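(* Let $\Sigma_t$ be an inverse mean curvature flow of closed embedded surfaces in $\mathbb{H}^3$. Then the modified Hawking mass $\tilde m(\Sigma_t)$ satisfies \[\frac{d}{dt}\tilde m(\Sigma_t)=|\Sigma_t|\int_{\Sigma_t}\frac{|\nabla H|^2}{H^2}\,d\mu_t .\]
   Context: $\mathbb{H}^3$ is hyperbolic 3-space (constant sectional curvature $-1$). For a closed embedded surface $\Sigma\subset\mathbb{H}^3$, $|\Sigma|$ is its area, $d\mu$ its area form, $A$ its second fundamental form, $H$ its mean curvature (trace of $A$ with respect to the outward normal, positive on geodesic spheres), and $\mathring A$ is the traceless part of $A$, so that $|A|^2=|\mathring A|^2+\frac12H^2$. The modified Hawking mass is \[\tilde m(\Sigma)=-|\Sigma|\int_\Sigma|\mathring A|^2\,d\mu .\] An inverse mean curvature flow is a smooth family of closed embedded surfaces $\Sigma_t$ with $H>0$ moving in the outward unit normal direction with speed $1/H$. Here $H$, the area form $d\mu_t$, the Levi-Civita connection $\nabla$ and the norm are those of $\Sigma_t$. *)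

theory Defs
  imports "HOL-Analysis.Analysis"
begin

subsection \<open>Smooth maps between open subsets of Euclidean spaces\<close>

primrec Ck_on :: "nat \<Rightarrow> 'a::euclidean_space set \<Rightarrow> ('a \<Rightarrow> 'b::real_normed_vector) \<Rightarrow> bool"
where
  "Ck_on 0 S f \<longleftrightarrow> continuous_on S f"
| "Ck_on (Suc k) S f \<longleftrightarrow>
     (\<forall>x\<in>S. f differentiable (at x)) \<and>
     (\<forall>v. Ck_on k S (\<lambda>x. frechet_derivative f (at x) v))"

definition smooth_on :: "'a::euclidean_space set \<Rightarrow> ('a \<Rightarrow> 'b::real_normed_vector) \<Rightarrow> bool"
  where "smooth_on S f \<longleftrightarrow> (\<forall>k. Ck_on k S f)"

definition pderiv2 :: "2 \<Rightarrow> (real^2 \<Rightarrow> 'b::real_normed_vector) \<Rightarrow> real^2 \<Rightarrow> 'b"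
  where "pderiv2 i f u = frechet_derivative f (at u) (axis i 1)"


subsection \<open>Hyperbolic 3-space\<close>

text \<open>The hyperboloid model: the upper sheet of the unit hyperboloid in Minkowski space,
  with the Riemannian metric (of constant curvature \<open>-1\<close>) induced by the Lorentz form.\<close>

type_synonym minkowski = "(real^3) \<times> real"

definition lorentz :: "minkowski \<Rightarrow> minkowski \<Rightarrow> real"
  where "lorentz x y = fst x \<bullet> fst y - snd x * snd y"

definition hyp3 :: "minkowski set"
  where "hyp3 = {x. lorentz x x = -1 \<and> snd x > 0}"

text \<open>Lorentz-orthogonal projection onto the tangent space at \<open>p\<close>. The Levi-Civita
  connection of hyperbolic space is the flat derivative followed by this projection.\<close>

definition hyp_tangent_proj :: "minkowski \<Rightarrow> minkowski \<Rightarrow> minkowski"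
  where "hyp_tangent_proj p v = v + lorentz v p *\<^sub>R p"

text \<open>The unit-speed geodesic starting at \<open>p\<close> in the unit tangent direction \<open>v\<close>.\<close>

definition hyp_geodesic :: "minkowski \<Rightarrow> minkowski \<Rightarrow> real \<Rightarrow> minkowski"
  where "hyp_geodesic p v s = cosh s *\<^sub>R p + sinh s *\<^sub>R v"

text \<open>Inside and outside of a set, relative to hyperbolic space. A subset of the hyperboloid is
  bounded for the hyperbolic distance iff it is bounded in the Euclidean norm of the ambient
  space.\<close>

definition hyp_inside :: "minkowski set \<Rightarrow> minkowski set"
  where "hyp_inside S =
    {x \<in> hyp3 - S. bounded (connected_component_set (hyp3 - S) x)}"

definition hyp_outside :: "minkowski set \<Rightarrow> minkowski set"
  where "hyp_outside S =
    {x \<in> hyp3 - S. \<not> bounded (connected_component_set (hyp3 - S) x)}"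


subsection \<open>Closed surfaces\<close>

text \<open>A chart is given by its inverse, a local parametrisation
  \<open>\<phi>\<close> defined on an open set \<open>U\<close>. As the surface is compact, its smooth structure is given by a
  finite atlas, listed in some order.\<close>

type_synonym 'm chart = "(real^2) set \<times> (real^2 \<Rightarrow> 'm)"

definition closed_surface :: "'m::t2_space set \<Rightarrow> 'm chart list \<Rightarrow> bool"
  where "closed_surface M cs \<longleftrightarrow>
    compact M \<and>
    (\<forall>(U, \<phi>) \<in> set cs. open U \<and> openin (top_of_set M) (\<phi> ` U) \<and>
       (\<exists>\<psi>. homeomorphism U (\<phi> ` U) \<phi> \<psi>)) \<and>
    M = (\<Union>(U, \<phi>) \<in> set cs. \<phi> ` U) \<and>
    (\<forall>(U, \<phi>) \<in> set cs. \<forall>(V, \<psi>) \<in> set cs.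
       smooth_on {u \<in> U. \<phi> u \<in> \<psi> ` V} (\<lambda>u. inv_into V \<psi> (\<phi> u)))"

definition embedded_in_hyp3 ::
    "'m::t2_space set \<Rightarrow> 'm chart list \<Rightarrow> ('m \<Rightarrow> minkowski) \<Rightarrow> bool"
  where "embedded_in_hyp3 M cs f \<longleftrightarrow>
    f ` M \<subseteq> hyp3 \<and>
    (\<exists>g. homeomorphism M (f ` M) f g) \<and>
    (\<forall>(U, \<phi>) \<in> set cs. smooth_on U (f \<circ> \<phi>) \<and>
       (\<forall>u\<in>U. inj (frechet_derivative (f \<circ> \<phi>) (at u))))"

definition outward_unit_normal ::
    "'m::t2_space set \<Rightarrow> 'm chart list \<Rightarrow> ('m \<Rightarrow> minkowski) \<Rightarrow> ('m \<Rightarrow> minkowski) \<Rightarrow> bool"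
  where "outward_unit_normal M cs f \<nu> \<longleftrightarrow>
    (\<forall>p\<in>M. lorentz (\<nu> p) (f p) = 0 \<and> lorentz (\<nu> p) (\<nu> p) = 1 \<and>
       (\<exists>\<epsilon>>0. \<forall>s. 0 < s \<and> s < \<epsilon> \<longrightarrow>
          hyp_geodesic (f p) (\<nu> p) s \<in> hyp_outside (f ` M) \<and>
          hyp_geodesic (f p) (\<nu> p) (- s) \<in> hyp_inside (f ` M))) \<and>
    (\<forall>(U, \<phi>) \<in> set cs. \<forall>u\<in>U. \<forall>i. lorentz (\<nu> (\<phi> u)) (pderiv2 i (f \<circ> \<phi>) u) = 0)"


subsection \<open>Local geometry\<close>

text \<open>Here \<open>X\<close> is a local parametrisation of a surface in hyperbolic space and \<open>N\<close> its unit
  normal, both as functions of the coordinates \<open>u\<close>.\<close>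

definition first_ff :: "(real^2 \<Rightarrow> minkowski) \<Rightarrow> real^2 \<Rightarrow> real^2^2"
  where "first_ff X u = (\<chi> i j. lorentz (pderiv2 i X u) (pderiv2 j X u))"

text \<open>The sign makes geodesic spheres positively curved with respect to the outward normal.\<close>

definition second_ff ::
    "(real^2 \<Rightarrow> minkowski) \<Rightarrow> (real^2 \<Rightarrow> minkowski) \<Rightarrow> real^2 \<Rightarrow> real^2^2"
  where "second_ff X N u =
    (\<chi> i j. - lorentz (hyp_tangent_proj (X u) (pderiv2 i (pderiv2 j X) u)) (N u))"

definition mean_curv ::
    "(real^2 \<Rightarrow> minkowski) \<Rightarrow> (real^2 \<Rightarrow> minkowski) \<Rightarrow> real^2 \<Rightarrow> real"
  where "mean_curv X N u = trace (matrix_inv (first_ff X u) ** second_ff X N u)"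

definition traceless_ff ::
    "(real^2 \<Rightarrow> minkowski) \<Rightarrow> (real^2 \<Rightarrow> minkowski) \<Rightarrow> real^2 \<Rightarrow> real^2^2"
  where "traceless_ff X N u = second_ff X N u - (mean_curv X N u / 2) *\<^sub>R first_ff X u"

definition tensor_norm_sq :: "real^2^2 \<Rightarrow> real^2^2 \<Rightarrow> real"
  where "tensor_norm_sq g T =
    (let h = matrix_inv g in
     \<Sum>i\<in>UNIV. \<Sum>j\<in>UNIV. \<Sum>k\<in>UNIV. \<Sum>l\<in>UNIV. h$i$k * h$j$l * T$i$j * T$k$l)"

definition traceless_norm_sq ::
    "(real^2 \<Rightarrow> minkowski) \<Rightarrow> (real^2 \<Rightarrow> minkowski) \<Rightarrow> real^2 \<Rightarrow> real"
  where "traceless_norm_sq X N u = tensor_norm_sq (first_ff X u) (traceless_ff X N u)"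

definition grad_norm_sq :: "(real^2 \<Rightarrow> minkowski) \<Rightarrow> (real^2 \<Rightarrow> real) \<Rightarrow> real^2 \<Rightarrow> real"
  where "grad_norm_sq X w u =
    (\<Sum>i\<in>UNIV. \<Sum>j\<in>UNIV. matrix_inv (first_ff X u) $ i $ j * pderiv2 i w u * pderiv2 j w u)"


subsection \<open>Integration over a closed surface\<close>

text \<open>The images of the pieces below partition the surface into Borel sets, each contained in the
  image of one chart. The integral of a function against the area form is the sum over the pieces
  of its coordinate integrals against \<open>sqrt (det g)\<close>; by the change of variables formula it does
  not depend on the atlas. The integrand \<open>Q\<close> assigns to each
  local parametrisation \<open>\<phi>\<close> the expression of the function in the coordinates of \<open>\<phi>\<close>.\<close>

definition chart_piece :: "'m chart list \<Rightarrow> nat \<Rightarrow> (real^2) set"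
  where "chart_piece cs i =
    {u \<in> fst (cs ! i). snd (cs ! i) u \<notin> (\<Union>j<i. snd (cs ! j) ` fst (cs ! j))}"

definition surface_integral ::
    "'m chart list \<Rightarrow> ('m \<Rightarrow> minkowski) \<Rightarrow> ((real^2 \<Rightarrow> 'm) \<Rightarrow> real^2 \<Rightarrow> real) \<Rightarrow> real"
  where "surface_integral cs f Q =
    (\<Sum>i<length cs. let \<phi> = snd (cs ! i) in
       LINT u:chart_piece cs i|lborel. Q \<phi> u * sqrt (det (first_ff (f \<circ> \<phi>) u)))"

definition surface_area :: "'m chart list \<Rightarrow> ('m \<Rightarrow> minkowski) \<Rightarrow> real"
  where "surface_area cs f = surface_integral cs f (\<lambda>\<phi> u. 1)"

definition modified_hawking_mass ::
    "'m chart list \<Rightarrow> ('m \<Rightarrow> minkowski) \<Rightarrow> ('m \<Rightarrow> minkowski) \<Rightarrow> real"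
  where "modified_hawking_mass cs f \<nu> =
    - surface_area cs f * surface_integral cs f (\<lambda>\<phi>. traceless_norm_sq (f \<circ> \<phi>) (\<nu> \<circ> \<phi>))"


subsection \<open>Inverse mean curvature flow\<close>

text \<open>The surfaces are \<open>F t ` M\<close> for \<open>t\<close> in the open interval \<open>I\<close>, and \<open>\<nu> t\<close> is the outward unit
  normal of the surface at time \<open>t\<close>, as a function on \<open>M\<close>.\<close>

definition inverse_mean_curvature_flow ::
    "'m::t2_space set \<Rightarrow> 'm chart list \<Rightarrow> real set \<Rightarrow>
     (real \<Rightarrow> 'm \<Rightarrow> minkowski) \<Rightarrow> (real \<Rightarrow> 'm \<Rightarrow> minkowski) \<Rightarrow> bool"
  where "inverse_mean_curvature_flow M cs I F \<nu> \<longleftrightarrow>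
    closed_surface M cs \<and> open I \<and> is_interval I \<and>
    (\<forall>(U, \<phi>) \<in> set cs. smooth_on (U \<times> I) (\<lambda>(u, t). F t (\<phi> u))) \<and>
    (\<forall>t\<in>I. embedded_in_hyp3 M cs (F t) \<and> outward_unit_normal M cs (F t) (\<nu> t)) \<and>
    (\<forall>t\<in>I. \<forall>(U, \<phi>) \<in> set cs. \<forall>u\<in>U.
       let H = mean_curv (F t \<circ> \<phi>) (\<nu> t \<circ> \<phi>) u in
       H > 0 \<and> ((\<lambda>s. F s (\<phi> u)) has_vector_derivative (1 / H) *\<^sub>R \<nu> t (\<phi> u)) (at t))"

end

theory Submission
  imports Defs
begin

text \<open>
  The velocity \<open>\<partial>F/\<partial>t = \<nu>/H\<close> is a derivative of the smooth map \<open>F\<close>, so \<open>\<nu>\<close> and \<open>H\<close> are smooth, and with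
  \<open>f = 1/H\<close> the structure equations of the hyperboloid give \<open>\<partial>g = 2 f h\<close>, \<open>\<partial>(d\<mu>) = d\<mu>\<close> and
  \<open>\<partial>h = - \<nabla>\<^sup>2 f + f h\<^sup>2 + f g\<close>. As the traceless part \<open>A\<^sub>0\<close> satisfies the Codazzi equation
  \<open>div A\<^sub>0 = \<nabla>H / 2\<close>, the area density of \<open>|A\<^sub>0|\<^sup>2\<close> obeys
  \<open>\<partial>(|A\<^sub>0|\<^sup>2 d\<mu>) = (- 2 div (A\<^sub>0 \<nabla>f) - |\<nabla>H|\<^sup>2 / H\<^sup>2 - |A\<^sub>0|\<^sup>2) d\<mu>\<close>.
  Integrating kills the divergence, and the last term cancels against the growth
  \<open>\<partial>|\<Sigma>| = |\<Sigma>|\<close> of the area in the product \<open>- |\<Sigma>| \<integral> |A\<^sub>0|\<^sup>2 d\<mu>\<close>.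

  The integral over the surface is localised by a partition of unity that does not depend on time;
  each localised integral runs over a box inside one chart, where differentiation under the integral
  sign and integration by parts are elementary.
\<close>

subsection \<open>Calculus of smooth maps\<close>

text \<open>No abstract connection is used. In the linear ambient space partial derivatives commute,
  so the structure equations come from swapping derivatives of the space-time map \<open>Y\<close>
  and expanding products in the frame \<open>Y\<close>, \<open>T\<close>, \<open>X 1\<close>,
  \<open>X 2\<close>; the curvature -1 enters only through the components along the position vector
  \<open>Y\<close>. The evolution of \<open>H\<close> is not derived separately: the speed law says
  that \<open>k = h / H\<close> has trace 1, and differentiating this constraint in time yields the
  derivative of \<open>w = 1 / H^2\<close>. The obstacle is the integral, which is defined on
  disjoint Borel pieces of charts, where integration by parts would produce boundary terms. Hence
  the change of variables that moves the pieces into one chart. The divergence itself is never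
  compared between charts, which would bring in second derivatives of the chart changes. Only the
  pairing of the field with the differential of a function is, and the divergence theorem says that
  the pairings with the differentials of a partition of unity add up to the pairing with the
  differential of the constant 1.\<close>

definition dird :: "'a::real_normed_vector \<Rightarrow> ('a \<Rightarrow> 'b::real_normed_vector) \<Rightarrow> 'a \<Rightarrow> 'b"
  where "dird v f x = frechet_derivative f (at x) v"

lemma dird_eq:
  "(f has_derivative f') (at x) \<Longrightarrow> dird v f x = f' v"
  unfolding dird_def by (metis frechet_derivative_at)

lemma Ck_on_Suc: "Ck_on (Suc k) S f \<longleftrightarrow>
    (\<forall>x\<in>S. f differentiable (at x)) \<and> (\<forall>v. Ck_on k S (dird v f))"
  by (simp add: dird_def[abs_def])

declare Ck_on.simps(2) [simp del]

lemma dird_cong: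
  assumes "open S" "x \<in> S" "\<And>y. y \<in> S \<Longrightarrow> f y = g y"
  shows "dird v f x = dird v g x"
proof -
  have "(f has_derivative D) (at x) \<longleftrightarrow> (g has_derivative D) (at x)" for D
    using has_derivative_transform_within_open[of f D x UNIV S g]
      has_derivative_transform_within_open[of g D x UNIV S f] assms by auto
  then show ?thesis by (simp add: dird_def frechet_derivative_def)
qed

lemma differentiable_cong_open:
  assumes "open S" "x \<in> S" "\<And>y. y \<in> S \<Longrightarrow> f y = g y"
  shows "f differentiable (at x) \<longleftrightarrow> g differentiable (at x)"
proof -
  have "(f has_derivative D) (at x) \<longleftrightarrow> (g has_derivative D) (at x)" for D
    using has_derivative_transform_within_open[of f D x UNIV S g]
      has_derivative_transform_within_open[of g D x UNIV S f] assms by auto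
  then show ?thesis by (simp add: differentiable_def)
qed

lemma Ck_on_cong:
  assumes "open S" "\<And>y. y \<in> S \<Longrightarrow> f y = g y"
  shows "Ck_on k S f \<longleftrightarrow> Ck_on k S g"
  using assms(2)
proof (induction k arbitrary: f g)
  case 0
  then show ?case by (auto intro!: continuous_on_cong)
next
  case (Suc k)
  have "Ck_on k S (dird v f) \<longleftrightarrow> Ck_on k S (dird v g)" for v
    using dird_cong[OF assms(1)] Suc by blast
  moreover have "f differentiable (at x) \<longleftrightarrow> g differentiable (at x)" if "x \<in> S" for x
    using differentiable_cong_open[OF assms(1) that] Suc.prems by blast
  ultimately show ?case by (simp add: Ck_on_Suc)
qed

lemma Ck_on_imp_continuous: "Ck_on k S f \<Longrightarrow> continuous_on S f"
  by (cases k) (auto simp: Ck_on_Suc continuous_on_eq_continuous_at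
    intro!: continuous_at_imp_continuous_on differentiable_imp_continuous_within)

lemma Ck_on_SucD: "Ck_on (Suc k) S f \<Longrightarrow> Ck_on k S f"
proof (induction k arbitrary: f)
  case 0 then show ?case using Ck_on_imp_continuous by auto
next
  case (Suc k) then show ?case by (metis Ck_on_Suc)
qed

text \<open>\<open>Ck_on\<close> uses full derivatives \<open>at x\<close>, so on open sets it is a
  local property. This is what allows functions to be extended by zero.\<close>

lemma Ck_on_Un: "Ck_on k S f \<Longrightarrow> Ck_on k T f \<Longrightarrow> open S \<Longrightarrow> open T \<Longrightarrow> Ck_on k (S \<union> T) f"
  by (induction k arbitrary: f) (auto simp: Ck_on_Suc continuous_on_open_Un)

lemma Ck_on_const [intro]:
  fixes S :: "'a::euclidean_space set" and c :: "'b::real_normed_vector"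
  shows "Ck_on k S (\<lambda>x. c)"
proof (induction k arbitrary: c)
  case (Suc k)
  have "dird v (\<lambda>x::'a. c) = (\<lambda>x. 0)" for v :: 'a and c :: 'b by (simp add: dird_def fun_eq_iff)
  then show ?case by (simp add: Ck_on_Suc Suc)
qed auto

lemma Ck_on_add:
  assumes "open S" "Ck_on k S f" "Ck_on k S g"
  shows "Ck_on k S (\<lambda>x. f x + g x)"
  using assms(2,3)
proof (induction k arbitrary: f g)
  case 0
  then show ?case by (auto intro: continuous_intros)
next
  case (Suc k)
  have der: "((\<lambda>x. f x + g x) has_derivative (\<lambda>v. dird v f x + dird v g x)) (at x)" if "x \<in> S" for x
    using Suc.prems that unfolding Ck_on_Suc dird_def
    by (intro has_derivative_add) (auto simp: frechet_derivative_works)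
  have "Ck_on k S (\<lambda>x. dird v f x + dird v g x)" for v
    using Suc by (auto simp: Ck_on_Suc)
  then have "Ck_on k S (dird v (\<lambda>x. f x + g x))" for v
    using Ck_on_cong[OF \<open>open S\<close>, of "dird v (\<lambda>x. f x + g x)"] dird_eq[OF der]
    by (metis (no_types, lifting))
  then show ?case using der by (auto simp: Ck_on_Suc differentiable_def)
qed

lemma Ck_on_bilinear:
  assumes B: "bounded_bilinear B" and "open S" "Ck_on k S f" "Ck_on k S g"
  shows "Ck_on k S (\<lambda>x. B (f x) (g x))"
  using assms(3,4)
proof (induction k arbitrary: f g)
  case 0
  then show ?case using bounded_bilinear.continuous_on[OF B] by auto
next
  case (Suc k)
  have der: "((\<lambda>x. B (f x) (g x)) has_derivative
      (\<lambda>v. B (f x) (dird v g x) + B (dird v f x) (g x))) (at x)" if "x \<in> S" for x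
  proof -
    have "(f has_derivative (\<lambda>v. dird v f x)) (at x)" "(g has_derivative (\<lambda>v. dird v g x)) (at x)"
      using Suc.prems that unfolding Ck_on_Suc dird_def by (auto simp: frechet_derivative_works)
    from bounded_bilinear.FDERIV[OF B this] show ?thesis .
  qed
  have "Ck_on k S (\<lambda>x. B (f x) (dird v g x) + B (dird v f x) (g x))" for v
    using Suc.prems by (intro Ck_on_add Suc.IH \<open>open S\<close>) (auto simp: Ck_on_Suc intro: Ck_on_SucD)
  then have "Ck_on k S (dird v (\<lambda>x. B (f x) (g x)))" for v
    using Ck_on_cong[OF \<open>open S\<close>, of "dird v (\<lambda>x. B (f x) (g x))"] dird_eq[OF der] by (metis (no_types, lifting))
  then show ?case using der by (auto simp: Ck_on_Suc differentiable_def)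
qed

lemma Ck_on_linear:
  assumes L: "bounded_linear L" and "open S" "Ck_on k S f"
  shows "Ck_on k S (\<lambda>x. L (f x))"
proof -
  \<comment> \<open>A linear map is treated as a bilinear one whose scalar argument is frozen at
    1.\<close>
  have "bounded_bilinear (\<lambda>(r::real) y. r *\<^sub>R L y)"
    using bounded_bilinear.comp[OF bounded_bilinear_scaleR bounded_linear_ident L] .
  from Ck_on_bilinear[OF this \<open>open S\<close> _ assms(3), of "\<lambda>x. 1"] show ?thesis
    by (simp add: Ck_on_const)
qed

lemma Ck_on_ident: "Ck_on k S (\<lambda>x. x)"
  by (cases k) (auto simp: Ck_on_Suc dird_def[abs_def] intro!: continuous_intros Ck_on_const)

text \<open>Order one suffices for the \<open>C^1\<close> bump functions. The direction in which
  \<open>f\<close> is differentiated moves with \<open>x\<close>, so it is expanded in the basis to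
  exhibit continuity of the derivative.\<close>

lemma Ck_on_compose1:
  fixes f :: "'b::euclidean_space \<Rightarrow> 'c::real_normed_vector"
    and g :: "'a::euclidean_space \<Rightarrow> 'b"
  assumes "open S" "Ck_on 1 T f" "Ck_on 1 S g" "g ` S \<subseteq> T"
  shows "Ck_on 1 S (\<lambda>x. f (g x))"
proof -
  have g: "(g has_derivative (\<lambda>v. dird v g x)) (at x)" if "x \<in> S" for x
    using that assms(3) by (auto simp: Ck_on_Suc dird_def frechet_derivative_works)
  have f: "(f has_derivative (\<lambda>v. dird v f (g x))) (at (g x))" if "x \<in> S" for x
    using that assms(2,4) by (auto simp: Ck_on_Suc dird_def frechet_derivative_works)
  have der: "((\<lambda>x. f (g x)) has_derivative (\<lambda>v. dird (dird v g x) f (g x))) (at x)" if "x \<in> S" for x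
    using diff_chain_at[OF g[OF that] f[OF that]] by (simp add: o_def)
  have lin: "dird w f (g x) = (\<Sum>b\<in>Basis. (w \<bullet> b) *\<^sub>R dird b f (g x))" if "x \<in> S" for w x
  proof -
    have "linear (\<lambda>v. dird v f (g x))" using f[OF that] has_derivative_linear by blast
    from linear_sum[OF this, of "\<lambda>b. (w \<bullet> b) *\<^sub>R b" Basis] show ?thesis
      by (simp add: euclidean_representation linear_cmul[OF \<open>linear _\<close>])
  qed
  have "continuous_on S (\<lambda>x. \<Sum>b\<in>Basis. (dird v g x \<bullet> b) *\<^sub>R dird b f (g x))" for v
  proof (intro continuous_intros)
    show "continuous_on S (dird v g)" using assms(3) by (simp add: Ck_on_Suc)
    fix b :: 'b
    have "continuous_on T (dird b f)" using assms(2) by (simp add: Ck_on_Suc)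
    then show "continuous_on S (\<lambda>x. dird b f (g x))"
      using continuous_on_compose2 Ck_on_imp_continuous[OF assms(3)] assms(4) by blast
  qed
  then have "continuous_on S (dird v (\<lambda>x. f (g x)))" for v
    using dird_eq[OF der] lin by (simp cong: continuous_on_cong)
  then show ?thesis using der by (auto simp: Ck_on_Suc differentiable_def)
qed

text \<open>The derivative of \<open>1 / f\<close> contains \<open>1 / f\<close> only
  undifferentiated, so order \<open>k\<close> of the inverse gives order \<open>k + 1\<close>
  without a chain rule of higher order. \<open>Ck_on_sqrt\<close> rests on the same
  observation.\<close>

lemma Ck_on_inverse:
  fixes f :: "'a::euclidean_space \<Rightarrow> real"
  assumes "open S" "Ck_on k S f" "\<And>x. x \<in> S \<Longrightarrow> f x \<noteq> 0"
  shows "Ck_on k S (\<lambda>x. inverse (f x))"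
  using assms(2)
proof (induction k)
  case 0
  then show ?case using assms(3) by (auto intro!: continuous_on_inverse)
next
  case (Suc k)
  have der: "((\<lambda>x. inverse (f x)) has_derivative
      (\<lambda>v. - (inverse (f x) * dird v f x * inverse (f x)))) (at x)" if "x \<in> S" for x
    using Suc.prems that assms(3) unfolding Ck_on_Suc dird_def
    by (intro Deriv.has_derivative_inverse) (auto simp: frechet_derivative_works)
  have "Ck_on k S (\<lambda>x. - (inverse (f x) * dird v f x * inverse (f x)))" for v
    using Suc.prems Suc.IH[OF Ck_on_SucD[OF Suc.prems]]
    by (intro Ck_on_linear[OF bounded_linear_minus[OF bounded_linear_ident]]
        Ck_on_bilinear[OF bounded_bilinear_mult] \<open>open S\<close>)
      (auto simp: Ck_on_Suc)
  then have "Ck_on k S (dird v (\<lambda>x. inverse (f x)))" for v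
    using Ck_on_cong[OF \<open>open S\<close>, of "dird v (\<lambda>x. inverse (f x))"] dird_eq[OF der]
    by (metis (no_types, lifting))
  then show ?case using der by (auto simp: Ck_on_Suc differentiable_def)
qed

lemma Ck_on_sqrt:
  fixes f :: "'a::euclidean_space \<Rightarrow> real"
  assumes "open S" "Ck_on k S f" "\<And>x. x \<in> S \<Longrightarrow> f x > 0"
  shows "Ck_on k S (\<lambda>x. sqrt (f x))"
  using assms(2)
proof (induction k)
  case 0
  then show ?case by (auto intro!: continuous_on_real_sqrt)
next
  case (Suc k)
  have der: "((\<lambda>x. sqrt (f x)) has_derivative
      (\<lambda>v. dird v f x * inverse (2 * sqrt (f x)))) (at x)" if "x \<in> S" for x
  proof -
    have "(f has_derivative (\<lambda>v. dird v f x)) (at x)"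
      using Suc.prems that unfolding Ck_on_Suc dird_def by (auto simp: frechet_derivative_works)
    from has_derivative_real_sqrt[OF _ this] show ?thesis
      using assms(3)[OF that] by (simp add: field_simps)
  qed
  have "Ck_on k S (\<lambda>x. dird v f x * inverse (2 * sqrt (f x)))" for v
    using Suc.prems Suc.IH[OF Ck_on_SucD[OF Suc.prems]]
    by (intro Ck_on_inverse Ck_on_bilinear[OF bounded_bilinear_mult] \<open>open S\<close>)
      (use assms(3) in \<open>force simp: Ck_on_Suc\<close>)+
  then have "Ck_on k S (dird v (\<lambda>x. sqrt (f x)))" for v
    using Ck_on_cong[OF \<open>open S\<close>, of "dird v (\<lambda>x. sqrt (f x))"] dird_eq[OF der]
    by (metis (no_types, lifting))
  then show ?case using der by (auto simp: Ck_on_Suc differentiable_def)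
qed

section \<open>Closure properties of smooth maps and derivatives along lines\<close>

named_theorems smooth_intros

lemma smooth_on_dird [smooth_intros]: "smooth_on S f \<Longrightarrow> smooth_on S (dird v f)"
  unfolding smooth_on_def by (metis Ck_on_Suc)

lemma smooth_on_add [smooth_intros]:
  "open S \<Longrightarrow> smooth_on S f \<Longrightarrow> smooth_on S g \<Longrightarrow> smooth_on S (\<lambda>x. f x + g x)"
  by (simp add: smooth_on_def Ck_on_add)

lemma smooth_on_const [smooth_intros]: "smooth_on S (\<lambda>x. c)"
  by (simp add: smooth_on_def Ck_on_const)

lemma smooth_on_minus [smooth_intros]:
  "open S \<Longrightarrow> smooth_on S f \<Longrightarrow> smooth_on S (\<lambda>x. - f x)"
  by (simp add: smooth_on_def Ck_on_linear[OF bounded_linear_minus[OF bounded_linear_ident]])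

lemma smooth_on_diff [smooth_intros]:
  "open S \<Longrightarrow> smooth_on S f \<Longrightarrow> smooth_on S g \<Longrightarrow> smooth_on S (\<lambda>x. f x - g x)"
  using smooth_on_add[of S f "\<lambda>x. - g x"] smooth_on_minus[of S g] by simp

lemma smooth_on_bilinear:
  "bounded_bilinear B \<Longrightarrow> open S \<Longrightarrow> smooth_on S f \<Longrightarrow> smooth_on S g \<Longrightarrow>
    smooth_on S (\<lambda>x. B (f x) (g x))"
  by (simp add: smooth_on_def Ck_on_bilinear)

lemma smooth_on_mult [smooth_intros]:
  fixes f g :: "'a::euclidean_space \<Rightarrow> real"
  shows "open S \<Longrightarrow> smooth_on S f \<Longrightarrow> smooth_on S g \<Longrightarrow> smooth_on S (\<lambda>x. f x * g x)"
  by (rule smooth_on_bilinear[OF bounded_bilinear_mult])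

lemma smooth_on_power [smooth_intros]:
  fixes f :: "'a::euclidean_space \<Rightarrow> real"
  shows "open S \<Longrightarrow> smooth_on S f \<Longrightarrow> smooth_on S (\<lambda>x. f x ^ n)"
  by (induction n) (auto intro: smooth_intros)

lemma smooth_on_divide [smooth_intros]:
  fixes f g :: "'a::euclidean_space \<Rightarrow> real"
  assumes "open S" "smooth_on S f" "smooth_on S g" "\<And>x. x \<in> S \<Longrightarrow> g x \<noteq> 0"
  shows "smooth_on S (\<lambda>x. f x / g x)"
  using smooth_on_mult[OF assms(1,2), of "\<lambda>x. inverse (g x)"] Ck_on_inverse[OF assms(1)] assms(3,4)
  by (simp add: smooth_on_def field_simps)

lemma smooth_on_sqrt [smooth_intros]:
  fixes f :: "'a::euclidean_space \<Rightarrow> real"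
  shows "open S \<Longrightarrow> smooth_on S f \<Longrightarrow> (\<And>x. x \<in> S \<Longrightarrow> f x > 0) \<Longrightarrow> smooth_on S (\<lambda>x. sqrt (f x))"
  by (simp add: smooth_on_def Ck_on_sqrt)

lemma smooth_on_imp_continuous: "smooth_on S f \<Longrightarrow> continuous_on S f"
  unfolding smooth_on_def using Ck_on_imp_continuous by blast

lemma smooth_on_has_derivative:
  "smooth_on S f \<Longrightarrow> x \<in> S \<Longrightarrow> (f has_derivative (\<lambda>v. dird v f x)) (at x)"
  unfolding smooth_on_def dird_def by (metis Ck_on_Suc frechet_derivative_works)

lemma smooth_on_line_derivative:
  assumes "smooth_on S f" "x + r *\<^sub>R v \<in> S"
  shows "((\<lambda>r. f (x + r *\<^sub>R v)) has_vector_derivative dird v f (x + r *\<^sub>R v)) (at r)"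
proof -
  have f: "(f has_derivative (\<lambda>w. dird w f (x + r *\<^sub>R v))) (at (x + r *\<^sub>R v))"
    using smooth_on_has_derivative[OF assms] .
  have "((\<lambda>r. x + r *\<^sub>R v) has_derivative (\<lambda>r. r *\<^sub>R v)) (at r)"
    by (auto intro!: derivative_eq_intros)
  from diff_chain_at[OF this f] show ?thesis
    using linear_cmul[OF has_derivative_linear[OF f]] by (simp add: has_vector_derivative_def o_def)
qed

lemma smooth_on_DERIV:
  fixes f :: "'a::euclidean_space \<Rightarrow> real"
  assumes "smooth_on S f" "x \<in> S"
  shows "((\<lambda>r. f (x + r *\<^sub>R v)) has_real_derivative dird v f x) (at 0)"
  using smooth_on_line_derivative[OF assms(1), of x 0 v] assms(2)
  by (simp add: has_real_derivative_iff_has_vector_derivative)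

text \<open>Lets the one-variable rules compute directional derivatives. Smoothness has to be known
  beforehand, since a derivative along one line does not give differentiability.\<close>

lemma dird_DERIV_unique:
  fixes f :: "'a::euclidean_space \<Rightarrow> real"
  assumes "smooth_on S f" "x \<in> S" "((\<lambda>r. f (x + r *\<^sub>R v)) has_real_derivative d) (at 0)"
  shows "dird v f x = d"
  using DERIV_unique[OF smooth_on_DERIV[OF assms(1,2)] assms(3)] .

text \<open>The mean value theorem is applied twice, first along \<open>v\<close> to the difference
  of two translates, then along \<open>w\<close> to the derivative.\<close>

lemma second_difference_mean_value:
  fixes f :: "'a::euclidean_space \<Rightarrow> real"
  assumes f: "smooth_on S f" and h: "h > 0"
    and S: "\<And>a b. 0 \<le> a \<Longrightarrow> a \<le> h \<Longrightarrow> 0 \<le> b \<Longrightarrow> b \<le> h \<Longrightarrow> x + a *\<^sub>R v + b *\<^sub>R w \<in> S"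
  obtains a b where "0 < a" "a < h" "0 < b" "b < h"
    "f (x + h *\<^sub>R v + h *\<^sub>R w) - f (x + h *\<^sub>R v) - f (x + h *\<^sub>R w) + f x
      = h\<^sup>2 * dird w (dird v f) (x + a *\<^sub>R v + b *\<^sub>R w)"
proof -
  have line: "((\<lambda>r. g (y + r *\<^sub>R u)) has_real_derivative dird u g (y + r *\<^sub>R u)) (at r)"
    if "smooth_on S g" "y + r *\<^sub>R u \<in> S" for g :: "'a \<Rightarrow> real" and y r u
    using smooth_on_line_derivative[OF that]
    by (simp add: has_real_derivative_iff_has_vector_derivative)
  let ?\<phi> = "\<lambda>a. f ((x + h *\<^sub>R w) + a *\<^sub>R v) - f (x + a *\<^sub>R v)"
  have "(?\<phi> has_real_derivative dird v f ((x + h *\<^sub>R w) + a *\<^sub>R v) - dird v f (x + a *\<^sub>R v)) (at a)"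
    if "0 \<le> a" "a \<le> h" for a
    using S[of a h] S[of a 0] that h
    by (intro DERIV_diff line[OF f]) (auto simp: algebra_simps)
  from MVT2[OF h this] obtain a where a: "0 < a" "a < h"
    "?\<phi> h - ?\<phi> 0 = h * (dird v f ((x + h *\<^sub>R w) + a *\<^sub>R v) - dird v f (x + a *\<^sub>R v))"
    by auto
  have "((\<lambda>b. dird v f ((x + a *\<^sub>R v) + b *\<^sub>R w)) has_real_derivative
      dird w (dird v f) ((x + a *\<^sub>R v) + b *\<^sub>R w)) (at b)" if "0 \<le> b" "b \<le> h" for b
    using S[of a b] that a by (intro line smooth_on_dird f) auto
  from MVT2[OF h this] obtain b where b: "0 < b" "b < h"
    "dird v f (x + a *\<^sub>R v + h *\<^sub>R w) - dird v f (x + a *\<^sub>R v)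
      = h * dird w (dird v f) (x + a *\<^sub>R v + b *\<^sub>R w)"
    by auto
  show ?thesis
    using that[of a b] a b by (simp add: algebra_simps power2_eq_square)
qed

text \<open>The second difference is symmetric in \<open>v\<close> and \<open>w\<close>, so the two
  mixed derivatives agree at suitable points close to \<open>x\<close>; continuity carries the
  equality to \<open>x\<close>.\<close>

lemma dird_commute_real:
  fixes f :: "'a::euclidean_space \<Rightarrow> real"
  assumes "open S" "smooth_on S f" "x \<in> S"
  shows "dird v (dird w f) x = dird w (dird v f) x"
proof (rule ccontr)
  assume neq: "dird v (dird w f) x \<noteq> dird w (dird v f) x"
  \<comment> \<open>Half of the gap: values within \<open>e\<close> of the two unequal derivatives
    cannot coincide.\<close>
  define e where "e = \<bar>dird v (dird w f) x - dird w (dird v f) x\<bar> / 2"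
  have "e > 0" using neq by (simp add: e_def)
  have cont: "isCont (dird v (dird w f)) x" "isCont (dird w (dird v f)) x"
    using assms smooth_on_imp_continuous smooth_on_dird continuous_on_eq_continuous_at by metis+
  obtain d where d: "d > 0" "\<And>y. dist y x < d \<Longrightarrow> y \<in> S"
    "\<And>y. dist y x < d \<Longrightarrow> dist (dird v (dird w f) y) (dird v (dird w f) x) < e"
    "\<And>y. dist y x < d \<Longrightarrow> dist (dird w (dird v f) y) (dird w (dird v f) x) < e"
  proof -
    obtain d1 where "d1 > 0" "\<And>y. dist y x < d1 \<Longrightarrow> y \<in> S"
      using assms open_dist by blast
    moreover obtain d2 where "d2 > 0"
      "\<And>y. dist y x < d2 \<Longrightarrow> dist (dird v (dird w f) y) (dird v (dird w f) x) < e"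
      using cont(1) \<open>e > 0\<close> unfolding continuous_at_eps_delta by blast
    moreover obtain d3 where "d3 > 0"
      "\<And>y. dist y x < d3 \<Longrightarrow> dist (dird w (dird v f) y) (dird w (dird v f) x) < e"
      using cont(2) \<open>e > 0\<close> unfolding continuous_at_eps_delta by blast
    ultimately show ?thesis using that[of "min d1 (min d2 d3)"] by simp
  qed
  \<comment> \<open>This side keeps the whole parallelogram within distance \<open>d / 2\<close> of
    \<open>x\<close>; the summand 1 avoids division by zero when both directions vanish.\<close>
  define h where "h = d / (2 * (norm v + norm w + 1))"
  have nn: "norm v + norm w + 1 > 0" by (smt (verit) norm_ge_zero)
  then have "h > 0" using d(1) by (simp add: h_def)
  have near: "dist (x + a *\<^sub>R v + b *\<^sub>R w) x < d" if "0 \<le> a" "a \<le> h" "0 \<le> b" "b \<le> h" for a b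
  proof -
    have "dist (x + a *\<^sub>R v + b *\<^sub>R w) x \<le> a * norm v + b * norm w"
      using norm_triangle_ineq[of "a *\<^sub>R v" "b *\<^sub>R w"] that by (simp add: dist_norm)
    also have "\<dots> \<le> h * norm v + h * norm w"
      using that by (intro add_mono mult_right_mono) auto
    also have "\<dots> \<le> h * (norm v + norm w + 1)"
      using \<open>h > 0\<close> by (simp add: algebra_simps)
    also have "\<dots> = d / 2" using nn by (simp add: h_def field_simps)
    also have "\<dots> < d" using d(1) by simp
    finally show ?thesis .
  qed
  obtain a b where ab: "0 < a" "a < h" "0 < b" "b < h"
    "f (x + h *\<^sub>R v + h *\<^sub>R w) - f (x + h *\<^sub>R v) - f (x + h *\<^sub>R w) + f x
      = h\<^sup>2 * dird w (dird v f) (x + a *\<^sub>R v + b *\<^sub>R w)"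
    using second_difference_mean_value[OF assms(2) \<open>h > 0\<close>] near d(2) by blast
  have "x + a *\<^sub>R w + b *\<^sub>R v \<in> S" if "0 \<le> a" "a \<le> h" "0 \<le> b" "b \<le> h" for a b
    using near[OF that(3,4,1,2)] d(2) by (simp add: algebra_simps)
  then obtain a' b' where ab': "0 < a'" "a' < h" "0 < b'" "b' < h"
    "f (x + h *\<^sub>R w + h *\<^sub>R v) - f (x + h *\<^sub>R w) - f (x + h *\<^sub>R v) + f x
      = h\<^sup>2 * dird v (dird w f) (x + a' *\<^sub>R w + b' *\<^sub>R v)"
    using second_difference_mean_value[OF assms(2) \<open>h > 0\<close>] by blast
  have "h\<^sup>2 * dird w (dird v f) (x + a *\<^sub>R v + b *\<^sub>R w) = h\<^sup>2 * dird v (dird w f) (x + a' *\<^sub>R w + b' *\<^sub>R v)"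
    using ab(5) ab'(5) by (simp add: algebra_simps)
  then have "dird w (dird v f) (x + a *\<^sub>R v + b *\<^sub>R w) = dird v (dird w f) (x + b' *\<^sub>R v + a' *\<^sub>R w)"
    using \<open>h > 0\<close> by (simp add: algebra_simps)
  moreover have "dist (dird w (dird v f) (x + a *\<^sub>R v + b *\<^sub>R w)) (dird w (dird v f) x) < e"
    using ab by (intro d near) auto
  moreover have "dist (dird v (dird w f) (x + b' *\<^sub>R v + a' *\<^sub>R w)) (dird v (dird w f) x) < e"
    using ab' by (intro d near) auto
  ultimately have "dist (dird v (dird w f) x) (dird w (dird v f) x) < e + e"
    using dist_triangle_less_add by (metis dist_commute)
  then show False by (simp add: dist_real_def e_def)
qed

lemma dird_bounded_linear:
  assumes "bounded_linear L" "(f has_derivative (\<lambda>v. dird v f x)) (at x)"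
  shows "dird v (\<lambda>x. L (f x)) x = L (dird v f x)"
  using dird_eq[OF bounded_linear.has_derivative[OF assms]] .

lemma dird_commute:
  fixes f :: "'a::euclidean_space \<Rightarrow> 'b::euclidean_space"
  assumes "open S" "smooth_on S f" "x \<in> S"
  shows "dird v (dird w f) x = dird w (dird v f) x"
proof (rule euclidean_eqI)
  fix b :: 'b
  have sm: "smooth_on S (\<lambda>x. g x \<bullet> b)" if "smooth_on S g" for g :: "'a \<Rightarrow> 'b"
    using that assms(1) by (simp add: smooth_on_def Ck_on_linear[OF bounded_linear_inner_left])
  have comp: "dird u (\<lambda>y. g y \<bullet> b) y = dird u g y \<bullet> b" if "y \<in> S" "smooth_on S g" for g u y
    using dird_bounded_linear[OF bounded_linear_inner_left smooth_on_has_derivative[OF that(2,1)]] .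
  have "dird u (dird u' (\<lambda>y. f y \<bullet> b)) x = dird u (dird u' f) x \<bullet> b" for u u'
    using dird_cong[OF assms(1,3) comp[OF _ assms(2)]] comp[OF assms(3) smooth_on_dird[OF assms(2)]]
    by simp
  with dird_commute_real[OF assms(1) sm[OF assms(2)] assms(3)]
  show "dird v (dird w f) x \<bullet> b = dird w (dird v f) x \<bullet> b" by metis
qed

subsection \<open>Integrals in the coordinate plane\<close>

text \<open>Real values are embedded as \<open>real^1\<close> in order to apply the transformation
  formula for vector-valued functions.\<close>

lemma has_absolute_integral_change_of_variables_real:
  fixes f :: "real^'n::{finite,wellorder} \<Rightarrow> real" and g :: "real^'n::_ \<Rightarrow> real^'n::_"
  assumes "S \<in> sets lebesgue"
    and "\<And>x. x \<in> S \<Longrightarrow> (g has_derivative g' x) (at x within S)"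
    and "inj_on g S"
  shows "(\<lambda>x. \<bar>det (matrix (g' x))\<bar> * f (g x)) absolutely_integrable_on S \<and>
           integral S (\<lambda>x. \<bar>det (matrix (g' x))\<bar> * f (g x)) = b
     \<longleftrightarrow> f absolutely_integrable_on (g ` S) \<and> integral (g ` S) f = b"
  using has_absolute_integral_change_of_variables[OF assms, of "\<lambda>x. vec (f x) :: real^1" "vec b"]
  by (simp add: absolutely_integrable_on_1_iff integral_on_1_eq vec_eq_iff)

text \<open>Translation invariance replaces Fubini: the integral of \<open>G (x + r v)\<close> over
  a box that contains all the supports does not depend on \<open>r\<close>, and its derivative at
  \<open>r = 0\<close> is the integral of \<open>dird v G\<close>.\<close>

lemma integral_dird_eq_0:
  fixes g :: "'a::euclidean_space \<Rightarrow> real"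
  assumes U: "open U" "cbox a b \<subseteq> U" and g: "Ck_on 1 U g"
    and g0: "\<And>x. x \<in> U \<Longrightarrow> x \<notin> box a b \<Longrightarrow> g x = 0"
  shows "integral (cbox a b) (dird v g) = 0"
proof -
  \<comment> \<open>Extension by zero. It is \<open>C^1\<close> everywhere because \<open>U\<close>
    and the complement of the closed box are open and cover the space.\<close>
  define G where "G x = (if x \<in> cbox a b then g x else 0)" for x
  have G_U: "G x = g x" if "x \<in> U" for x
    using g0[OF that] box_subset_cbox by (auto simp: G_def)
  have G_out: "G x = 0" if "x \<in> - cbox a b" for x using that by (simp add: G_def)
  have "Ck_on 1 U G" using g Ck_on_cong[OF U(1) G_U] by simp
  moreover have op: "open (- cbox a b)" by (simp add: open_Compl closed_cbox)
  moreover have "Ck_on 1 (- cbox a b) G"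
    using Ck_on_cong[OF op, of G "\<lambda>x. 0"] G_out by (auto simp: Ck_on_const)
  ultimately have "Ck_on 1 (U \<union> - cbox a b) G" using U(1) Ck_on_Un by blast
  moreover have "U \<union> - cbox a b = UNIV" using U(2) by blast
  ultimately have C1: "Ck_on 1 UNIV G" by simp
  then have der: "(G has_derivative (\<lambda>w. dird w G x)) (at x)" for x
    by (auto simp: Ck_on_Suc dird_def frechet_derivative_works)
  have contG: "continuous_on UNIV G" using C1 Ck_on_imp_continuous by blast
  have contD: "continuous_on UNIV (dird v G)" using C1 by (simp add: Ck_on_Suc)
  have dG_out: "dird v G x = 0" if "x \<notin> cbox a b" for x
    using dird_cong[OF op, of x G "\<lambda>x. 0" v] G_out that by (simp add: dird_def)
  \<comment> \<open>A shift by \<open>r v\<close> with \<open>|r| \<le> 1\<close> changes each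
    coordinate by at most \<open>norm v\<close>, so this margin accommodates all the
    translates.\<close>
  define B where "B = (norm v) *\<^sub>R (One::'a)"
  have big: "x - r *\<^sub>R v \<in> cbox a b \<Longrightarrow> x \<in> cbox (a - B) (b + B)" if "\<bar>r\<bar> \<le> 1" for r x
  proof -
    assume x: "x - r *\<^sub>R v \<in> cbox a b"
    have "\<bar>(r *\<^sub>R v) \<bullet> i\<bar> \<le> norm v" if "i \<in> Basis" for i
      using Basis_le_norm[OF that, of "r *\<^sub>R v"] mult_right_mono[OF \<open>\<bar>r\<bar> \<le> 1\<close>, of "norm v"] by simp
    then show ?thesis
      using x by (fastforce simp: mem_box B_def algebra_simps abs_le_iff)
  qed
  let ?big = "cbox (a - B) (b + B)"
  have const: "integral ?big (\<lambda>x. G (x + r *\<^sub>R v)) = integral (cbox a b) G" if "\<bar>r\<bar> \<le> 1" for r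
  proof (rule integral_unique, rule has_integral_on_superset)
    have "(G has_integral integral (cbox a b) G) (cbox a b)"
      by (intro integrable_integral integrable_continuous continuous_on_subset[OF contG]) auto
    then show "((\<lambda>x. G (x + r *\<^sub>R v)) has_integral integral (cbox a b) G) (cbox (a - r *\<^sub>R v) (b - r *\<^sub>R v))"
      using has_integral_affinity_iff[of 1 G "r *\<^sub>R v" _ a b] by simp
    have shift: "x \<in> cbox (a - r *\<^sub>R v) (b - r *\<^sub>R v) \<longleftrightarrow> x + r *\<^sub>R v \<in> cbox a b" for x
      by (auto simp: mem_box algebra_simps)
    then show "cbox (a - r *\<^sub>R v) (b - r *\<^sub>R v) \<subseteq> ?big"
      using big[of "-r"] that by auto
    show "G (x + r *\<^sub>R v) = 0" if "x \<notin> cbox (a - r *\<^sub>R v) (b - r *\<^sub>R v)" for x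
      using that shift by (simp add: G_def)
  qed
  have "((\<lambda>r. integral ?big (\<lambda>x. G (x + r *\<^sub>R v))) has_field_derivative
      integral ?big (\<lambda>x. dird v G (x + 0 *\<^sub>R v))) (at 0 within UNIV)"
  proof (rule leibniz_rule_field_derivative)
    fix r :: real and x
    have line: "((\<lambda>r. x + r *\<^sub>R v) has_derivative (\<lambda>r. r *\<^sub>R v)) (at r)"
      by (auto intro!: derivative_eq_intros)
    have eq: "(\<lambda>a. a * c) = (*) c" for c :: real by (simp add: fun_eq_iff)
    show "((\<lambda>r. G (x + r *\<^sub>R v)) has_real_derivative dird v G (x + r *\<^sub>R v)) (at r within UNIV)"
      using diff_chain_at[OF line der[of "x + r *\<^sub>R v"]] linear_cmul[OF has_derivative_linear[OF der]]
      by (simp add: has_field_derivative_def o_def eq)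
  next
    fix r :: real
    show "(\<lambda>x. G (x + r *\<^sub>R v)) integrable_on ?big"
      by (intro integrable_continuous continuous_on_compose2[OF contG] continuous_intros) auto
  next
    show "continuous_on (UNIV \<times> ?big) (\<lambda>(r, x). dird v G (x + r *\<^sub>R v))"
      unfolding case_prod_unfold
      by (intro continuous_on_compose2[OF contD] continuous_intros) auto
  qed auto
  moreover have "((\<lambda>r. integral ?big (\<lambda>x. G (x + r *\<^sub>R v))) has_field_derivative 0) (at 0)"
  proof (rule has_field_derivative_transform_within[OF DERIV_const[of "integral (cbox a b) G"]])
    show "integral (cbox a b) G = integral ?big (\<lambda>x. G (x + r *\<^sub>R v))" if "dist r 0 < 1" for r
      using const[of r] that by simp
  qed auto
  ultimately have "integral ?big (dird v G) = 0" using DERIV_unique by fastforce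
  moreover have "integral ?big (dird v G) = integral (cbox a b) (dird v G)"
  proof -
    have "?big \<inter> cbox a b = cbox a b" using big[of 0] by auto
    moreover have "(\<lambda>x. if x \<in> cbox a b then dird v G x else 0) = dird v G"
      using dG_out by auto
    ultimately show ?thesis
      using Henstock_Kurzweil_Integration.integral_restrict_Int[where S = "cbox a b" and T = ?big and f = "dird v G"]
      by (simp add: Int_commute)
  qed
  moreover have "integral (cbox a b) (dird v G) = integral (cbox a b) (dird v g)"
    using dird_cong[OF U(1) _ G_U, where v = v] U(2)
    by (intro Henstock_Kurzweil_Integration.integral_cong) auto
  ultimately show ?thesis by simp
qed


subsection \<open>Partitions of unity\<close>

text \<open>The divergence theorem differentiates the bump functions only once, so \<open>C\<^sup>1\<close> bumps suffice.\<close>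

definition box_bump :: "'a::euclidean_space \<Rightarrow> 'a \<Rightarrow> 'a \<Rightarrow> real"
  where "box_bump a b x = (\<Prod>i\<in>Basis. (max 0 ((x - a) \<bullet> i))\<^sup>2 * (max 0 ((b - x) \<bullet> i))\<^sup>2)"

lemma box_bump_pos: "x \<in> box a b \<Longrightarrow> box_bump a b x > 0"
  unfolding box_bump_def by (intro prod_pos) (auto simp: mem_box inner_diff_left zero_less_mult_iff)

lemma box_bump_nonneg: "box_bump a b x \<ge> 0"
  unfolding box_bump_def by (intro prod_nonneg) auto

lemma box_bump_outside:
  assumes "x \<notin> box a b"
  shows "box_bump a b x = 0"
proof -
  obtain i where "i \<in> Basis" "x \<bullet> i \<le> a \<bullet> i \<or> b \<bullet> i \<le> x \<bullet> i"
    using assms by (auto simp: mem_box not_less)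
  then show ?thesis
    unfolding box_bump_def
    by (intro prod_zero bexI[of _ i]) (auto simp: inner_diff_left max_def)
qed

text \<open>At the kink 0 the difference quotient is at most \<open>|h|\<close>, so the derivative
  there is 0; this is why the positive part is squared.\<close>

lemma has_derivative_max0_sq:
  "((\<lambda>x::real. (max 0 x)\<^sup>2) has_real_derivative 2 * max 0 x) (at x)"
proof (cases "x = 0")
  case True
  have "((\<lambda>h::real. (max 0 h)\<^sup>2 / h) \<longlongrightarrow> 0) (at 0)"
  proof (rule Lim_null_comparison)
    show "\<forall>\<^sub>F h::real in at 0. norm ((max 0 h)\<^sup>2 / h) \<le> \<bar>h\<bar>"
      by (intro always_eventually) (auto simp: max_def power2_eq_square)
    show "((\<lambda>h::real. \<bar>h\<bar>) \<longlongrightarrow> 0) (at 0)" by (rule tendsto_rabs_zero[OF tendsto_ident_at])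
  qed
  then show ?thesis by (simp add: True has_field_derivative_iff)
next
  case False
  show ?thesis
  proof (cases "x > 0")
    case True
    have "((\<lambda>x::real. x\<^sup>2) has_real_derivative 2 * max 0 x) (at x)"
      using True by (auto intro!: derivative_eq_intros)
    then show ?thesis
      by (rule has_field_derivative_transform_within_open[where S = "{0<..}"]) (use True in auto)
  next
    case neg: False
    have "((\<lambda>x::real. 0) has_real_derivative 2 * max 0 x) (at x)"
      using neg by (auto intro!: derivative_eq_intros)
    then show ?thesis
      by (rule has_field_derivative_transform_within_open[where S = "{..<0}"]) (use neg False in auto)
  qed
qed

lemma Ck_on_max0_sq: "Ck_on 1 UNIV (\<lambda>x::real. (max 0 x)\<^sup>2)"
proof -
  have der: "((\<lambda>x::real. (max 0 x)\<^sup>2) has_derivative (\<lambda>v. 2 * max 0 x * v)) (at x)" for x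
    using has_derivative_max0_sq by (simp add: has_field_derivative_def)
  have "dird v (\<lambda>x::real. (max 0 x)\<^sup>2) = (\<lambda>x. 2 * max 0 x * v)" for v
    using dird_eq[OF der] by (simp add: fun_eq_iff)
  then show ?thesis
    using der by (auto simp: Ck_on_Suc differentiable_def intro!: continuous_intros)
qed

lemma Ck_on_box_bump:
  fixes a b :: "'a::euclidean_space"
  shows "Ck_on 1 UNIV (box_bump a b)"
proof -
  have comp: "Ck_on 1 UNIV (\<lambda>x::'a. (max 0 (g x))\<^sup>2)" if "Ck_on 1 UNIV g" for g :: "'a \<Rightarrow> real"
    using Ck_on_compose1[OF open_UNIV Ck_on_max0_sq that] by simp
  have lin: "Ck_on 1 UNIV (\<lambda>x::'a. x \<bullet> i)" for i
    using Ck_on_linear[OF bounded_linear_inner_left open_UNIV Ck_on_ident] .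
  have lin': "Ck_on 1 UNIV (\<lambda>x::'a. r * (x \<bullet> i) + c)" for i r c
    using Ck_on_add[OF open_UNIV Ck_on_linear[OF bounded_linear_mult_right open_UNIV lin] Ck_on_const] .
  have "Ck_on 1 UNIV (\<lambda>x. \<Prod>i\<in>B. (max 0 ((x - a) \<bullet> i))\<^sup>2 * (max 0 ((b - x) \<bullet> i))\<^sup>2)"
    if "finite B" for B :: "'a set"
    using that
  proof induction
    case (insert i B)
    have "Ck_on 1 UNIV (\<lambda>x. (max 0 ((x - a) \<bullet> i))\<^sup>2)" "Ck_on 1 UNIV (\<lambda>x. (max 0 ((b - x) \<bullet> i))\<^sup>2)"
      using comp[OF lin'[of 1 i "- (a \<bullet> i)"]] comp[OF lin'[of "-1" i "b \<bullet> i"]]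
      by (simp_all add: inner_diff_left)
    then show ?case
      using insert by (simp add: Ck_on_bilinear[OF bounded_bilinear_mult])
  qed (auto simp: Ck_on_const)
  then show ?thesis unfolding box_bump_def[abs_def] by simp
qed

subsection \<open>Atlases\<close>

lemma lorentz_bilinear: "bounded_bilinear lorentz"
proof -
  \<comment> \<open>The Lorentz form is the Euclidean inner product with the time component of one
    argument reflected, so boundedness is inherited.\<close>
  have eq: "lorentz = (\<lambda>x y. x \<bullet> (fst y, - snd y))"
    by (simp add: fun_eq_iff lorentz_def inner_prod_def)
  have "bounded_linear (\<lambda>y::minkowski. (fst y, - snd y))"
    by (intro bounded_linear_Pair bounded_linear_minus bounded_linear_fst bounded_linear_snd)
  from bounded_bilinear.comp[OF bounded_bilinear_inner bounded_linear_ident this]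
  show ?thesis unfolding eq .
qed

lemmas lorentz_simps =
  bounded_bilinear.add_left[OF lorentz_bilinear] bounded_bilinear.add_right[OF lorentz_bilinear]
  bounded_bilinear.diff_left[OF lorentz_bilinear] bounded_bilinear.diff_right[OF lorentz_bilinear]
  bounded_bilinear.minus_left[OF lorentz_bilinear] bounded_bilinear.minus_right[OF lorentz_bilinear]
  bounded_bilinear.scaleR_left[OF lorentz_bilinear] bounded_bilinear.scaleR_right[OF lorentz_bilinear]
  bounded_bilinear.zero_left[OF lorentz_bilinear] bounded_bilinear.zero_right[OF lorentz_bilinear]

lemma lorentz_commute: "lorentz x y = lorentz y x"
  by (simp add: lorentz_def inner_commute mult.commute)

abbreviation e2 :: "2 \<Rightarrow> real^2" where "e2 i \<equiv> axis i 1"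

lemma pderiv2_eq_dird: "pderiv2 i f u = dird (e2 i) f u"
  by (simp add: pderiv2_def dird_def)

definition area_density :: "('m \<Rightarrow> minkowski) \<Rightarrow> (real^2 \<Rightarrow> 'm) \<Rightarrow> real^2 \<Rightarrow> real"
  where "area_density f \<phi> u = sqrt (det (first_ff (f \<circ> \<phi>) u))"

lemma first_ff_component: "first_ff X u $ i $ j = lorentz (dird (e2 i) X u) (dird (e2 j) X u)"
  by (simp add: first_ff_def pderiv2_eq_dird)

definition chart_change :: "(real^2) set \<Rightarrow> (real^2 \<Rightarrow> 'm) \<Rightarrow> (real^2 \<Rightarrow> 'm) \<Rightarrow> real^2 \<Rightarrow> real^2"
  where "chart_change V \<psi> \<phi> u = inv_into V \<psi> (\<phi> u)"

definition chart_jacobian :: "(real^2) set \<Rightarrow> (real^2 \<Rightarrow> 'm) \<Rightarrow> (real^2 \<Rightarrow> 'm) \<Rightarrow> real^2 \<Rightarrow> real^2^2"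
  where "chart_jacobian V \<psi> \<phi> u = matrix (\<lambda>v. dird v (chart_change V \<psi> \<phi>) u)"

type_synonym 'm boxed_chart = "(real^2) set \<times> (real^2 \<Rightarrow> 'm) \<times> (real^2) \<times> (real^2)"

locale atlas =
  fixes M :: "'m::t2_space set" and cs :: "'m chart list"
  assumes closed_surface: "closed_surface M cs"
begin

definition charts :: "((real^2) set \<Rightarrow> (real^2 \<Rightarrow> 'm) \<Rightarrow> bool)"
  where "charts U \<phi> \<longleftrightarrow> (U, \<phi>) \<in> set cs"

lemma compact_M: "compact M"
  using closed_surface unfolding closed_surface_def by (elim conjE)

lemma chart_open: "charts U \<phi> \<Longrightarrow> open U"
  and chart_openin: "charts U \<phi> \<Longrightarrow> openin (top_of_set M) (\<phi> ` U)"
  and chart_homeomorphism: "charts U \<phi> \<Longrightarrow> \<exists>\<psi>. homeomorphism U (\<phi> ` U) \<phi> \<psi>"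
  using closed_surface by (auto simp: closed_surface_def charts_def)

lemma chart_continuous: "charts U \<phi> \<Longrightarrow> continuous_on U \<phi>"
  using chart_homeomorphism homeomorphism_cont1 by blast

lemma chart_inj: "charts U \<phi> \<Longrightarrow> inj_on \<phi> U"
  using chart_homeomorphism[of U \<phi>] homeomorphism_apply1 inj_on_inverseI[of U _ \<phi>] by blast

lemma chart_in: "charts U \<phi> \<Longrightarrow> u \<in> U \<Longrightarrow> \<phi> u \<in> M"
  using chart_openin openin_imp_subset by blast

lemma chart_cover: "p \<in> M \<Longrightarrow> \<exists>U \<phi> u. charts U \<phi> \<and> u \<in> U \<and> p = \<phi> u"
  using closed_surface unfolding closed_surface_def charts_def by blast

lemma chart_image_openin:
  assumes "charts U \<phi>" "open V" "V \<subseteq> U"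
  shows "openin (top_of_set M) (\<phi> ` V)"
proof -
  obtain \<psi> where "homeomorphism U (\<phi> ` U) \<phi> \<psi>" using chart_homeomorphism assms(1) by blast
  then have "openin (top_of_set (\<phi> ` U)) (\<phi> ` V)"
    using homeomorphism_imp_open_map assms by (metis openin_open_eq chart_open)
  then show ?thesis using chart_openin[OF assms(1)] openin_trans by blast
qed

definition overlap :: "(real^2) set \<Rightarrow> (real^2 \<Rightarrow> 'm) \<Rightarrow> (real^2) set \<Rightarrow> (real^2 \<Rightarrow> 'm) \<Rightarrow> (real^2) set"
  where "overlap U \<phi> V \<psi> = {u \<in> U. \<phi> u \<in> \<psi> ` V}"

lemma overlap_open:
  assumes "charts U \<phi>" "charts V \<psi>"
  shows "open (overlap U \<phi> V \<psi>)"
proof -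
  have "openin (top_of_set U) (U \<inter> \<phi> -` (\<psi> ` V))"
    using continuous_openin_preimage[OF chart_continuous[OF assms(1)] _ chart_openin[OF assms(2)]]
      chart_in[OF assms(1)] by blast
  then show ?thesis
    using openin_open_trans chart_open[OF assms(1)] by (auto simp: overlap_def vimage_def Int_def)
qed

lemma chart_change_in:
  assumes "u \<in> overlap U \<phi> V \<psi>"
  shows "chart_change V \<psi> \<phi> u \<in> V" "\<psi> (chart_change V \<psi> \<phi> u) = \<phi> u"
  using assms by (auto simp: overlap_def chart_change_def inv_into_into f_inv_into_f)

lemma chart_change_eq:
  assumes "charts V \<psi>" "v \<in> V" "\<psi> v = \<phi> u"
  shows "chart_change V \<psi> \<phi> u = v"
  using assms chart_inj by (metis chart_change_def inv_into_f_f)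

lemma chart_change_smooth:
  "charts U \<phi> \<Longrightarrow> charts V \<psi> \<Longrightarrow> smooth_on (overlap U \<phi> V \<psi>) (chart_change V \<psi> \<phi>)"
  using closed_surface
  by (fastforce simp: closed_surface_def charts_def overlap_def chart_change_def[abs_def])

lemma dird_chart_change:
  fixes a :: "'m \<Rightarrow> 'b::real_normed_vector"
  assumes "charts U \<phi>" "charts V \<psi>" "u \<in> U" "v \<in> V" "\<phi> u = \<psi> v"
    and "(a \<circ> \<psi>) differentiable (at v)"
  shows "dird (e2 i) (a \<circ> \<phi>) u =
    chart_jacobian V \<psi> \<phi> u $ 1 $ i *\<^sub>R dird (e2 1) (a \<circ> \<psi>) v +
    chart_jacobian V \<psi> \<phi> u $ 2 $ i *\<^sub>R dird (e2 2) (a \<circ> \<psi>) v"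
proof -
  let ?\<tau> = "chart_change V \<psi> \<phi>"
  have u: "u \<in> overlap U \<phi> V \<psi>" using assms by (auto simp: overlap_def)
  have \<tau>u: "?\<tau> u = v" using chart_change_eq[OF assms(2,4)] assms(5) by simp
  have der: "((a \<circ> \<psi>) has_derivative (\<lambda>w. dird w (a \<circ> \<psi>) v)) (at v)"
    using assms(6) by (simp add: frechet_derivative_works dird_def)
  have \<tau>: "(?\<tau> has_derivative (\<lambda>w. dird w ?\<tau> u)) (at u)"
    using smooth_on_has_derivative[OF chart_change_smooth[OF assms(1,2)] u] .
  have "dird (e2 i) (a \<circ> \<phi>) u = dird (e2 i) ((a \<circ> \<psi>) \<circ> ?\<tau>) u"
    by (rule dird_cong[OF overlap_open[OF assms(1,2)] u]) (simp add: chart_change_in)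
  also have "\<dots> = dird (dird (e2 i) ?\<tau> u) (a \<circ> \<psi>) v"
    using dird_eq[OF diff_chain_at[OF \<tau>]] der \<tau>u by (simp add: o_def)
  also have "dird (e2 i) ?\<tau> u = dird (e2 i) ?\<tau> u $ 1 *\<^sub>R e2 1 + dird (e2 i) ?\<tau> u $ 2 *\<^sub>R e2 2"
    by (simp add: vec_eq_iff forall_2 axis_def)
  finally show ?thesis
    using linear_add[OF has_derivative_linear[OF der]] linear_cmul[OF has_derivative_linear[OF der]]
    by (simp only: chart_jacobian_def matrix_def vec_lambda_beta)
qed

text \<open>The Gram matrix changes by congruence with the Jacobian, so its determinant acquires the
  square of the Jacobian determinant. The resulting factor is the one in the transformation formula
  for integrals.\<close>

lemma area_density_chart_change:
  assumes "charts U \<phi>" "charts V \<psi>" "u \<in> U" "v \<in> V" "\<phi> u = \<psi> v"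
    and "(f \<circ> \<psi>) differentiable (at v)"
  shows "area_density f \<phi> u = \<bar>det (chart_jacobian V \<psi> \<phi> u)\<bar> * area_density f \<psi> v"
proof -
  let ?J = "chart_jacobian V \<psi> \<phi> u"
  have "det (first_ff (f \<circ> \<phi>) u) = (det ?J)\<^sup>2 * det (first_ff (f \<circ> \<psi>) v)"
    unfolding det_2 first_ff_component dird_chart_change[OF assms] lorentz_simps
    by (simp add: lorentz_commute[of "dird (e2 2) _ _" "dird (e2 1) _ _"] power2_eq_square algebra_simps)
  then show ?thesis by (simp add: area_density_def real_sqrt_mult)
qed

text \<open>The condition under which the coordinate expressions describe a single function on the
  surface.\<close>

definition chart_invariant :: "((real^2 \<Rightarrow> 'm) \<Rightarrow> real^2 \<Rightarrow> real) \<Rightarrow> bool"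
  where "chart_invariant Q \<longleftrightarrow> (\<forall>U \<phi> V \<psi> u v. charts U \<phi> \<and> charts V \<psi> \<and> u \<in> U \<and> v \<in> V \<and>
    \<phi> u = \<psi> v \<longrightarrow> Q \<phi> u = Q \<psi> v)"

section \<open>The pieces of the surface and the transfer of their integrals into one chart\<close>

lemma chart_nth: "i < length cs \<Longrightarrow> charts (fst (cs ! i)) (snd (cs ! i))"
  by (simp add: charts_def)

text \<open>A point belongs to the piece of the first chart in the list that contains it.\<close>

lemma chart_piece_cover:
  assumes "p \<in> M"
  shows "\<exists>!i. i < length cs \<and> p \<in> snd (cs ! i) ` chart_piece cs i"
proof -
  let ?P = "\<lambda>i. i < length cs \<and> p \<in> snd (cs ! i) ` fst (cs ! i)"
  have "\<exists>i. ?P i"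
    using chart_cover[OF assms] unfolding charts_def in_set_conv_nth by force
  then obtain n where n: "?P n" "\<And>j. j < n \<Longrightarrow> \<not> ?P j"
    using exists_least_iff[of ?P] by blast
  have "p \<in> snd (cs ! n) ` chart_piece cs n"
  proof -
    obtain u where u: "u \<in> fst (cs ! n)" "p = snd (cs ! n) u" using n(1) by blast
    then have "u \<in> chart_piece cs n" using n by (auto simp: chart_piece_def)
    then show ?thesis using u by blast
  qed
  moreover have "i = n" if "i < length cs" "p \<in> snd (cs ! i) ` chart_piece cs i" for i
  proof -
    have "?P i" "\<And>j. j < i \<Longrightarrow> \<not> ?P j" using that by (auto simp: chart_piece_def)
    with n show "i = n" by (meson linorder_neqE_nat)
  qed
  ultimately show ?thesis using n(1) by blast
qed

text \<open>Seen in any chart, a piece is an open overlap minus finitely many open overlaps, which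
  makes it Borel.\<close>

lemma chart_piece_preimage:
  assumes "charts U \<phi>" "i < length cs"
  shows "{u \<in> U. \<phi> u \<in> snd (cs ! i) ` chart_piece cs i} =
    overlap U \<phi> (fst (cs ! i)) (snd (cs ! i)) -
    (\<Union>j<i. overlap U \<phi> (fst (cs ! j)) (snd (cs ! j)))"
proof -
  have "p \<in> snd (cs ! i) ` chart_piece cs i \<longleftrightarrow> p \<in> snd (cs ! i) ` fst (cs ! i) \<and>
      (\<forall>j<i. p \<notin> snd (cs ! j) ` fst (cs ! j))" for p
    by (auto simp: chart_piece_def)
  then show ?thesis by (auto simp: overlap_def)
qed

lemma chart_piece_preimage_borel:
  assumes "charts U \<phi>" "i < length cs"
  shows "{u \<in> U. \<phi> u \<in> snd (cs ! i) ` chart_piece cs i} \<in> sets borel"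
  unfolding chart_piece_preimage[OF assms]
  using overlap_open[OF assms(1) chart_nth] assms(2) by (intro sets.Diff borel_open open_UN) auto

lemma chart_piece_borel:
  assumes "i < length cs"
  shows "chart_piece cs i \<in> sets borel"
proof -
  have "chart_piece cs i = {u \<in> fst (cs ! i). snd (cs ! i) u \<in> snd (cs ! i) ` chart_piece cs i}"
    using chart_inj[OF chart_nth[OF assms]] by (auto simp: chart_piece_def inj_on_def)
  then show ?thesis using chart_piece_preimage_borel[OF chart_nth[OF assms] assms] by simp
qed

text \<open>The part of a piece that meets the chart \<open>\<phi>\<close> is the image of
  \<open>E\<close> under the chart change, whose Jacobian factor is the ratio of the area densities.
  Integrability comes from continuity on the compact set \<open>K\<close>, off which the integrand
  vanishes.\<close>

lemma chart_piece_integral: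
  assumes \<phi>: "charts U \<phi>" and K: "compact K" "K \<subseteq> U" and i: "i < length cs"
    and inv: "chart_invariant Q"
    and cont: "\<And>V \<psi>. charts V \<psi> \<Longrightarrow> continuous_on V (\<lambda>v. Q \<psi> v * area_density f \<psi> v)"
    and diff: "\<And>V \<psi> v. charts V \<psi> \<Longrightarrow> v \<in> V \<Longrightarrow> (f \<circ> \<psi>) differentiable (at v)"
    and supp: "\<And>V \<psi> v. charts V \<psi> \<Longrightarrow> v \<in> V \<Longrightarrow> \<psi> v \<notin> \<phi> ` K \<Longrightarrow> Q \<psi> v = 0"
  defines "\<psi> \<equiv> snd (cs ! i)" and "G \<equiv> \<lambda>\<psi> v. Q \<psi> v * area_density f \<psi> v"
    and "E \<equiv> {u \<in> U. \<phi> u \<in> snd (cs ! i) ` chart_piece cs i}"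
  shows "set_integrable lborel (chart_piece cs i) (G \<psi>)"
    and "(\<lambda>u. if u \<in> E then G \<phi> u else 0) absolutely_integrable_on UNIV"
    and "(LINT v:chart_piece cs i|lborel. G \<psi> v) = integral UNIV (\<lambda>u. if u \<in> E then G \<phi> u else 0)"
proof -
  define V where "V = fst (cs ! i)"
  have \<psi>: "charts V \<psi>" using chart_nth[OF i] by (simp add: V_def \<psi>_def)
  define \<tau> where "\<tau> = chart_change V \<psi> \<phi>"
  \<comment> \<open>The piece may reach outside the image of \<open>\<phi>\<close>; \<open>R\<close>
    is the part inside it, and the rest contributes 0 by the support condition.\<close>
  define R where "R = {v \<in> chart_piece cs i. \<psi> v \<in> \<phi> ` U}"
  have piece: "chart_piece cs i \<subseteq> V" by (auto simp: chart_piece_def V_def)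
  have E_overlap: "E \<subseteq> overlap U \<phi> V \<psi>" using piece by (auto simp: E_def overlap_def \<psi>_def)
  have E_borel: "E \<in> sets borel" unfolding E_def by (rule chart_piece_preimage_borel[OF \<phi> i])
  have \<tau>E: "\<tau> u \<in> V" "\<psi> (\<tau> u) = \<phi> u" if "u \<in> E" for u
    using chart_change_in[of u U \<phi> V \<psi>] E_overlap that by (auto simp: \<tau>_def)
  have \<tau>_eq: "\<tau> u = v" if "u \<in> U" "v \<in> V" "\<psi> v = \<phi> u" for u v
    using chart_change_eq[OF \<psi>] that by (simp add: \<tau>_def)
  have image: "\<tau> ` E = R"
  proof
    show "\<tau> ` E \<subseteq> R"
    proof
      fix v assume "v \<in> \<tau> ` E"
      then obtain u where u: "u \<in> E" "v = \<tau> u" by blast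
      then obtain w where w: "w \<in> chart_piece cs i" "\<phi> u = \<psi> w" by (auto simp: E_def \<psi>_def)
      then have "v = w" using \<tau>_eq[of u w] u piece by (auto simp: E_def)
      moreover have "\<phi> u \<in> \<phi> ` U" using u by (simp add: E_def)
      ultimately show "v \<in> R" using w by (simp add: R_def)
    qed
    show "R \<subseteq> \<tau> ` E"
    proof
      fix v assume v: "v \<in> R"
      then obtain u where u: "u \<in> U" "\<psi> v = \<phi> u" by (auto simp: R_def)
      then have "u \<in> E" using v by (auto simp: E_def R_def \<psi>_def intro!: image_eqI[of _ _ v])
      moreover have "\<tau> u = v" using \<tau>_eq u v piece by (auto simp: R_def)
      ultimately show "v \<in> \<tau> ` E" by blast
    qed
  qed
  have inj: "inj_on \<tau> E"
    using chart_inj[OF \<phi>] \<tau>E(2) by (metis (no_types, lifting) E_def inj_on_def mem_Collect_eq)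
  have der: "(\<tau> has_derivative (\<lambda>w. dird w \<tau> u)) (at u within E)" if "u \<in> E" for u
    using smooth_on_has_derivative[OF chart_change_smooth[OF \<phi> \<psi>], of u] that E_overlap
    by (auto simp: \<tau>_def intro: has_derivative_at_withinI)
  have G_eq: "\<bar>det (matrix (\<lambda>w. dird w \<tau> u))\<bar> * G \<psi> (\<tau> u) = G \<phi> u" if "u \<in> E" for u
  proof -
    have uv: "u \<in> U" "\<tau> u \<in> V" "\<phi> u = \<psi> (\<tau> u)" using that \<tau>E by (auto simp: E_def)
    have "Q \<phi> u = Q \<psi> (\<tau> u)"
      using inv \<phi> \<psi> uv unfolding chart_invariant_def by blast
    then show ?thesis
      using area_density_chart_change[OF \<phi> \<psi> uv diff[OF \<psi> uv(2)]]
      by (simp add: G_def chart_jacobian_def \<tau>_def)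
  qed
  have "G \<phi> absolutely_integrable_on K"
  proof -
    have "continuous_on K (G \<phi>)"
      using cont[OF \<phi>] K(2) continuous_on_subset unfolding G_def by blast
    from borel_integrable_compact[OF K(1) this] show ?thesis
      unfolding set_integrable_def using integrable_completion borel_measurable_integrable by blast
  qed
  moreover have "E \<inter> K \<in> sets lebesgue"
    using E_borel borel_compact[OF K(1)] by (auto intro!: sets_completionI_sets)
  ultimately have "G \<phi> absolutely_integrable_on (E \<inter> K)"
    using set_integrable_subset by blast
  \<comment> \<open>Injectivity of \<open>\<phi>\<close> turns support in the image of
    \<open>K\<close> into support in \<open>K\<close>.\<close>
  moreover have "(if u \<in> E \<inter> K then G \<phi> u else 0) = (if u \<in> E then G \<phi> u else 0)" for u
    using supp[OF \<phi>, of u] inj_on_image_mem_iff[OF chart_inj[OF \<phi>] _ K(2), of u]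
    by (cases "u \<in> U") (simp_all add: E_def G_def)
  ultimately show E_int: "(\<lambda>u. if u \<in> E then G \<phi> u else 0) absolutely_integrable_on UNIV"
    using absolutely_integrable_restrict_UNIV[of "E \<inter> K" "G \<phi>"] by simp
  then have "G \<phi> absolutely_integrable_on E" by (simp add: absolutely_integrable_restrict_UNIV)
  then have "(\<lambda>u. \<bar>det (matrix (\<lambda>w. dird w \<tau> u))\<bar> * G \<psi> (\<tau> u)) absolutely_integrable_on E"
    by (rule set_integrable_cong[THEN iffD1, rotated -1]) (auto simp: G_eq)
  moreover have "integral E (\<lambda>u. \<bar>det (matrix (\<lambda>w. dird w \<tau> u))\<bar> * G \<psi> (\<tau> u)) = integral E (G \<phi>)"
    by (intro Henstock_Kurzweil_Integration.integral_cong G_eq)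
  ultimately have R: "G \<psi> absolutely_integrable_on R" "integral R (G \<psi>) = integral E (G \<phi>)"
    using has_absolute_integral_change_of_variables_real[of E \<tau> "\<lambda>u w. dird w \<tau> u" "G \<psi>"]
      der inj E_borel image by auto
  have piece_eq: "(if v \<in> R then G \<psi> v else 0) = (if v \<in> chart_piece cs i then G \<psi> v else 0)" for v
    using supp[OF \<psi>, of v] piece K(2) by (auto simp: R_def G_def)
  have leb: "set_integrable lebesgue (chart_piece cs i) (G \<psi>)"
    using R(1) absolutely_integrable_restrict_UNIV[of R "G \<psi>"]
      absolutely_integrable_restrict_UNIV[of "chart_piece cs i" "G \<psi>"] by (simp only: piece_eq)
  \<comment> \<open>The change of variables gives Lebesgue integrability; Borel measurability is
    added in order to pass to \<open>lborel\<close>.\<close>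
  have "continuous_on (chart_piece cs i) (G \<psi>)"
    using cont[OF \<psi>] piece continuous_on_subset unfolding G_def by blast
  from borel_measurable_continuous_on_indicator[OF chart_piece_borel[OF i] this]
  have meas: "(\<lambda>v. indicator (chart_piece cs i) v *\<^sub>R G \<psi> v) \<in> borel_measurable lborel" by simp
  show lb: "set_integrable lborel (chart_piece cs i) (G \<psi>)"
    using leb integrable_completion[OF meas] by (simp add: set_integrable_def)
  have "(LINT v:chart_piece cs i|lborel. G \<psi> v) = integral (chart_piece cs i) (G \<psi>)"
    using set_borel_integral_eq_integral(2)[OF lb] .
  also have "\<dots> = integral R (G \<psi>)"
    using integral_restrict_UNIV[of R "G \<psi>"] integral_restrict_UNIV[of "chart_piece cs i" "G \<psi>"]
    by (simp only: piece_eq)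
  also have "\<dots> = integral UNIV (\<lambda>u. if u \<in> E then G \<phi> u else 0)"
    using R(2) by (simp add: integral_restrict_UNIV)
  finally show "(LINT v:chart_piece cs i|lborel. G \<psi> v) =
    integral UNIV (\<lambda>u. if u \<in> E then G \<phi> u else 0)" .
qed

text \<open>The sets \<open>E i\<close> partition \<open>U\<close>, since every point lies in
  exactly one piece; hence the contributions of the pieces add up to one integral over
  \<open>K\<close>.\<close>

lemma surface_integral_in_chart:
  assumes \<phi>: "charts U \<phi>" and K: "compact K" "K \<subseteq> U"
    and inv: "chart_invariant Q"
    and cont: "\<And>V \<psi>. charts V \<psi> \<Longrightarrow> continuous_on V (\<lambda>v. Q \<psi> v * area_density f \<psi> v)"
    and diff: "\<And>V \<psi> v. charts V \<psi> \<Longrightarrow> v \<in> V \<Longrightarrow> (f \<circ> \<psi>) differentiable (at v)"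
    and supp: "\<And>V \<psi> v. charts V \<psi> \<Longrightarrow> v \<in> V \<Longrightarrow> \<psi> v \<notin> \<phi> ` K \<Longrightarrow> Q \<psi> v = 0"
  shows "surface_integral cs f Q = integral K (\<lambda>u. Q \<phi> u * area_density f \<phi> u)"
proof -
  define E where "E i = {u \<in> U. \<phi> u \<in> snd (cs ! i) ` chart_piece cs i}" for i
  define G where "G u = Q \<phi> u * area_density f \<phi> u" for u
  note * = chart_piece_integral[OF \<phi> K _ inv cont diff supp, folded E_def]
  have "surface_integral cs f Q = (\<Sum>i<length cs. integral UNIV (\<lambda>u. if u \<in> E i then G u else 0))"
    unfolding surface_integral_def Let_def G_def
    using *(3) by (intro sum.cong) (auto simp: area_density_def)
  also have "\<dots> = integral UNIV (\<lambda>u. \<Sum>i<length cs. if u \<in> E i then G u else 0)"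
    using set_lebesgue_integral_eq_integral(1)[OF *(2)] unfolding G_def
    by (intro integral_sum[symmetric]) auto
  also have "(\<lambda>u. \<Sum>i<length cs. if u \<in> E i then G u else 0) = (\<lambda>u. if u \<in> K then G u else 0)"
  proof
    fix u
    show "(\<Sum>i<length cs. if u \<in> E i then G u else 0) = (if u \<in> K then G u else 0)"
    proof (cases "u \<in> U")
      case True
      obtain i where i: "i < length cs" "\<phi> u \<in> snd (cs ! i) ` chart_piece cs i"
        "\<And>j. j < length cs \<Longrightarrow> \<phi> u \<in> snd (cs ! j) ` chart_piece cs j \<Longrightarrow> j = i"
        using chart_piece_cover[OF chart_in[OF \<phi> True]] by blast
      have "u \<in> E j \<longleftrightarrow> j = i" if "j < length cs" for j
        using i that True unfolding E_def by blast
      then have "(\<Sum>j<length cs. if u \<in> E j then G u else 0) = (\<Sum>j<length cs. if j = i then G u else 0)"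
        by (intro sum.cong) auto
      also have "\<dots> = G u" using i(1) by simp
      also have "\<dots> = (if u \<in> K then G u else 0)"
        using supp[OF \<phi> True] inj_on_image_mem_iff[OF chart_inj[OF \<phi>] True K(2)] by (simp add: G_def)
      finally show ?thesis .
    next
      case False
      then have "u \<notin> E i" "u \<notin> K" for i using K(2) by (auto simp: E_def)
      then show ?thesis by simp
    qed
  qed
  finally show ?thesis unfolding integral_restrict_UNIV by (simp only: G_def)
qed

section \<open>A partition of unity subordinate to boxes in charts\<close>

definition chart_bump :: "(real^2) set \<Rightarrow> (real^2 \<Rightarrow> 'm) \<Rightarrow> real^2 \<Rightarrow> real^2 \<Rightarrow> 'm \<Rightarrow> real"
  where "chart_bump U \<phi> a b p = (if p \<in> \<phi> ` U then box_bump a b (inv_into U \<phi> p) else 0)"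

lemma chart_bump_outside:
  assumes "p \<notin> \<phi> ` box a b"
  shows "chart_bump U \<phi> a b p = 0"
proof -
  have "inv_into U \<phi> p \<notin> box a b" if "p \<in> \<phi> ` U"
  proof
    assume "inv_into U \<phi> p \<in> box a b"
    then have "\<phi> (inv_into U \<phi> p) \<in> \<phi> ` box a b" by (rule imageI)
    with assms show False unfolding f_inv_into_f[OF that] by (rule notE)
  qed
  then show ?thesis by (simp add: chart_bump_def box_bump_outside)
qed

lemma chart_bump_pos:
  assumes "charts U \<phi>" "cbox a b \<subseteq> U" "p \<in> \<phi> ` box a b"
  shows "chart_bump U \<phi> a b p > 0"
proof -
  obtain u where u: "u \<in> box a b" "p = \<phi> u" using assms(3) by blast
  then have "u \<in> U" using assms(2) box_subset_cbox by blast
  then show ?thesis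
    using u box_bump_pos inv_into_f_f[OF chart_inj[OF assms(1)]] by (simp add: chart_bump_def)
qed

text \<open>\<open>V\<close> is covered by two open sets: the overlap with \<open>U\<close>, where
  the bump is a \<open>C^1\<close> function of the chart change, and the set that misses the image
  of the closed box, where it is 0. The latter is open because compact subsets of a Hausdorff space
  are closed.\<close>

lemma Ck_on_chart_bump:
  assumes \<phi>: "charts U \<phi>" and \<psi>: "charts V \<psi>" and ab: "cbox a b \<subseteq> U"
  shows "Ck_on 1 V (chart_bump U \<phi> a b \<circ> \<psi>)"
proof -
  define W where "W = {v \<in> V. \<psi> v \<notin> \<phi> ` cbox a b}"
  have "compact (\<phi> ` cbox a b)"
    using compact_continuous_image[OF continuous_on_subset[OF chart_continuous[OF \<phi>] ab] compact_cbox] .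
  then have "open (V \<inter> \<psi> -` (- \<phi> ` cbox a b))"
    using continuous_open_preimage[OF chart_continuous[OF \<psi>] chart_open[OF \<psi>]]
    by (simp add: compact_imp_closed open_Compl)
  then have W: "open W" by (simp add: W_def vimage_def Int_def)
  have "Ck_on 1 W (chart_bump U \<phi> a b \<circ> \<psi>) \<longleftrightarrow> Ck_on 1 W (\<lambda>v. 0::real)"
    using image_mono[OF box_subset_cbox[of a b], of \<phi>]
    by (intro Ck_on_cong W) (auto simp: W_def intro!: chart_bump_outside)
  then have 1: "Ck_on 1 W (chart_bump U \<phi> a b \<circ> \<psi>)" by (simp add: Ck_on_const)
  have op: "open (overlap V \<psi> U \<phi>)" by (rule overlap_open[OF \<psi> \<phi>])
  have "Ck_on 1 (overlap V \<psi> U \<phi>) (chart_change U \<phi> \<psi>)"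
    using chart_change_smooth[OF \<psi> \<phi>] by (simp add: smooth_on_def)
  from Ck_on_compose1[OF op Ck_on_box_bump this]
  have "Ck_on 1 (overlap V \<psi> U \<phi>) (\<lambda>v. box_bump a b (chart_change U \<phi> \<psi> v))" by simp
  then have 2: "Ck_on 1 (overlap V \<psi> U \<phi>) (chart_bump U \<phi> a b \<circ> \<psi>)"
    by (rule Ck_on_cong[OF op, THEN iffD1, rotated])
      (auto simp: chart_bump_def chart_change_def overlap_def)
  have "W \<union> overlap V \<psi> U \<phi> = V" using ab by (auto simp: W_def overlap_def)
  then show ?thesis using Ck_on_Un[OF 1 2 W op] by simp
qed

text \<open>The charts with boxes index the functions themselves, so that an index carries the
  domain of its coordinate integral.\<close>

definition partition_of_unity ::
    "'m boxed_chart set \<Rightarrow> ('m boxed_chart \<Rightarrow> 'm \<Rightarrow> real) \<Rightarrow> bool"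
  where "partition_of_unity J \<eta> \<longleftrightarrow> finite J \<and>
    (\<forall>(U, \<phi>, a, b) \<in> J. charts U \<phi> \<and> cbox a b \<subseteq> U \<and>
      (\<forall>p \<in> M. p \<notin> \<phi> ` box a b \<longrightarrow> \<eta> (U, \<phi>, a, b) p = 0)) \<and>
    (\<forall>j \<in> J. \<forall>V \<psi>. charts V \<psi> \<longrightarrow> Ck_on 1 V (\<eta> j \<circ> \<psi>)) \<and>
    (\<forall>p \<in> M. (\<Sum>j\<in>J. \<eta> j p) = 1)"

text \<open>The images of boxes in charts cover the compact surface. For a finite subcover the sum
  of the bumps is positive on the surface, and division by it normalises them.\<close>

lemma partition_of_unity_exists: "\<exists>J \<eta>. partition_of_unity J \<eta>"
proof -
  define T where "T = {(U, \<phi>, a, b). charts U \<phi> \<and> cbox a b \<subseteq> U}"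
  define B where "B = (\<lambda>(U::(real^2) set, \<phi>::real^2 \<Rightarrow> 'm, a, b). \<phi> ` box a b)"
  have "\<forall>c\<in>B ` T. openin (top_of_set M) c"
    using chart_image_openin[OF _ open_box] box_subset_cbox unfolding T_def B_def by fastforce
  moreover have "M \<subseteq> \<Union>(B ` T)"
  proof
    fix p assume "p \<in> M"
    then obtain U \<phi> u where u: "charts U \<phi>" "u \<in> U" "p = \<phi> u" using chart_cover by blast
    obtain a b where "u \<in> box a b" "cbox a b \<subseteq> U"
      using open_contains_cbox[OF chart_open[OF u(1)] u(2)] by metis
    then show "p \<in> \<Union>(B ` T)" using u by (force simp: T_def B_def)
  qed
  ultimately obtain D where D: "D \<subseteq> B ` T" "finite D" "M \<subseteq> \<Union>D"
    using compact_M unfolding compact_eq_openin_cover by meson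
  then obtain J where J: "J \<subseteq> T" "finite J" "D = B ` J"
    using finite_subset_image by metis
  define \<beta> where "\<beta> = (\<lambda>(U, \<phi>, a, b). chart_bump U \<phi> a b)"
  define \<eta> where "\<eta> j p = \<beta> j p * inverse (\<Sum>k\<in>J. \<beta> k p)" for j p
  have \<beta>_nonneg: "\<beta> j p \<ge> 0" for j p
    by (cases j) (simp add: \<beta>_def chart_bump_def box_bump_nonneg)
  have pos: "(\<Sum>k\<in>J. \<beta> k p) > 0" if "p \<in> M" for p
  proof -
    have "p \<in> \<Union>(B ` J)" using D(3) that unfolding J(3) by (rule subsetD)
    then obtain j where j: "j \<in> J" "p \<in> B j" by blast
    obtain U \<phi> a b where j_eq: "j = (U, \<phi>, a, b)" by (cases j)
    have "j \<in> T" using j(1) J(1) by blast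
    then have c: "charts U \<phi>" "cbox a b \<subseteq> U" "p \<in> \<phi> ` box a b" "\<beta> j = chart_bump U \<phi> a b"
      using j(2) by (simp_all add: \<beta>_def B_def T_def j_eq)
    then have "\<beta> j p > 0" by (simp only: chart_bump_pos)
    with \<beta>_nonneg show ?thesis by (intro sum_pos2[OF J(2) \<open>j \<in> J\<close>])
  qed
  have \<beta>_C1: "Ck_on 1 V (\<lambda>v. \<beta> j (\<psi> v))" if "j \<in> J" "charts V \<psi>" for j V \<psi>
    using Ck_on_chart_bump[OF _ that(2)] that(1) J(1) by (auto simp: \<beta>_def T_def o_def)
  have sum_C1: "Ck_on 1 V (\<lambda>v. \<Sum>k\<in>K. \<beta> k (\<psi> v))" if "finite K" "K \<subseteq> J" "charts V \<psi>" for K V \<psi>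
    using that
  proof (induction K)
    case (insert k K)
    then show ?case using \<beta>_C1 chart_open by (simp add: Ck_on_add)
  qed (auto simp: Ck_on_const)
  have "partition_of_unity J \<eta>"
    unfolding partition_of_unity_def
  proof (intro conjI ballI allI impI)
    show "finite J" by fact
    show "case j of (U, \<phi>, a, b) \<Rightarrow> charts U \<phi> \<and> cbox a b \<subseteq> U \<and>
      (\<forall>p \<in> M. p \<notin> \<phi> ` box a b \<longrightarrow> \<eta> (U, \<phi>, a, b) p = 0)" if "j \<in> J" for j
      using that J(1) chart_bump_outside by (auto simp: T_def \<eta>_def \<beta>_def)
    show "Ck_on 1 V (\<eta> j \<circ> \<psi>)" if "j \<in> J" "charts V \<psi>" for j V \<psi>
    proof -
      have "Ck_on 1 V (\<lambda>v. inverse (\<Sum>k\<in>J. \<beta> k (\<psi> v)))"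
        using Ck_on_inverse[OF chart_open[OF that(2)] sum_C1[OF J(2) order_refl that(2)]]
          pos chart_in[OF that(2)] by force
      from Ck_on_bilinear[OF bounded_bilinear_mult chart_open[OF that(2)] \<beta>_C1[OF that] this]
      show ?thesis by (simp add: \<eta>_def[abs_def] o_def)
    qed
    show "(\<Sum>j\<in>J. \<eta> j p) = 1" if "p \<in> M" for p
      using pos[OF that] by (simp add: \<eta>_def sum_distrib_right[symmetric])
  qed
  then show ?thesis by blast
qed

end

subsection \<open>Integrals over a closed surface\<close>

lemma continuous_on_area_density:
  assumes "open U" "smooth_on U (f \<circ> \<phi>)"
  shows "continuous_on U (area_density f \<phi>)"
proof -
  have "continuous_on U (\<lambda>u. lorentz (dird v (f \<circ> \<phi>) u) (dird w (f \<circ> \<phi>) u))" for v w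
    using assms(2) smooth_on_dird smooth_on_imp_continuous
    by (intro bounded_bilinear.continuous_on[OF lorentz_bilinear]) blast+
  then show ?thesis
    unfolding area_density_def[abs_def] det_2 first_ff_component
    by (intro continuous_intros) auto
qed

context atlas
begin

lemma surface_integral_cong:
  assumes "\<And>U \<phi> u. charts U \<phi> \<Longrightarrow> u \<in> U \<Longrightarrow> Q \<phi> u = Q' \<phi> u"
  shows "surface_integral cs f Q = surface_integral cs f Q'"
  unfolding surface_integral_def Let_def
proof (intro sum.cong set_lebesgue_integral_cong refl allI impI)
  fix i u assume "i \<in> {..<length cs}" "u \<in> chart_piece cs i"
  then have "Q (snd (cs ! i)) u = Q' (snd (cs ! i)) u"
    using assms[OF chart_nth] by (auto simp: chart_piece_def)
  then show "Q (snd (cs ! i)) u * sqrt (det (first_ff (f \<circ> snd (cs ! i)) u)) =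
    Q' (snd (cs ! i)) u * sqrt (det (first_ff (f \<circ> snd (cs ! i)) u))" by simp
qed (use chart_piece_borel in auto)

lemma surface_integral_sum:
  assumes "finite J"
    and "\<And>j i. j \<in> J \<Longrightarrow> i < length cs \<Longrightarrow> set_integrable lborel (chart_piece cs i)
      (\<lambda>u. Q j (snd (cs ! i)) u * area_density f (snd (cs ! i)) u)"
  shows "surface_integral cs f (\<lambda>\<phi> u. \<Sum>j\<in>J. Q j \<phi> u) = (\<Sum>j\<in>J. surface_integral cs f (Q j))"
proof -
  have "(LINT u:chart_piece cs i|lborel.
        (\<Sum>j\<in>J. Q j (snd (cs ! i)) u) * sqrt (det (first_ff (f \<circ> snd (cs ! i)) u))) =
      (\<Sum>j\<in>J. LINT u:chart_piece cs i|lborel.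
        Q j (snd (cs ! i)) u * sqrt (det (first_ff (f \<circ> snd (cs ! i)) u)))"
    if "i < length cs" for i
    using assms(2)[OF _ that]
    unfolding set_integrable_def set_lebesgue_integral_def area_density_def
    by (subst Bochner_Integration.integral_sum[symmetric]) (simp_all add: sum_distrib_right sum_distrib_left)
  then show ?thesis
    unfolding surface_integral_def Let_def by (subst sum.swap) (auto intro: sum.cong)
qed

lemma partition_of_unityD:
  assumes "partition_of_unity J \<eta>"
  shows "finite J"
    and "(U, \<phi>, a, b) \<in> J \<Longrightarrow> charts U \<phi>"
    and "(U, \<phi>, a, b) \<in> J \<Longrightarrow> cbox a b \<subseteq> U"
    and "(U, \<phi>, a, b) \<in> J \<Longrightarrow> p \<in> M \<Longrightarrow> p \<notin> \<phi> ` box a b \<Longrightarrow> \<eta> (U, \<phi>, a, b) p = 0"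
    and "j \<in> J \<Longrightarrow> charts V \<psi> \<Longrightarrow> Ck_on 1 V (\<eta> j \<circ> \<psi>)"
    and "p \<in> M \<Longrightarrow> (\<Sum>j\<in>J. \<eta> j p) = 1"
  using assms unfolding partition_of_unity_def by fast+

definition smooth_map :: "('m \<Rightarrow> minkowski) \<Rightarrow> bool"
  where "smooth_map f \<longleftrightarrow> (\<forall>U \<phi>. charts U \<phi> \<longrightarrow> smooth_on U (f \<circ> \<phi>))"

lemma smooth_map_differentiable:
  "smooth_map f \<Longrightarrow> charts V \<psi> \<Longrightarrow> v \<in> V \<Longrightarrow> (f \<circ> \<psi>) differentiable (at v)"
  unfolding smooth_map_def using smooth_on_has_derivative differentiableI by blast

lemma surface_integral_partition:
  assumes pou: "partition_of_unity J \<eta>" and f: "smooth_map f" and inv: "chart_invariant Q"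
    and cont: "\<And>V \<psi>. charts V \<psi> \<Longrightarrow> continuous_on V (Q \<psi>)"
  shows "surface_integral cs f Q = (\<Sum>(U, \<phi>, a, b)\<in>J.
    integral (cbox a b) (\<lambda>u. \<eta> (U, \<phi>, a, b) (\<phi> u) * (Q \<phi> u * area_density f \<phi> u)))"
proof -
  define R where "R j \<phi> u = \<eta> j (\<phi> u) * Q \<phi> u" for j \<phi> u
  note J = partition_of_unityD[OF pou]
  have R_inv: "chart_invariant (R j)" for j
    using inv unfolding chart_invariant_def R_def by metis
  have R_cont: "continuous_on V (\<lambda>v. R j \<psi> v * area_density f \<psi> v)" if "j \<in> J" "charts V \<psi>" for j V \<psi>
    using Ck_on_imp_continuous[OF J(5)[OF that]] cont[OF that(2)] f that(2)
      continuous_on_area_density[OF chart_open[OF that(2)]]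
    unfolding R_def smooth_map_def by (intro continuous_intros) (auto simp: o_def)
  have R_supp: "R (U, \<phi>, a, b) \<psi> v = 0"
    if "(U, \<phi>, a, b) \<in> J" "charts V \<psi>" "v \<in> V" "\<psi> v \<notin> \<phi> ` cbox a b" for U \<phi> a b V \<psi> v
    using J(4)[OF that(1) chart_in[OF that(2,3)]] that(4) image_mono[OF box_subset_cbox[of a b], of \<phi>]
    by (auto simp: R_def)
  have "surface_integral cs f Q = surface_integral cs f (\<lambda>\<phi> u. \<Sum>j\<in>J. R j \<phi> u)"
    using J(6)[OF chart_in] by (intro surface_integral_cong) (simp add: R_def sum_distrib_right[symmetric])
  also have "\<dots> = (\<Sum>j\<in>J. surface_integral cs f (R j))"
  proof (intro surface_integral_sum J(1))
    fix j i assume ji: "j \<in> J" "i < length cs"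
    obtain U \<phi> a b where j: "j = (U, \<phi>, a, b)" by (cases j)
    show "set_integrable lborel (chart_piece cs i)
      (\<lambda>u. R j (snd (cs ! i)) u * area_density f (snd (cs ! i)) u)"
      using ji unfolding j
      by (intro chart_piece_integral(1)[OF J(2) compact_cbox J(3) _ R_inv R_cont
            smooth_map_differentiable[OF f] R_supp]) auto
  qed
  also have "\<dots> = (\<Sum>(U, \<phi>, a, b)\<in>J.
    integral (cbox a b) (\<lambda>u. \<eta> (U, \<phi>, a, b) (\<phi> u) * (Q \<phi> u * area_density f \<phi> u)))"
  proof (intro sum.cong refl, clarify)
    fix U \<phi> a b assume j: "(U, \<phi>, a, b) \<in> J"
    show "surface_integral cs f (R (U, \<phi>, a, b)) =
      integral (cbox a b) (\<lambda>u. \<eta> (U, \<phi>, a, b) (\<phi> u) * (Q \<phi> u * area_density f \<phi> u))"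
      unfolding mult.assoc[symmetric] R_def[symmetric]
      by (rule surface_integral_in_chart[OF J(2)[OF j] compact_cbox J(3)[OF j] R_inv R_cont[OF j]
          smooth_map_differentiable[OF f] R_supp[OF j]])
  qed
  finally show ?thesis .
qed

text \<open>\<open>P\<close> is a vector field times the area density. Integration by parts moves
  the derivative onto each function of the partition and leaves minus the pairing of
  \<open>P\<close> with its differential. By \<open>inv\<close> these pairings are functions on the
  surface, so they can be added pointwise, and the differentials sum to that of the constant
  1.\<close>

lemma surface_divergence_theorem:
  assumes pou: "partition_of_unity J \<eta>" and f: "smooth_map f"
    and pos: "\<And>U \<phi> u. charts U \<phi> \<Longrightarrow> u \<in> U \<Longrightarrow> area_density f \<phi> u > 0"
    and P: "\<And>U \<phi> i. charts U \<phi> \<Longrightarrow> Ck_on 1 U (P \<phi> i)"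
    and inv: "\<And>\<eta>. (\<And>U \<phi>. charts U \<phi> \<Longrightarrow> Ck_on 1 U (\<eta> \<circ> \<phi>)) \<Longrightarrow> chart_invariant (\<lambda>\<phi> u.
      (P \<phi> 1 u * dird (e2 1) (\<eta> \<circ> \<phi>) u + P \<phi> 2 u * dird (e2 2) (\<eta> \<circ> \<phi>) u) / area_density f \<phi> u)"
  shows "(\<Sum>(U, \<phi>, a, b)\<in>J. integral (cbox a b) (\<lambda>u. \<eta> (U, \<phi>, a, b) (\<phi> u) *
    (dird (e2 1) (P \<phi> 1) u + dird (e2 2) (P \<phi> 2) u))) = 0"
proof -
  note J = partition_of_unityD[OF pou]
  define Z where "Z j \<phi> u = (P \<phi> 1 u * dird (e2 1) (\<eta> j \<circ> \<phi>) u +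
    P \<phi> 2 u * dird (e2 2) (\<eta> j \<circ> \<phi>) u) / area_density f \<phi> u" for j \<phi> u
  have Z_dens: "Z j \<phi> u * area_density f \<phi> u =
      P \<phi> 1 u * dird (e2 1) (\<eta> j \<circ> \<phi>) u + P \<phi> 2 u * dird (e2 2) (\<eta> j \<circ> \<phi>) u"
    if "charts U \<phi>" "u \<in> U" for j U \<phi> u
    using pos[OF that] by (simp add: Z_def)
  have Z_inv: "chart_invariant (Z j)" if "j \<in> J" for j
    using inv J(5)[OF that] unfolding Z_def[abs_def] by blast
  have d_cont: "continuous_on V (dird v (\<eta> j \<circ> \<psi>))" if "j \<in> J" "charts V \<psi>" for j V \<psi> v
    using J(5)[OF that] by (simp add: Ck_on_Suc)
  have P_cont: "continuous_on V (P \<psi> i)" "continuous_on V (dird v (P \<psi> i))"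
    if "charts V \<psi>" for V \<psi> i v
    using P[OF that] Ck_on_imp_continuous[OF P[OF that]] by (auto simp: Ck_on_Suc)
  have Z_cont: "continuous_on V (\<lambda>v. Z j \<psi> v * area_density f \<psi> v)" if "j \<in> J" "charts V \<psi>" for j V \<psi>
  proof -
    have "continuous_on V (\<lambda>u. P \<psi> 1 u * dird (e2 1) (\<eta> j \<circ> \<psi>) u +
        P \<psi> 2 u * dird (e2 2) (\<eta> j \<circ> \<psi>) u)"
      by (intro continuous_intros P_cont d_cont that)
    then show ?thesis using Z_dens[OF that(2)] by (simp cong: continuous_on_cong)
  qed
  \<comment> \<open>The derivative of a function vanishes on every open set where the function does;
    the closed box is taken so that the complement of its image is open.\<close>
  have Z_supp: "Z (U, \<phi>, a, b) \<psi> v = 0"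
    if j: "(U, \<phi>, a, b) \<in> J" and V: "charts V \<psi>" "v \<in> V" and nin: "\<psi> v \<notin> \<phi> ` cbox a b" for U \<phi> a b V \<psi> v
  proof -
    define W where "W = {v \<in> V. \<psi> v \<notin> \<phi> ` cbox a b}"
    have "open (V \<inter> \<psi> -` (- \<phi> ` cbox a b))"
      using continuous_open_preimage[OF chart_continuous[OF V(1)] chart_open[OF V(1)]]
        compact_continuous_image[OF continuous_on_subset[OF chart_continuous[OF J(2)[OF j]] J(3)[OF j]] compact_cbox]
      by (simp add: compact_imp_closed open_Compl)
    then have W: "open W" by (simp add: W_def vimage_def Int_def)
    have "(\<eta> (U, \<phi>, a, b) \<circ> \<psi>) w = 0" if "w \<in> W" for w
      using that J(4)[OF j chart_in[OF V(1)], of w] image_mono[OF box_subset_cbox[of a b], of \<phi>]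
      by (auto simp: W_def)
    then have "dird x (\<eta> (U, \<phi>, a, b) \<circ> \<psi>) v = dird x (\<lambda>_. 0) v" for x
      using nin V(2) by (intro dird_cong[OF W]) (auto simp: W_def)
    then show ?thesis by (simp add: Z_def dird_def)
  qed
  have Z_int: "surface_integral cs f (Z (U, \<phi>, a, b)) =
      - integral (cbox a b) (\<lambda>u. \<eta> (U, \<phi>, a, b) (\<phi> u) *
          (dird (e2 1) (P \<phi> 1) u + dird (e2 2) (P \<phi> 2) u))"
    if j: "(U, \<phi>, a, b) \<in> J" for U \<phi> a b
  proof -
    let ?\<eta> = "\<eta> (U, \<phi>, a, b)"
    note \<phi> = J(2)[OF j] and ab = J(3)[OF j]
    have \<eta>: "Ck_on 1 U (?\<eta> \<circ> \<phi>)" by (rule J(5)[OF j \<phi>])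
    have prod: "Ck_on 1 U (\<lambda>u. (?\<eta> \<circ> \<phi>) u * P \<phi> i u)" for i
      using Ck_on_bilinear[OF bounded_bilinear_mult chart_open[OF \<phi>] \<eta> P[OF \<phi>]] .
    \<comment> \<open>The product vanishes outside the open box, so no boundary contribution
      arises.\<close>
    have zero: "integral (cbox a b) (dird v (\<lambda>u. (?\<eta> \<circ> \<phi>) u * P \<phi> i u)) = 0" for v i
    proof (rule integral_dird_eq_0[OF chart_open[OF \<phi>] ab prod])
      show "(?\<eta> \<circ> \<phi>) u * P \<phi> i u = 0" if "u \<in> U" "u \<notin> box a b" for u
        using J(4)[OF j chart_in[OF \<phi> that(1)]] that ab box_subset_cbox[of a b]
          inj_on_image_mem_iff[OF chart_inj[OF \<phi>] that(1), of "box a b"] by auto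
    qed
    have leibniz: "dird v (\<lambda>u. (?\<eta> \<circ> \<phi>) u * P \<phi> i u) u =
        (?\<eta> \<circ> \<phi>) u * dird v (P \<phi> i) u + dird v (?\<eta> \<circ> \<phi>) u * P \<phi> i u" if "u \<in> U" for u v i
    proof -
      have "((?\<eta> \<circ> \<phi>) has_derivative (\<lambda>v. dird v (?\<eta> \<circ> \<phi>) u)) (at u)"
        "(P \<phi> i has_derivative (\<lambda>v. dird v (P \<phi> i) u)) (at u)"
        using \<eta> P[OF \<phi>] that by (auto simp: Ck_on_Suc dird_def frechet_derivative_works)
      from has_derivative_mult[OF this] show ?thesis by (rule dird_eq)
    qed
    have sub: "continuous_on (cbox a b) h" if "continuous_on U h" for h :: "real^2 \<Rightarrow> real"
      using that ab continuous_on_subset by blast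
    have io: "(\<lambda>u. (?\<eta> \<circ> \<phi>) u * dird v (P \<phi> i) u) integrable_on cbox a b"
      "(\<lambda>u. dird v (?\<eta> \<circ> \<phi>) u * P \<phi> i u) integrable_on cbox a b" for v i
      using P_cont[OF \<phi>] d_cont[OF j \<phi>] Ck_on_imp_continuous[OF \<eta>]
      by (auto intro!: integrable_continuous sub continuous_on_mult)
    have parts: "integral (cbox a b) (\<lambda>u. dird v (?\<eta> \<circ> \<phi>) u * P \<phi> i u) =
        - integral (cbox a b) (\<lambda>u. (?\<eta> \<circ> \<phi>) u * dird v (P \<phi> i) u)" for v i
    proof -
      have "integral (cbox a b) (\<lambda>u. (?\<eta> \<circ> \<phi>) u * dird v (P \<phi> i) u + dird v (?\<eta> \<circ> \<phi>) u * P \<phi> i u) = 0"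
        using zero[of v i] leibniz ab
        by (subst (asm) Henstock_Kurzweil_Integration.integral_cong[OF leibniz]) auto
      then show ?thesis using Henstock_Kurzweil_Integration.integral_add[OF io] by simp
    qed
    have "surface_integral cs f (Z (U, \<phi>, a, b)) =
        integral (cbox a b) (\<lambda>u. Z (U, \<phi>, a, b) \<phi> u * area_density f \<phi> u)"
      by (rule surface_integral_in_chart[OF \<phi> compact_cbox ab Z_inv[OF j] Z_cont[OF j]
          smooth_map_differentiable[OF f] Z_supp[OF j]])
    also have "\<dots> = integral (cbox a b) (\<lambda>u. dird (e2 1) (?\<eta> \<circ> \<phi>) u * P \<phi> 1 u +
        dird (e2 2) (?\<eta> \<circ> \<phi>) u * P \<phi> 2 u)"
      using ab Z_dens[OF \<phi>]
      by (intro Henstock_Kurzweil_Integration.integral_cong) (auto simp: mult.commute)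
    also have "\<dots> = - (integral (cbox a b) (\<lambda>u. (?\<eta> \<circ> \<phi>) u * dird (e2 1) (P \<phi> 1) u) +
        integral (cbox a b) (\<lambda>u. (?\<eta> \<circ> \<phi>) u * dird (e2 2) (P \<phi> 2) u))"
      by (simp add: Henstock_Kurzweil_Integration.integral_add[OF io(2) io(2)] parts)
    also have "\<dots> = - integral (cbox a b) (\<lambda>u. ?\<eta> (\<phi> u) *
          (dird (e2 1) (P \<phi> 1) u + dird (e2 2) (P \<phi> 2) u))"
      using Henstock_Kurzweil_Integration.integral_add[OF io(1) io(1), of "e2 1" 1 "e2 2" 2]
      by (simp add: distrib_left)
    finally show ?thesis .
  qed
  have "(\<Sum>j\<in>J. surface_integral cs f (Z j)) = surface_integral cs f (\<lambda>\<phi> u. \<Sum>j\<in>J. Z j \<phi> u)"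
  proof (intro surface_integral_sum[symmetric] J(1))
    fix j i assume ji: "j \<in> J" "i < length cs"
    obtain U \<phi> a b where j: "j = (U, \<phi>, a, b)" by (cases j)
    show "set_integrable lborel (chart_piece cs i)
      (\<lambda>u. Z j (snd (cs ! i)) u * area_density f (snd (cs ! i)) u)"
      using ji unfolding j
      by (intro chart_piece_integral(1)[OF J(2) compact_cbox J(3) _ Z_inv Z_cont
            smooth_map_differentiable[OF f] Z_supp]) auto
  qed
  also have "\<dots> = surface_integral cs f (\<lambda>\<phi> u. 0)"
  proof (rule surface_integral_cong)
    fix U \<phi> u assume \<phi>: "charts U \<phi>" and u: "u \<in> U"
    have "(\<Sum>j\<in>J. dird v (\<eta> j \<circ> \<phi>) u) = 0" for v
    proof -
      have "((\<eta> j \<circ> \<phi>) has_derivative (\<lambda>v. dird v (\<eta> j \<circ> \<phi>) u)) (at u)" if "j \<in> J" for j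
        using J(5)[OF that \<phi>] u by (auto simp: Ck_on_Suc dird_def frechet_derivative_works)
      then have "(\<Sum>j\<in>J. dird v (\<eta> j \<circ> \<phi>) u) = dird v (\<lambda>x. \<Sum>j\<in>J. (\<eta> j \<circ> \<phi>) x) u"
        by (intro dird_eq[symmetric] has_derivative_sum)
      also have "\<dots> = dird v (\<lambda>x. 1) u"
        by (rule dird_cong[OF chart_open[OF \<phi>] u]) (use J(6)[OF chart_in[OF \<phi>]] in simp)
      finally show ?thesis by (simp add: dird_def)
    qed
    then show "(\<Sum>j\<in>J. Z j \<phi> u) = 0"
      by (simp add: Z_def sum_divide_distrib[symmetric] sum.distrib sum_distrib_left[symmetric])
  qed
  also have "\<dots> = 0" by (simp add: surface_integral_def Let_def)
  finally have "(\<Sum>j\<in>J. surface_integral cs f (Z j)) = 0" .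
  moreover have "(\<Sum>j\<in>J. surface_integral cs f (Z j)) = - (\<Sum>(U, \<phi>, a, b)\<in>J. integral (cbox a b)
      (\<lambda>u. \<eta> (U, \<phi>, a, b) (\<phi> u) * (dird (e2 1) (P \<phi> 1) u + dird (e2 2) (P \<phi> 2) u)))"
    unfolding sum_negf[symmetric]
    by (intro sum.cong refl, clarify) (simp add: Z_int)
  ultimately show ?thesis by simp
qed

text \<open>The partition lives on the fixed surface \<open>M\<close> and does not move, so only the
  density \<open>W\<close> is differentiated. On a compact box the joint continuity of its time
  derivative justifies differentiation under the integral.\<close>

lemma surface_integral_has_real_derivative:
  assumes pou: "partition_of_unity J \<eta>" and I: "open I" "t \<in> I"
    and F: "\<And>s. s \<in> I \<Longrightarrow> smooth_map (F s)"
    and inv: "\<And>s. s \<in> I \<Longrightarrow> chart_invariant (Q s)"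
    and cont: "\<And>s V \<psi>. s \<in> I \<Longrightarrow> charts V \<psi> \<Longrightarrow> continuous_on V (Q s \<psi>)"
    and W: "\<And>U \<phi>. charts U \<phi> \<Longrightarrow> smooth_on (U \<times> I) (W \<phi>)"
    and W_eq: "\<And>U \<phi> u s. charts U \<phi> \<Longrightarrow> u \<in> U \<Longrightarrow> s \<in> I \<Longrightarrow>
      W \<phi> (u, s) = Q s \<phi> u * area_density (F s) \<phi> u"
  shows "((\<lambda>s. surface_integral cs (F s) (Q s)) has_real_derivative
    (\<Sum>(U, \<phi>, a, b)\<in>J. integral (cbox a b)
      (\<lambda>u. \<eta> (U, \<phi>, a, b) (\<phi> u) * dird (0, 1) (W \<phi>) (u, t)))) (at t)"
proof -
  note J = partition_of_unityD[OF pou]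
  obtain e where e: "e > 0" "ball t e \<subseteq> I" using I open_contains_ball by blast
  have summand: "((\<lambda>s. integral (cbox a b) (\<lambda>u. \<eta> (U, \<phi>, a, b) (\<phi> u) * W \<phi> (u, s)))
      has_real_derivative integral (cbox a b)
      (\<lambda>u. \<eta> (U, \<phi>, a, b) (\<phi> u) * dird (0, 1) (W \<phi>) (u, t))) (at t)"
    if j: "(U, \<phi>, a, b) \<in> J" for U \<phi> a b
  proof -
    note \<phi> = J(2)[OF j] and ab = J(3)[OF j]
    have \<eta>: "continuous_on (cbox a b) (\<lambda>u. \<eta> (U, \<phi>, a, b) (\<phi> u))"
      using Ck_on_imp_continuous[OF J(5)[OF j \<phi>]] continuous_on_subset[OF _ ab] by (simp add: o_def)
    have *: "((\<lambda>s. integral (cbox a b) (\<lambda>u. \<eta> (U, \<phi>, a, b) (\<phi> u) * W \<phi> (u, s)))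
      has_real_derivative integral (cbox a b)
      (\<lambda>u. \<eta> (U, \<phi>, a, b) (\<phi> u) * dird (0, 1) (W \<phi>) (u, t))) (at t within ball t e)"
    proof (rule leibniz_rule_field_derivative)
      fix s u assume s: "s \<in> ball t e" and u: "u \<in> cbox a b"
      have "(u, s) \<in> U \<times> I" using s u e ab by auto
      then have "((\<lambda>r. W \<phi> ((u, 0) + r *\<^sub>R (0, 1))) has_vector_derivative
          dird (0, 1) (W \<phi>) ((u, 0) + s *\<^sub>R (0, 1))) (at s)"
        by (intro smooth_on_line_derivative[OF W[OF \<phi>]]) simp
      then have "((\<lambda>r. W \<phi> (u, r)) has_real_derivative dird (0, 1) (W \<phi>) (u, s)) (at s)"
        by (simp add: has_real_derivative_iff_has_vector_derivative)
      then show "((\<lambda>s. \<eta> (U, \<phi>, a, b) (\<phi> u) * W \<phi> (u, s)) has_real_derivative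
          \<eta> (U, \<phi>, a, b) (\<phi> u) * dird (0, 1) (W \<phi>) (u, s)) (at s within ball t e)"
        by (rule has_field_derivative_at_within[OF DERIV_cmult])
    next
      fix s assume "s \<in> ball t e"
      then show "(\<lambda>u. \<eta> (U, \<phi>, a, b) (\<phi> u) * W \<phi> (u, s)) integrable_on cbox a b"
        using e ab by (intro integrable_continuous continuous_intros \<eta>
            continuous_on_compose2[OF smooth_on_imp_continuous[OF W[OF \<phi>]]]) auto
    next
      show "continuous_on (ball t e \<times> cbox a b)
          (\<lambda>(s, u). \<eta> (U, \<phi>, a, b) (\<phi> u) * dird (0, 1) (W \<phi>) (u, s))"
        unfolding case_prod_unfold using e ab
        by (intro continuous_intros continuous_on_compose2[OF \<eta>]
            continuous_on_compose2[OF smooth_on_imp_continuous[OF smooth_on_dird[OF W[OF \<phi>]]]]) auto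
    qed (use e in auto)
    then show ?thesis using at_within_open[of t "ball t e"] e(1) by simp
  qed
  have "((\<lambda>s. \<Sum>(U, \<phi>, a, b)\<in>J. integral (cbox a b) (\<lambda>u. \<eta> (U, \<phi>, a, b) (\<phi> u) * W \<phi> (u, s)))
    has_real_derivative (\<Sum>(U, \<phi>, a, b)\<in>J. integral (cbox a b)
      (\<lambda>u. \<eta> (U, \<phi>, a, b) (\<phi> u) * dird (0, 1) (W \<phi>) (u, t)))) (at t)"
    by (rule DERIV_sum) (use summand in \<open>auto split: prod.split\<close>)
  then show ?thesis
  proof (rule has_field_derivative_transform_within_open[OF _ I])
    fix s assume s: "s \<in> I"
    have partition: "surface_integral cs (F s) (Q s) = (\<Sum>(U, \<phi>, a, b)\<in>J. integral (cbox a b)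
        (\<lambda>u. \<eta> (U, \<phi>, a, b) (\<phi> u) * (Q s \<phi> u * area_density (F s) \<phi> u)))"
      by (rule surface_integral_partition[OF pou F[OF s] inv[OF s] cont[OF s]])
    show "(\<Sum>(U, \<phi>, a, b)\<in>J. integral (cbox a b) (\<lambda>u. \<eta> (U, \<phi>, a, b) (\<phi> u) * W \<phi> (u, s))) =
      surface_integral cs (F s) (Q s)"
      unfolding partition
    proof (intro sum.cong refl, clarify)
      fix U \<phi> a b assume j: "(U, \<phi>, a, b) \<in> J"
      show "integral (cbox a b) (\<lambda>u. \<eta> (U, \<phi>, a, b) (\<phi> u) * W \<phi> (u, s)) =
        integral (cbox a b) (\<lambda>u. \<eta> (U, \<phi>, a, b) (\<phi> u) * (Q s \<phi> u * area_density (F s) \<phi> u))"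
        using W_eq[OF J(2)[OF j] _ s] J(3)[OF j]
        by (intro Henstock_Kurzweil_Integration.integral_cong) auto
    qed
  qed
qed

end

subsection \<open>Lorentzian linear algebra\<close>

text \<open>The orthogonal complement of a timelike vector is positive definite; this is
  Cauchy-Schwarz for the spatial parts.\<close>

lemma lorentz_spacelike:
  assumes "lorentz p p = -1" "lorentz v p = 0" "v \<noteq> 0"
  shows "lorentz v v > 0"
proof -
  obtain a \<alpha> b \<beta> where eq: "v = (a, \<alpha>)" "p = (b, \<beta>)" by (metis surj_pair)
  have 1: "b \<bullet> b = \<beta>\<^sup>2 - 1" "a \<bullet> b = \<alpha> * \<beta>"
    using assms(1,2) by (simp_all add: lorentz_def eq power2_eq_square)
  have "(\<alpha> * \<beta>)\<^sup>2 \<le> (a \<bullet> a) * (\<beta>\<^sup>2 - 1)"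
    using Cauchy_Schwarz_ineq[of a b] by (simp add: 1)
  then have 2: "a \<bullet> a \<le> (a \<bullet> a - \<alpha>\<^sup>2) * \<beta>\<^sup>2" by (simp add: algebra_simps power_mult_distrib)
  have "\<beta>\<^sup>2 > 0" using 1(1) inner_ge_zero[of b] by linarith
  moreover have "a \<noteq> 0"
  proof
    assume "a = 0"
    then have "\<alpha> = 0" using 1(2) \<open>\<beta>\<^sup>2 > 0\<close> by simp
    with \<open>a = 0\<close> assms(3) show False by (simp add: eq zero_prod_def)
  qed
  ultimately have "a \<bullet> a - \<alpha>\<^sup>2 > 0"
    using 2 by (smt (verit) inner_gt_zero_iff zero_less_mult_pos2)
  then show ?thesis by (simp add: lorentz_def eq power2_eq_square)
qed

text \<open>Serves in contrapositive form: a vector of nonzero Lorentz square that is orthogonal to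
  \<open>B\<close> lies outside its span.\<close>

lemma lorentz_span_orthogonal:
  assumes "v \<in> span B" "\<And>b. b \<in> B \<Longrightarrow> lorentz b v = 0"
  shows "lorentz v v = 0"
proof -
  have "subspace {y. lorentz y v = 0}" by (simp add: subspace_def lorentz_simps)
  then have "span B \<subseteq> {y. lorentz y v = 0}" using assms(2) by (intro span_minimal) auto
  then show ?thesis using assms(1) by blast
qed

text \<open>The vectors \<open>p\<close>, \<open>T\<close>, \<open>a\<close>, \<open>b\<close> form
  a frame of four-dimensional Minkowski space: the remainder \<open>z\<close> of the expansion is
  orthogonal to all of them, and were it nonzero there would be five independent vectors. The first
  term is negative because \<open>p\<close> is timelike.\<close>

lemma lorentz_frame_expansion:
  assumes p: "lorentz p p = -1" and T: "lorentz T p = 0" "lorentz T T > 0"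
    and a: "lorentz a p = 0" "lorentz a T = 0" and b: "lorentz b p = 0" "lorentz b T = 0"
    and D: "lorentz a a * lorentz b b - (lorentz a b)\<^sup>2 > 0"
  shows "lorentz v w = - lorentz v p * lorentz w p + lorentz v T * lorentz w T / lorentz T T +
    (lorentz b b * lorentz v a * lorentz w a
      - lorentz a b * (lorentz v a * lorentz w b + lorentz v b * lorentz w a)
      + lorentz a a * lorentz v b * lorentz w b) / (lorentz a a * lorentz b b - (lorentz a b)\<^sup>2)"
proof -
  define d where "d = lorentz a a * lorentz b b - (lorentz a b)\<^sup>2"
  \<comment> \<open>\<open>x\<close> and \<open>y\<close> solve the Gram system for the components
    along \<open>a\<close> and \<open>b\<close> by Cramer's rule.\<close>
  define x where "x = (lorentz b b * lorentz v a - lorentz a b * lorentz v b) / d"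
  define y where "y = (lorentz a a * lorentz v b - lorentz a b * lorentz v a) / d"
  define z where "z = v + lorentz v p *\<^sub>R p - (lorentz v T / lorentz T T) *\<^sub>R T - x *\<^sub>R a - y *\<^sub>R b"
  note comm = lorentz_commute[of p T] lorentz_commute[of p a] lorentz_commute[of p b]
    lorentz_commute[of T a] lorentz_commute[of T b] lorentz_commute[of b a]
  have "d > 0" using D by (simp add: d_def)
  have xy: "x * lorentz a a + y * lorentz a b = lorentz v a" "x * lorentz a b + y * lorentz b b = lorentz v b"
    using \<open>d > 0\<close> unfolding x_def y_def
    by (simp_all add: field_simps) (simp_all add: d_def algebra_simps power2_eq_square)
  have "lorentz T T \<noteq> 0" using T(2) by simp
  then have z: "lorentz z p = 0" "lorentz z T = 0" "lorentz z a = 0" "lorentz z b = 0"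
    using xy unfolding z_def lorentz_simps by (simp_all add: p T a b comm)
  have "z = 0"
  proof (rule ccontr)
    assume "z \<noteq> 0"
    then have "lorentz z z > 0" using lorentz_spacelike[OF p z(1)] by blast
    moreover have "lorentz y z = 0" if "y \<in> {p, T, b, a}" for y
      using that z lorentz_commute[of y z] by auto
    ultimately have "z \<notin> span {p, T, b, a}"
      using lorentz_span_orthogonal[of z "{p, T, b, a}"] by fastforce
    moreover have "p \<notin> span {T, b, a}"
      using lorentz_span_orthogonal[of p "{T, b, a}"] p T a b by auto
    moreover have "T \<notin> span {b, a}"
      using lorentz_span_orthogonal[of T "{b, a}"] T a b by auto
    moreover have "b \<notin> span {a}"
    proof
      assume "b \<in> span {a}"
      then obtain r where "b = r *\<^sub>R a" by (auto simp: span_singleton)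
      then show False using D by (simp add: lorentz_simps power2_eq_square)
    qed
    moreover have "independent {a}" using D by (auto simp: lorentz_simps)
    moreover have "independent (insert y B) \<and> card (insert y B) = Suc (card B)"
      if "independent B" "y \<notin> span B" for y :: minkowski and B
      using that independent_insertI independent_imp_finite span_base card_insert_disjoint by metis
    ultimately have "independent {z, p, T, b, a}" "card {z, p, T, b, a} = 5"
      by simp_all
    then show False using independent_bound[of "{z, p, T, b, a}"] by simp
  qed
  then have v: "v = - lorentz v p *\<^sub>R p + (lorentz v T / lorentz T T) *\<^sub>R T + x *\<^sub>R a + y *\<^sub>R b"
    by (simp add: z_def algebra_simps)
  have "lorentz v w = - lorentz v p * lorentz w p + lorentz v T * lorentz w T / lorentz T T +
      (x * lorentz w a + y * lorentz w b)"
    by (subst v) (simp add: lorentz_simps lorentz_commute[of p w] lorentz_commute[of T w]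
        lorentz_commute[of a w] lorentz_commute[of b w])
  also have "x * lorentz w a + y * lorentz w b = (lorentz b b * lorentz v a * lorentz w a
      - lorentz a b * (lorentz v a * lorentz w b + lorentz v b * lorentz w a)
      + lorentz a a * lorentz v b * lorentz w b) / d"
    using \<open>d > 0\<close> by (simp add: x_def y_def field_simps)
  finally show ?thesis unfolding d_def .
qed

subsection \<open>Surface tensors in two dimensions\<close>

lemma matrix_inv_2:
  fixes A :: "real^2^2"
  assumes "det A \<noteq> 0"
  shows "matrix_inv A $ 1 $ 1 = A $ 2 $ 2 / det A" "matrix_inv A $ 1 $ 2 = - A $ 1 $ 2 / det A"
    "matrix_inv A $ 2 $ 1 = - A $ 2 $ 1 / det A" "matrix_inv A $ 2 $ 2 = A $ 1 $ 1 / det A"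
proof -
  define B :: "real^2^2" where "B = (\<chi> i j. (if i = j then (if i = 1 then A $ 2 $ 2 else A $ 1 $ 1)
    else - A $ i $ j) / det A)"
  have "A ** B = mat 1"
    using assms unfolding B_def
    by (simp add: vec_eq_iff forall_2 matrix_matrix_mult_def sum_2 mat_def divide_simps)
      (simp add: det_2 algebra_simps)
  then have AB: "A ** B = mat 1 \<and> B ** A = mat 1" using matrix_left_right_inverse by blast
  then have "A ** matrix_inv A = mat 1 \<and> matrix_inv A ** A = mat 1"
    unfolding matrix_inv_def by (rule someI)
  then have "matrix_inv A = B"
    using AB by (metis matrix_mul_assoc matrix_mul_lid matrix_mul_rid)
  then show "matrix_inv A $ 1 $ 1 = A $ 2 $ 2 / det A" "matrix_inv A $ 1 $ 2 = - A $ 1 $ 2 / det A"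
    "matrix_inv A $ 2 $ 1 = - A $ 2 $ 1 / det A" "matrix_inv A $ 2 $ 2 = A $ 1 $ 1 / det A"
    by (simp_all add: B_def)
qed

lemma trace_inv_mult_2:
  fixes g A :: "real^2^2"
  assumes "det g \<noteq> 0"
  shows "trace (matrix_inv g ** A) = (g $ 2 $ 2 * A $ 1 $ 1 - g $ 1 $ 2 * A $ 2 $ 1
    - g $ 2 $ 1 * A $ 1 $ 2 + g $ 1 $ 1 * A $ 2 $ 2) / det g"
  using assms
  by (simp add: trace_def matrix_matrix_mult_def sum_2 matrix_inv_2) (simp add: field_simps)

text \<open>In dimension two Cayley-Hamilton gives \<open>tr (E^2) = (tr E)^2 - 2 det E\<close>,
  here for \<open>E = matrix_inv g ** A\<close> with determinant
  \<open>det A / det g\<close>.\<close>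

lemma tensor_norm_sq_2:
  assumes "det g \<noteq> 0" "g $ 2 $ 1 = g $ 1 $ 2" "A $ 2 $ 1 = A $ 1 $ 2"
  shows "tensor_norm_sq g A = (trace (matrix_inv g ** A))\<^sup>2 - 2 * det A / det g"
proof -
  have "(det g)\<^sup>2 * tensor_norm_sq g A = (det g * trace (matrix_inv g ** A))\<^sup>2 - 2 * det A * det g"
    using assms
    by (simp add: tensor_norm_sq_def Let_def sum_2 matrix_inv_2 trace_inv_mult_2)
      (simp add: field_simps, simp add: det_2 power2_eq_square algebra_simps)
  then have "tensor_norm_sq g A =
      ((det g * trace (matrix_inv g ** A))\<^sup>2 - 2 * det A * det g) / (det g)\<^sup>2"
    using assms(1) by (simp add: field_simps)
  also have "\<dots> = (trace (matrix_inv g ** A))\<^sup>2 - 2 * det A / det g"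
    using assms(1) by (simp add: diff_divide_distrib power_mult_distrib power2_eq_square)
  finally show ?thesis .
qed

subsection \<open>Evolution equations in a chart\<close>

text \<open>Here \<open>cijl\<close> stands for the Christoffel symbol \<open>\<langle>\<partial>\<^sub>i \<partial>\<^sub>j X, \<partial>\<^sub>l X\<rangle>\<close>, a final \<open>t\<close> for the time derivative and
  \<open>kij_l\<close> for \<open>\<partial>\<^sub>l kij\<close>; \<open>w1\<close>, \<open>w11\<close>, \<open>\<dots>\<close> are the space derivatives of \<open>w\<close>. The equations
  for \<open>k11t\<close>, \<open>k12t\<close>, \<open>k22t\<close> are the evolution equation of the second fundamental form.\<close>

lemma mass_density_identity:
  fixes g11 g12 g22 k11 k12 k22 w w1 w2 wt w11 w12 w22 :: real
    and c111 c112 c121 c122 c221 c222 k11_1 k11_2 k12_1 k12_2 k22_1 k22_2 k11t k12t k22t :: real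
  defines "D \<equiv> g11 * g22 - g12\<^sup>2" and "K \<equiv> k11 * k22 - k12\<^sup>2"
    and "B \<equiv> \<lambda>x1 x2 y1 y2. (g22 * x1 * y1 - g12 * (x1 * y2 + x2 * y1) + g11 * x2 * y2) / (g11 * g22 - g12\<^sup>2)"
  assumes D: "D > 0" and w: "w > 0"
    and tr: "g22 * k11 - 2 * g12 * k12 + g11 * k22 = D"
    and k11t: "k11t = w * g11 + wt * k11 / (2 * w) + B w1 w2 c111 c112 / 2 - w11 / 2 + w1 * w1 / (4 * w) + B k11 k12 k11 k12"
    and k12t: "k12t = w * g12 + wt * k12 / (2 * w) + B w1 w2 c121 c122 / 2 - w12 / 2 + w1 * w2 / (4 * w) + B k11 k12 k12 k22"
    and k22t: "k22t = w * g22 + wt * k22 / (2 * w) + B w1 w2 c221 c222 / 2 - w22 / 2 + w2 * w2 / (4 * w) + B k12 k22 k12 k22"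
    and trt: "4 * K + g22 * k11t - 2 * g12 * k12t + g11 * k22t = 2 * D"
    and codazzi1: "k22_1 - k12_2 = (w1 * k22 - w2 * k12) / (2 * w) - B k11 k12 c221 c222 + B k12 k22 c121 c122"
    and codazzi2: "k11_2 - k12_1 = (w2 * k11 - w1 * k12) / (2 * w) - B k12 k22 c111 c112 + B k11 k12 c121 c122"
  shows "2 * D - 4 * (k11t * k22 + k11 * k22t - 2 * k12 * k12t) - (D - 4 * K) * wt / w =
    (2 * (k22_1 * w1 + k22 * w11 - k12_1 * w2 - k12 * w12)
      - (2 * c122 * w1 + g22 * w11 - (c112 + c121) * w2 - g12 * w12))
    + (2 * (k11_2 * w2 + k11 * w22 - k12_2 * w1 - k12 * w12)
      - (2 * c121 * w2 + g11 * w22 - (c122 + c221) * w1 - g12 * w12))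
    - ((2 * (k22 * w1 - k12 * w2) - (g22 * w1 - g12 * w2)) * w1
      + (2 * (k11 * w2 - k12 * w1) - (g11 * w2 - g12 * w1)) * w2) / w
    - ((2 * (k22 * w1 - k12 * w2) - (g22 * w1 - g12 * w2)) * (c111 * g22 + g11 * c122 - g12 * (c112 + c121))
      + (2 * (k11 * w2 - k12 * w1) - (g11 * w2 - g12 * w1)) * (c121 * g22 + g11 * c222 - g12 * (c122 + c221))) / D
    - (g22 * w1\<^sup>2 - 2 * g12 * w1 * w2 + g11 * w2\<^sup>2) / (2 * w)"
proof -
  have DB: "D * B x1 x2 y1 y2 = g22 * x1 * y1 - g12 * (x1 * y2 + x2 * y1) + g11 * x2 * y2" for x1 x2 y1 y2
    using D by (simp add: B_def D_def)
  \<comment> \<open>The trace of the square of \<open>k\<close> by Cayley-Hamilton; by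
    \<open>tr\<close> the trace of \<open>k\<close> is 1.\<close>
  have "D * (g22 * B k11 k12 k11 k12 - 2 * g12 * B k11 k12 k12 k22 + g11 * B k12 k22 k12 k22) =
      (g22 * k11 - 2 * g12 * k12 + g11 * k22)\<^sup>2 - 2 * K * D"
    by (simp add: DB distrib_left right_diff_distrib mult.left_commute[of D])
      (simp add: D_def K_def power2_eq_square algebra_simps)
  then have "D * (g22 * B k11 k12 k11 k12 - 2 * g12 * B k11 k12 k12 k22 + g11 * B k12 k22 k12 k22) =
      D * (D - 2 * K)"
    unfolding tr by (simp add: power2_eq_square algebra_simps)
  then have tr_kk: "g22 * B k11 k12 k11 k12 - 2 * g12 * B k11 k12 k12 k22 + g11 * B k12 k22 k12 k22 = D - 2 * K"
    using D by simp
  \<comment> \<open>Pairing the square of \<open>k\<close> with the cofactors of \<open>k\<close>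
    gives determinant times trace.\<close>
  have "D * (k22 * B k11 k12 k11 k12 - 2 * k12 * B k11 k12 k12 k22 + k11 * B k12 k22 k12 k22) =
      K * (g22 * k11 - 2 * g12 * k12 + g11 * k22)"
    by (simp add: DB distrib_left right_diff_distrib mult.left_commute[of D])
      (simp add: D_def K_def power2_eq_square algebra_simps)
  then have cof_kk: "k22 * B k11 k12 k11 k12 - 2 * k12 * B k11 k12 k12 k22 + k11 * B k12 k22 k12 k22 = K"
    using D unfolding tr by simp
  \<comment> \<open>Pairings with the cofactors of \<open>g\<close> (\<open>Lc\<close>,
    \<open>Lw\<close>, \<open>N\<close>) and of \<open>k\<close> (\<open>Kc\<close>,
    \<open>Kw\<close>, \<open>Kn\<close>): first the Christoffel part of the covariant Hessian of
    \<open>w\<close>, then its second derivatives, then the square of its gradient.\<close>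
  define Lc where "Lc = g22 * B w1 w2 c111 c112 - 2 * g12 * B w1 w2 c121 c122 + g11 * B w1 w2 c221 c222"
  define Kc where "Kc = k22 * B w1 w2 c111 c112 - 2 * k12 * B w1 w2 c121 c122 + k11 * B w1 w2 c221 c222"
  define Lw where "Lw = g22 * w11 - 2 * g12 * w12 + g11 * w22"
  define Kw where "Kw = k22 * w11 - 2 * k12 * w12 + k11 * w22"
  define N where "N = g22 * w1\<^sup>2 - 2 * g12 * w1 * w2 + g11 * w2\<^sup>2"
  define Kn where "Kn = k22 * w1\<^sup>2 - 2 * k12 * w1 * w2 + k11 * w2\<^sup>2"
  have "g22 * k11t - 2 * g12 * k12t + g11 * k22t = 2 * w * D
      + wt / (2 * w) * (g22 * k11 - 2 * g12 * k12 + g11 * k22) + Lc / 2 - Lw / 2 + N / (4 * w)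
      + (g22 * B k11 k12 k11 k12 - 2 * g12 * B k11 k12 k12 k22 + g11 * B k12 k22 k12 k22)"
    using w unfolding k11t k12t k22t Lc_def Lw_def N_def D_def
    by (simp add: field_simps power2_eq_square)
  then have tr_kt: "g22 * k11t - 2 * g12 * k12t + g11 * k22t =
      2 * w * D + wt / (2 * w) * D + Lc / 2 - Lw / 2 + N / (4 * w) + (D - 2 * K)"
    unfolding tr tr_kk .
  have "k22 * k11t - 2 * k12 * k12t + k11 * k22t = w * (g22 * k11 - 2 * g12 * k12 + g11 * k22)
      + wt / w * K + Kc / 2 - Kw / 2 + Kn / (4 * w)
      + (k22 * B k11 k12 k11 k12 - 2 * k12 * B k11 k12 k12 k22 + k11 * B k12 k22 k12 k22)"
    using w unfolding k11t k12t k22t Kc_def Kw_def Kn_def K_def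
    by (simp add: field_simps power2_eq_square)
  then have cof_kt: "k22 * k11t - 2 * k12 * k12t + k11 * k22t =
      w * D + wt / w * K + Kc / 2 - Kw / 2 + Kn / (4 * w) + K"
    unfolding tr cof_kk .
  \<comment> \<open>The differentiated trace constraint is solved for \<open>wt\<close>; this is the
    evolution equation of the speed, hence of \<open>H\<close>.\<close>
  have wt: "wt / w * D = 2 * D - 4 * K - 4 * w * D - Lc + Lw - N / (2 * w)"
  proof -
    have "wt / (2 * w) * D = (wt / w * D) / 2" "N / (4 * w) = (N / (2 * w)) / 2"
      "2 * w * D = 2 * (w * D)" "4 * w * D = 4 * (w * D)" by simp_all
    note eqs = this
    have "X = 2 * D - 4 * K - 4 * Y - Lc + Lw - Z"
      if "4 * K + S = 2 * D" "S = 2 * Y + X / 2 + Lc / 2 - Lw / 2 + Z / 2 + (D - 2 * K)" for S X Y Z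
      using that by linarith
    from this[OF _ tr_kt[unfolded eqs]] show ?thesis
      using trt unfolding eqs by (simp only: add_diff_eq add.assoc)
  qed
  \<comment> \<open>The ambient curvature contribution \<open>w * D\<close> and the other terms of
    order zero cancel; only terms with space derivatives of \<open>w\<close> survive.\<close>
  have lhs: "2 * D - 4 * (k11t * k22 + k11 * k22t - 2 * k12 * k12t) - (D - 4 * K) * wt / w =
      Lc - Lw + N / (2 * w) - 2 * Kc + 2 * Kw - Kn / w"
  proof -
    have kt: "4 * (k11t * k22 + k11 * k22t - 2 * k12 * k12t) =
        4 * (w * D) + 4 * (wt / w * K) + 2 * Kc - 2 * Kw + Kn / w + 4 * K"
      using arg_cong[OF cof_kt, of "\<lambda>x. 4 * x"] by (simp add: algebra_simps)
    have "(D - 4 * K) * wt / w = wt / w * D - 4 * (wt / w * K)" by (simp add: algebra_simps diff_divide_distrib)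
    then show ?thesis unfolding kt wt by simp
  qed
  \<comment> \<open>The divergence contains derivatives of \<open>k\<close> only through the two
    differences that the Codazzi equations control.\<close>
  have cod: "(k22_1 - k12_2) * w1 + (k11_2 - k12_1) * w2 = Kn / (2 * w)
      - w1 * B k11 k12 c221 c222 + (w1 * B k12 k22 c121 c122 + w2 * B k11 k12 c121 c122) - w2 * B k12 k22 c111 c112"
    using w unfolding codazzi1 codazzi2 Kn_def by (simp add: field_simps power2_eq_square)
  \<comment> \<open>\<open>Z1\<close> and \<open>Z2\<close> are half the space derivatives of
    \<open>D\<close>; they come from the area density in the denominator of the flux.\<close>
  define Z1 where "Z1 = c111 * g22 + g11 * c122 - g12 * (c112 + c121)"
  define Z2 where "Z2 = c121 * g22 + g11 * c222 - g12 * (c122 + c221)"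
  define y where "y = ((k22 * w1 - k12 * w2) * Z1 + (k11 * w2 - k12 * w1) * Z2) / D"
  define z where "z = ((g22 * w1 - g12 * w2) * Z1 + (g11 * w2 - g12 * w1) * Z2) / D"
  have yz: "D * y = (k22 * w1 - k12 * w2) * Z1 + (k11 * w2 - k12 * w1) * Z2"
    "D * z = (g22 * w1 - g12 * w2) * Z1 + (g11 * w2 - g12 * w1) * Z2"
    using D by (simp_all add: y_def z_def)
  have "D \<noteq> 0" using D by simp
  \<comment> \<open>The Christoffel terms from Codazzi and from the area density combine into the
    Christoffel part of the Hessian paired with the cofactors of \<open>k\<close>.\<close>
  have "D * (2 * (- w1 * B k11 k12 c221 c222 + (w1 * B k12 k22 c121 c122 + w2 * B k11 k12 c121 c122) - w2 * B k12 k22 c111 c112)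
      - 2 * y) = D * (- 2 * Kc)"
    unfolding Kc_def
    by (simp add: DB yz distrib_left right_diff_distrib mult.left_commute[of D])
      (simp add: Z1_def Z2_def algebra_simps)
  then have Kc: "2 * (- w1 * B k11 k12 c221 c222 + (w1 * B k12 k22 c121 c122 + w2 * B k11 k12 c121 c122) - w2 * B k12 k22 c111 c112)
      - 2 * y = - 2 * Kc"
    unfolding mult_cancel_left using \<open>D \<noteq> 0\<close> by (elim disjE) blast+
  have "D * (- 2 * c122 * w1 + (c112 + c121) * w2 - 2 * c121 * w2 + (c122 + c221) * w1 + z) = D * Lc"
    unfolding Lc_def
    by (simp add: DB yz distrib_left right_diff_distrib mult.left_commute[of D])
      (simp add: Z1_def Z2_def D_def power2_eq_square algebra_simps)
  then have Lc: "- 2 * c122 * w1 + (c112 + c121) * w2 - 2 * c121 * w2 + (c122 + c221) * w1 + z = Lc"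
    using D by simp
  have quad: "(2 * (k22 * w1 - k12 * w2) - (g22 * w1 - g12 * w2)) * w1
      + (2 * (k11 * w2 - k12 * w1) - (g11 * w2 - g12 * w1)) * w2 = 2 * Kn - N"
    by (simp add: Kn_def N_def power2_eq_square algebra_simps)
  have Zsum: "((2 * (k22 * w1 - k12 * w2) - (g22 * w1 - g12 * w2)) * Z1
      + (2 * (k11 * w2 - k12 * w1) - (g11 * w2 - g12 * w1)) * Z2) / D =
      2 * y - z"
    using D by (simp add: y_def z_def field_simps)
  have "(2 * (k22_1 * w1 + k22 * w11 - k12_1 * w2 - k12 * w12)
      - (2 * c122 * w1 + g22 * w11 - (c112 + c121) * w2 - g12 * w12))
    + (2 * (k11_2 * w2 + k11 * w22 - k12_2 * w1 - k12 * w12)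
      - (2 * c121 * w2 + g11 * w22 - (c122 + c221) * w1 - g12 * w12)) =
    2 * ((k22_1 - k12_2) * w1 + (k11_2 - k12_1) * w2) + 2 * Kw - Lw
    + (- 2 * c122 * w1 + (c112 + c121) * w2 - 2 * c121 * w2 + (c122 + c221) * w1)"
    by (simp add: Kw_def Lw_def algebra_simps)
  then show ?thesis
    unfolding lhs quad Z1_def[symmetric] Z2_def[symmetric] Zsum N_def[symmetric]
    using cod Kc Lc by (simp add: diff_divide_distrib)
qed

lemma smooth_on_lorentz [smooth_intros]:
  "open S \<Longrightarrow> smooth_on S a \<Longrightarrow> smooth_on S b \<Longrightarrow> smooth_on S (\<lambda>x. lorentz (a x) (b x))"
  by (rule smooth_on_bilinear[OF lorentz_bilinear])

lemma dird_lorentz: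
  assumes "smooth_on S a" "smooth_on S b" "x \<in> S"
  shows "dird v (\<lambda>x. lorentz (a x) (b x)) x = lorentz (a x) (dird v b x) + lorentz (dird v a x) (b x)"
  using dird_eq[OF bounded_bilinear.FDERIV[OF lorentz_bilinear
        smooth_on_has_derivative[OF assms(1,3)] smooth_on_has_derivative[OF assms(2,3)]]] .

lemma dird_constant_on:
  assumes "open S" "x \<in> S" "\<forall>y\<in>S. f y = c"
  shows "dird v f x = 0"
  using dird_cong[OF assms(1,2), of f "\<lambda>_. c" v] assms(3) by (simp add: dird_def)

abbreviation space_dir :: "2 \<Rightarrow> (real^2) \<times> real" where "space_dir i \<equiv> (e2 i, 0)"
abbreviation time_dir :: "(real^2) \<times> real" where "time_dir \<equiv> (0, 1)"

text \<open>A surface moving in its normal direction with arbitrary nonzero speed; the structure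
  equations are derived at this generality. The relation between speed and curvature is added in
  \<open>local_imcf\<close>.\<close>

locale local_flow =
  fixes S :: "((real^2) \<times> real) set" and Y :: "(real^2) \<times> real \<Rightarrow> minkowski"
  assumes open_S: "open S" and smooth_Y: "smooth_on S Y"
    and hyperboloid: "x \<in> S \<Longrightarrow> lorentz (Y x) (Y x) = -1"
    and normal: "x \<in> S \<Longrightarrow> lorentz (dird time_dir Y x) (dird (space_dir i) Y x) = 0"
    and moving: "x \<in> S \<Longrightarrow> lorentz (dird time_dir Y x) (dird time_dir Y x) > 0"
    and immersed: "x \<in> S \<Longrightarrow> lorentz (dird (space_dir 1) Y x) (dird (space_dir 1) Y x) *
        lorentz (dird (space_dir 2) Y x) (dird (space_dir 2) Y x) -
        (lorentz (dird (space_dir 1) Y x) (dird (space_dir 2) Y x))\<^sup>2 > 0"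
begin

text \<open>With \<open>f = 1 / H\<close> and second fundamental form \<open>h\<close>: \<open>T = f \<nu>\<close>, \<open>w = f\<^sup>2\<close> and \<open>k = f h\<close>, so
  that \<open>q = |A\<^sub>0|\<^sup>2\<close> and \<open>R = |\<nabla>H|\<^sup>2 / H\<^sup>2\<close> once the trace of \<open>k\<close> is \<open>1\<close>; \<open>P / s\<close> is the vector
  field \<open>- 2 A\<^sub>0 \<nabla>f\<close>. Working with \<open>w\<close> and \<open>k\<close> keeps all these quantities rational in the derivatives
  of \<open>Y\<close>, apart from the area density \<open>s\<close>.\<close>

definition T where "T = dird time_dir Y"
definition X where "X i = dird (space_dir i) Y"
definition XX where "XX i j = dird (space_dir i) (X j)"
definition g where "g i j x = lorentz (X i x) (X j x)"
definition k where "k i j x = - lorentz (T x) (XX i j x)"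
definition w where "w x = lorentz (T x) (T x)"
definition dw where "dw i = dird (space_dir i) w"
definition D where "D x = g 1 1 x * g 2 2 x - (g 1 2 x)\<^sup>2"
definition K where "K x = k 1 1 x * k 2 2 x - (k 1 2 x)\<^sup>2"
definition s where "s x = sqrt (D x)"
definition q where "q x = (1 / 2 - 2 * K x / D x) / w x"
definition A where "A i x = (if i = 1
  then 2 * (k 2 2 x * dw 1 x - k 1 2 x * dw 2 x) - (g 2 2 x * dw 1 x - g 1 2 x * dw 2 x)
  else 2 * (k 1 1 x * dw 2 x - k 1 2 x * dw 1 x) - (g 1 1 x * dw 2 x - g 1 2 x * dw 1 x))" for i :: 2
definition P where "P i x = A i x / (2 * w x * s x)"
definition N where "N x = g 2 2 x * (dw 1 x)\<^sup>2 - 2 * g 1 2 x * dw 1 x * dw 2 x + g 1 1 x * (dw 2 x)\<^sup>2"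
definition R where "R x = N x / (4 * (w x)\<^sup>2 * D x)"

lemma w_pos: "x \<in> S \<Longrightarrow> w x > 0" and D_pos: "x \<in> S \<Longrightarrow> D x > 0" and s_pos: "x \<in> S \<Longrightarrow> s x > 0"
  using moving immersed by (auto simp: w_def T_def D_def g_def X_def s_def power2_eq_square)

lemma smooth_base:
  "smooth_on S T" "smooth_on S (X i)" "smooth_on S (XX i j)"
  "smooth_on S (g i j)" "smooth_on S (k i j)" "smooth_on S w" "smooth_on S (dw i)"
  unfolding T_def X_def XX_def g_def[abs_def] k_def[abs_def] w_def[abs_def] dw_def
  by (intro smooth_intros open_S smooth_Y)+

lemma smooth_D: "smooth_on S D" and smooth_K: "smooth_on S K"
  unfolding D_def[abs_def] K_def[abs_def] by (intro smooth_intros open_S smooth_base)+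

lemma smooth_s: "smooth_on S s"
  unfolding s_def[abs_def] by (intro smooth_intros open_S smooth_D D_pos)

lemma smooth_q: "smooth_on S q"
  unfolding q_def[abs_def]
  using w_pos D_pos by (intro smooth_intros open_S smooth_base smooth_D smooth_K; force)

lemma smooth_A: "smooth_on S (A i)"
  unfolding A_def[abs_def] by (cases "i = 1"; simp; intro smooth_intros open_S smooth_base)

lemma smooth_P: "smooth_on S (P i)"
  unfolding P_def[abs_def]
  using w_pos s_pos by (intro smooth_intros open_S smooth_base smooth_A smooth_s; force)

lemma smooth_R: "smooth_on S R"
  unfolding R_def[abs_def] N_def[abs_def]
  using w_pos D_pos by (intro smooth_intros open_S smooth_base smooth_D; force)

lemma XX_commute: "x \<in> S \<Longrightarrow> XX i j x = XX j i x"
  unfolding XX_def X_def using dird_commute[OF open_S smooth_Y] .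

lemma X_time: "x \<in> S \<Longrightarrow> dird time_dir (X i) x = dird (space_dir i) T x"
  unfolding T_def X_def using dird_commute[OF open_S smooth_Y] .

lemma Y_X: "x \<in> S \<Longrightarrow> lorentz (dird v Y x) (Y x) = 0"
  using dird_constant_on[of S x "\<lambda>y. lorentz (Y y) (Y y)" "-1" v] open_S hyperboloid
    dird_lorentz[OF smooth_Y smooth_Y, of x v]
  by (simp add: lorentz_commute)

lemma dird_T_Y:
  assumes "x \<in> S"
  shows "lorentz (dird v T x) (Y x) = - lorentz (T x) (dird v Y x)"
proof -
  have "\<forall>y\<in>S. lorentz (T y) (Y y) = 0" using Y_X by (simp add: T_def)
  from dird_constant_on[OF open_S assms this] show ?thesis
    using dird_lorentz[OF smooth_base(1) smooth_Y assms, of v] by (simp add: eq_neg_iff_add_eq_0 add.commute)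
qed

lemma dird_T_X:
  assumes "x \<in> S"
  shows "lorentz (dird v T x) (X j x) = - lorentz (T x) (dird v (X j) x)"
proof -
  have "\<forall>y\<in>S. lorentz (T y) (X j y) = 0" using normal by (simp add: T_def X_def)
  from dird_constant_on[OF open_S assms this] show ?thesis
    using dird_lorentz[OF smooth_base(1,2) assms, of v j] by (simp add: eq_neg_iff_add_eq_0 add.commute)
qed

lemma dird_T_T: "x \<in> S \<Longrightarrow> lorentz (dird v T x) (T x) = dird v w x / 2"
  unfolding w_def[abs_def] using dird_lorentz[OF smooth_base(1,1)] by (simp add: lorentz_commute)

lemma dird_g:
  "x \<in> S \<Longrightarrow> dird v (g i j) x = lorentz (X i x) (dird v (X j) x) + lorentz (dird v (X i) x) (X j x)"
  unfolding g_def[abs_def] using dird_lorentz[OF smooth_base(2,2)] .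

lemma dird_k:
  assumes "x \<in> S"
  shows "dird v (k i j) x = - (lorentz (T x) (dird v (XX i j) x) + lorentz (dird v T x) (XX i j x))"
proof -
  have "(\<lambda>x. lorentz (T x) (XX i j x)) = (\<lambda>x. - k i j x)" by (simp add: k_def fun_eq_iff)
  then have "dird v (\<lambda>x. - k i j x) x = lorentz (T x) (dird v (XX i j) x) + lorentz (dird v T x) (XX i j x)"
    using dird_lorentz[OF smooth_base(1,3) assms, of v i j] by simp
  moreover have "dird v (\<lambda>x. - k i j x) x = - dird v (k i j) x"
    using dird_eq[OF has_derivative_minus[OF smooth_on_has_derivative[OF smooth_base(5) assms]]] .
  ultimately show ?thesis by simp
qed

text \<open>The inverse metric applied to two covectors, that is, the tangential part of a Lorentz
  product in terms of components.\<close>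

definition B where "B x a1 a2 b1 b2 = (g 2 2 x * a1 * b1 - g 1 2 x * (a1 * b2 + a2 * b1) + g 1 1 x * a2 * b2)
  / (g 1 1 x * g 2 2 x - (g 1 2 x)\<^sup>2)"

lemma B_scale: "B x (r * a1) (r * a2) b1 b2 = r * B x a1 a2 b1 b2"
  unfolding B_def times_divide_eq_right
  by (rule arg_cong2[where f = "(/)"]) (simp_all add: algebra_simps)

lemma frame_expansion:
  assumes "x \<in> S"
  shows "lorentz u v = - lorentz u (Y x) * lorentz v (Y x) + lorentz u (T x) * lorentz v (T x) / w x
    + B x (lorentz u (X 1 x)) (lorentz u (X 2 x)) (lorentz v (X 1 x)) (lorentz v (X 2 x))"
proof -
  have "lorentz (T x) (Y x) = 0" "lorentz (T x) (T x) > 0" "lorentz (X i x) (Y x) = 0"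
    "lorentz (X i x) (T x) = 0" for i
    using Y_X[OF assms] moving[OF assms] normal[OF assms] by (simp_all add: T_def X_def lorentz_commute)
  from lorentz_frame_expansion[OF hyperboloid[OF assms] this(1-4) this(3,4), of 1 2 u v] show ?thesis
    using D_pos[OF assms] by (simp add: D_def g_def w_def B_def algebra_simps)
qed

text \<open>The Christoffel symbols of the first kind.\<close>

definition c where "c i j l x = lorentz (XX i j x) (X l x)"

text \<open>The first component results from differentiating the orthogonality of \<open>X j\<close>
  and \<open>Y\<close>; it expresses the second fundamental form of the hyperboloid itself.\<close>

lemma XX_components:
  assumes "x \<in> S"
  shows "lorentz (XX i j x) (Y x) = - g i j x" "lorentz (XX i j x) (T x) = - k i j x"
proof -
  have "\<forall>y\<in>S. lorentz (X j y) (Y y) = 0" using Y_X by (simp add: X_def)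
  from dird_constant_on[OF open_S assms this]
  show "lorentz (XX i j x) (Y x) = - g i j x"
    using dird_lorentz[OF smooth_base(2) smooth_Y assms, of "space_dir i" j]
    by (simp add: g_def X_def XX_def lorentz_commute)
  show "lorentz (XX i j x) (T x) = - k i j x" by (simp add: k_def lorentz_commute)
qed

lemma space_T_components:
  assumes "x \<in> S"
  shows "lorentz (dird (space_dir i) T x) (Y x) = 0"
    "lorentz (dird (space_dir i) T x) (T x) = dw i x / 2"
    "lorentz (dird (space_dir i) T x) (X j x) = k i j x"
  using dird_T_Y[OF assms, of "space_dir i"] normal[OF assms, of i]
    dird_T_T[OF assms, of "space_dir i"] dird_T_X[OF assms, of "space_dir i" j]
  by (simp_all add: T_def dw_def k_def XX_def)

text \<open>These are differentiated orthogonality relations and norms. In the tangential one the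
  time derivative of \<open>X j\<close> is the space derivative of \<open>T\<close>, so the gradient
  of the speed appears.\<close>

lemma time_T_components:
  assumes "x \<in> S"
  shows "lorentz (dird time_dir T x) (Y x) = - w x"
    "lorentz (dird time_dir T x) (T x) = dird time_dir w x / 2"
    "lorentz (dird time_dir T x) (X j x) = - dw j x / 2"
  using dird_T_Y[OF assms, of time_dir] dird_T_T[OF assms, of time_dir]
    dird_T_X[OF assms, of time_dir j] X_time[OF assms, of j] space_T_components(2)[OF assms, of j]
  by (simp_all add: T_def w_def lorentz_commute)

lemma k_commute: "x \<in> S \<Longrightarrow> k i j x = k j i x"
  by (simp add: k_def XX_commute)

text \<open>A second differentiation of the relation between \<open>dw j\<close> and the product of
  \<open>T\<close> with its space derivative.\<close>

lemma dw_dw: 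
  assumes "x \<in> S"
  shows "lorentz (T x) (dird (space_dir i) (dird (space_dir j) T) x) =
    dird (space_dir i) (dw j) x / 2 - lorentz (dird (space_dir i) T x) (dird (space_dir j) T x)"
proof -
  have "dw j y = 2 * lorentz (dird (space_dir j) T y) (T y)" if "y \<in> S" for y
    using space_T_components(2)[OF that, of j] by simp
  then have "dird (space_dir i) (dw j) x = dird (space_dir i) (\<lambda>y. 2 * lorentz (dird (space_dir j) T y) (T y)) x"
    by (intro dird_cong[OF open_S assms])
  also have "\<dots> = 2 * dird (space_dir i) (\<lambda>y. lorentz (dird (space_dir j) T y) (T y)) x"
    by (intro dird_bounded_linear[OF bounded_linear_mult_right] smooth_on_has_derivative[OF _ assms]
        smooth_intros open_S smooth_base)
  also have "\<dots> = 2 * (lorentz (dird (space_dir j) T x) (dird (space_dir i) T x) +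
      lorentz (dird (space_dir i) (dird (space_dir j) T) x) (T x))"
    by (subst dird_lorentz[OF smooth_on_dird[OF smooth_base(1)] smooth_base(1) assms]) simp
  finally show ?thesis by (simp add: lorentz_commute add_divide_distrib)
qed

text \<open>The time derivative of \<open>XX i j\<close> is a second space derivative of
  \<open>T\<close>, whose product with \<open>T\<close> reduces to second derivatives of
  \<open>w\<close> by \<open>dw_dw\<close>. Frame expansions supply the rest; the term
  \<open>w g\<close> is the product of the two components along \<open>Y\<close> and carries the
  curvature -1.\<close>

lemma k_time:
  assumes "x \<in> S"
  shows "dird time_dir (k i j) x = w x * g i j x + dird time_dir w x * k i j x / (2 * w x)
    + B x (dw 1 x) (dw 2 x) (c i j 1 x) (c i j 2 x) / 2 - dird (space_dir i) (dw j) x / 2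
    + dw i x * dw j x / (4 * w x) + B x (k i 1 x) (k i 2 x) (k j 1 x) (k j 2 x)"
proof -
  have XX_time: "dird time_dir (XX i j) x = dird (space_dir i) (dird (space_dir j) T) x"
  proof -
    have "dird time_dir (XX i j) x = dird (space_dir i) (dird time_dir (X j)) x"
      unfolding XX_def by (rule dird_commute[OF open_S smooth_base(2) assms])
    also have "\<dots> = dird (space_dir i) (dird (space_dir j) T) x"
      by (rule dird_cong[OF open_S assms X_time])
    finally show ?thesis .
  qed
  have "lorentz (dird (space_dir i) T x) (dird (space_dir j) T x) =
      dw i x * dw j x / (4 * w x) + B x (k i 1 x) (k i 2 x) (k j 1 x) (k j 2 x)"
    by (subst frame_expansion[OF assms]) (simp add: space_T_components[OF assms])
  moreover have "lorentz (dird time_dir T x) (XX i j x) = - w x * g i j x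
      - dird time_dir w x * k i j x / (2 * w x) - B x (dw 1 x) (dw 2 x) (c i j 1 x) (c i j 2 x) / 2"
    using B_scale[of x "-1/2" "dw 1 x" "dw 2 x" "c i j 1 x" "c i j 2 x"]
    by (subst frame_expansion[OF assms])
      (simp add: time_T_components[OF assms] XX_components[OF assms] c_def[symmetric])
  ultimately show ?thesis
    unfolding dird_k[OF assms] XX_time dw_dw[OF assms] by simp
qed

text \<open>The third derivatives of \<open>Y\<close> are symmetric and cancel. No ambient curvature
  term arises because the space derivatives of \<open>T\<close> have no component along
  \<open>Y\<close>; the terms with \<open>dw\<close> reflect that \<open>k\<close> is the second
  fundamental form scaled by the speed.\<close>

lemma codazzi:
  assumes "x \<in> S"
  shows "dird (space_dir l) (k i j) x - dird (space_dir i) (k l j) x =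
    (dw l x * k i j x - dw i x * k l j x) / (2 * w x)
    - B x (k l 1 x) (k l 2 x) (c i j 1 x) (c i j 2 x) + B x (k i 1 x) (k i 2 x) (c l j 1 x) (c l j 2 x)"
proof -
  have XXX: "dird (space_dir l) (XX i j) x = dird (space_dir i) (XX l j) x"
    unfolding XX_def by (rule dird_commute[OF open_S smooth_base(2) assms])
  have "lorentz (dird (space_dir l) T x) (XX i j x) =
      - dw l x * k i j x / (2 * w x) + B x (k l 1 x) (k l 2 x) (c i j 1 x) (c i j 2 x)" for l i j
    by (subst frame_expansion[OF assms])
      (simp add: space_T_components[OF assms] XX_components[OF assms] c_def[symmetric])
  then show ?thesis
    unfolding dird_k[OF assms] XXX by (simp add: diff_divide_distrib)
qed

lemma g_time: "x \<in> S \<Longrightarrow> dird time_dir (g i j) x = 2 * k i j x"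
  using space_T_components(3) k_commute by (simp add: dird_g X_time lorentz_commute[of "X i x"])

lemma g_space: "x \<in> S \<Longrightarrow> dird (space_dir l) (g i j) x = c l j i x + c l i j x"
  by (simp add: dird_g XX_def[symmetric] c_def lorentz_commute[of "X i x"])

lemma c_commute: "x \<in> S \<Longrightarrow> c i j l x = c j i l x"
  by (simp add: c_def XX_commute)

section \<open>Derivatives of the determinants, the area density and the flux\<close>

lemma dird_D:
  assumes "x \<in> S"
  shows "dird v D x = dird v (g 1 1) x * g 2 2 x + g 1 1 x * dird v (g 2 2) x - 2 * g 1 2 x * dird v (g 1 2) x"
proof (rule dird_DERIV_unique[OF smooth_D assms])
  note [derivative_intros] = smooth_on_DERIV[OF smooth_base(4) assms]
  show "((\<lambda>r. D (x + r *\<^sub>R v)) has_real_derivative dird v (g 1 1) x * g 2 2 x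
      + g 1 1 x * dird v (g 2 2) x - 2 * g 1 2 x * dird v (g 1 2) x) (at 0)"
    unfolding D_def by (rule derivative_eq_intros refl)+ simp
qed

lemma dird_K:
  assumes "x \<in> S"
  shows "dird v K x = dird v (k 1 1) x * k 2 2 x + k 1 1 x * dird v (k 2 2) x - 2 * k 1 2 x * dird v (k 1 2) x"
proof (rule dird_DERIV_unique[OF smooth_K assms])
  note [derivative_intros] = smooth_on_DERIV[OF smooth_base(5) assms]
  show "((\<lambda>r. K (x + r *\<^sub>R v)) has_real_derivative dird v (k 1 1) x * k 2 2 x
      + k 1 1 x * dird v (k 2 2) x - 2 * k 1 2 x * dird v (k 1 2) x) (at 0)"
    unfolding K_def by (rule derivative_eq_intros refl)+ simp
qed

lemma DERIV_w: "x \<in> S \<Longrightarrow> ((\<lambda>r. w (x + r *\<^sub>R v)) has_real_derivative dird v w x) (at 0)"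
  by (rule smooth_on_DERIV[OF smooth_base(6)])

lemma dird_s:
  assumes "x \<in> S"
  shows "dird v s x = dird v D x / (2 * s x)"
proof (rule dird_DERIV_unique[OF smooth_s assms])
  show "((\<lambda>r. s (x + r *\<^sub>R v)) has_real_derivative dird v D x / (2 * s x)) (at 0)"
    unfolding s_def using D_pos[OF assms]
    by (auto intro!: derivative_eq_intros smooth_on_DERIV[OF smooth_D assms] simp: field_simps)
qed

lemma s_sq: "x \<in> S \<Longrightarrow> s x * s x = D x"
  using D_pos by (simp add: s_def less_imp_le)

lemma dird_P:
  assumes "x \<in> S"
  shows "dird v (P i) x = (dird v (A i) x - A i x * dird v w x / w x - A i x * dird v D x / (2 * D x))
    / (2 * w x * s x)"
proof (rule dird_DERIV_unique[OF smooth_P assms])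
  note [derivative_intros] = smooth_on_DERIV[OF smooth_A assms] DERIV_w[OF assms] smooth_on_DERIV[OF smooth_s assms]
  show "((\<lambda>r. P i (x + r *\<^sub>R v)) has_real_derivative
      (dird v (A i) x - A i x * dird v w x / w x - A i x * dird v D x / (2 * D x)) / (2 * w x * s x)) (at 0)"
    unfolding P_def using s_pos[OF assms] w_pos[OF assms]
    by (auto intro!: derivative_eq_intros simp: dird_s[OF assms] s_sq[OF assms, symmetric] field_simps)
qed

text \<open>Since \<open>s^2 = D\<close>, the density \<open>q s\<close> equals
  \<open>(D - 4 K) / (2 w s)\<close>. The assumption on \<open>D\<close> expresses that the area
  density grows at rate 1 along \<open>v\<close>.\<close>

lemma dird_qs:
  assumes "x \<in> S" "dird v D x = 2 * D x"
  shows "dird v (\<lambda>x. q x * s x) x + q x * s x =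
    (2 * D x - 4 * dird v K x - (D x - 4 * K x) * dird v w x / w x) / (2 * w x * s x)"
proof -
  have "dird v (\<lambda>x. q x * s x) x = (2 * D x - 4 * dird v K x - (D x - 4 * K x) * dird v w x / w x)
      / (2 * w x * s x) - q x * s x"
  proof (rule dird_DERIV_unique[OF _ assms(1)])
    show "smooth_on S (\<lambda>x. q x * s x)" by (intro smooth_intros open_S smooth_q smooth_s)
    note [derivative_intros] = smooth_on_DERIV[OF smooth_D assms(1)] smooth_on_DERIV[OF smooth_K assms(1)]
      DERIV_w[OF assms(1)] smooth_on_DERIV[OF smooth_s assms(1)]
    have "s x \<noteq> 0" "w x \<noteq> 0" "D x \<noteq> 0" using s_pos[OF assms(1)] w_pos[OF assms(1)] D_pos[OF assms(1)] by simp_all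
    then show "((\<lambda>r. q (x + r *\<^sub>R v) * s (x + r *\<^sub>R v)) has_real_derivative
        (2 * D x - 4 * dird v K x - (D x - 4 * K x) * dird v w x / w x)
        / (2 * w x * s x) - q x * s x) (at 0)"
      unfolding q_def
      by (auto intro!: derivative_eq_intros simp: dird_s[OF assms(1)] assms(2))
        (simp add: s_sq[OF assms(1), symmetric] field_simps)
  qed
  then show ?thesis by simp
qed

lemma dird_A:
  assumes "x \<in> S"
  shows "dird v (A 1) x = 2 * (dird v (k 2 2) x * dw 1 x + k 2 2 x * dird v (dw 1) x
      - dird v (k 1 2) x * dw 2 x - k 1 2 x * dird v (dw 2) x)
      - (dird v (g 2 2) x * dw 1 x + g 2 2 x * dird v (dw 1) x
      - dird v (g 1 2) x * dw 2 x - g 1 2 x * dird v (dw 2) x)" (is "_ = ?A1")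
    and "dird v (A 2) x = 2 * (dird v (k 1 1) x * dw 2 x + k 1 1 x * dird v (dw 2) x
      - dird v (k 1 2) x * dw 1 x - k 1 2 x * dird v (dw 1) x)
      - (dird v (g 1 1) x * dw 2 x + g 1 1 x * dird v (dw 2) x
      - dird v (g 1 2) x * dw 1 x - g 1 2 x * dird v (dw 1) x)" (is "_ = ?A2")
proof -
  note [derivative_intros] = smooth_on_DERIV[OF smooth_base(4) assms]
    smooth_on_DERIV[OF smooth_base(5) assms] smooth_on_DERIV[OF smooth_base(7) assms]
  show "dird v (A 1) x = ?A1"
  proof (rule dird_DERIV_unique[OF smooth_A assms])
    show "((\<lambda>r. A 1 (x + r *\<^sub>R v)) has_real_derivative ?A1) (at 0)"
      unfolding A_def by simp (rule derivative_eq_intros refl | simp add: algebra_simps)+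
  qed
  show "dird v (A 2) x = ?A2"
  proof (rule dird_DERIV_unique[OF smooth_A assms])
    show "((\<lambda>r. A 2 (x + r *\<^sub>R v)) has_real_derivative ?A2) (at 0)"
      unfolding A_def by simp (rule derivative_eq_intros refl | simp add: algebra_simps)+
  qed
qed

end

locale local_imcf = local_flow +
  assumes trace_k: "x \<in> S \<Longrightarrow> g 2 2 x * k 1 1 x - 2 * g 1 2 x * k 1 2 x + g 1 1 x * k 2 2 x = D x"
begin

lemma D_time: "x \<in> S \<Longrightarrow> dird time_dir D x = 2 * D x"
  using trace_k[of x] by (simp add: dird_D g_time algebra_simps)

lemma s_time: "x \<in> S \<Longrightarrow> dird time_dir s x = s x"
  using s_sq[of x] s_pos[of x] by (simp add: dird_s D_time field_simps)

text \<open>The trace constraint is differentiated in time. As \<open>g\<close> changes at rate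
  \<open>2 k\<close>, the metric coefficients contribute \<open>4 K\<close>, and the right-hand side
  is the growth of \<open>D\<close>.\<close>

lemma trace_k_time:
  assumes "x \<in> S"
  shows "4 * K x + g 2 2 x * dird time_dir (k 1 1) x - 2 * g 1 2 x * dird time_dir (k 1 2) x
    + g 1 1 x * dird time_dir (k 2 2) x = 2 * D x"
proof -
  let ?C = "\<lambda>x. g 2 2 x * k 1 1 x - 2 * g 1 2 x * k 1 2 x + g 1 1 x * k 2 2 x"
  note [derivative_intros] = smooth_on_DERIV[OF smooth_base(4) assms, of _ _ time_dir]
    smooth_on_DERIV[OF smooth_base(5) assms, of _ _ time_dir]
  have "dird time_dir ?C x = 4 * K x + g 2 2 x * dird time_dir (k 1 1) x
      - 2 * g 1 2 x * dird time_dir (k 1 2) x + g 1 1 x * dird time_dir (k 2 2) x"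
  proof (rule dird_DERIV_unique[OF _ assms])
    show "smooth_on S ?C" by (intro smooth_intros open_S smooth_base)
    show "((\<lambda>r. ?C (x + r *\<^sub>R time_dir)) has_real_derivative 4 * K x
        + g 2 2 x * dird time_dir (k 1 1) x - 2 * g 1 2 x * dird time_dir (k 1 2) x
        + g 1 1 x * dird time_dir (k 2 2) x) (at 0)"
      by (rule derivative_eq_intros refl)+
        (simp add: g_time[OF assms] K_def power2_eq_square algebra_simps flip: zero_prod_def)
  qed
  moreover have "dird time_dir ?C x = dird time_dir D x"
    by (rule dird_cong[OF open_S assms trace_k])
  ultimately show ?thesis using D_time[OF assms] by simp
qed

text \<open>This is \<open>mass_density_identity\<close> divided by \<open>2 w s\<close>, the common
  denominator of the density and of the flux.\<close>

theorem mass_density_evolution: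
  assumes x: "x \<in> S"
  shows "dird time_dir (\<lambda>x. q x * s x) x =
    dird (space_dir 1) (P 1) x + dird (space_dir 2) (P 2) x - R x * s x - q x * s x"
proof -
  have comm: "k 2 1 x = k 1 2 x" "c 2 1 l x = c 1 2 l x" "g 2 1 x = g 1 2 x"
    "dird v (k 2 1) x = dird v (k 1 2) x" "dird (space_dir 2) (dw 1) x = dird (space_dir 1) (dw 2) x" for l v
  proof -
    show "k 2 1 x = k 1 2 x" by (rule k_commute[OF x])
    show "c 2 1 l x = c 1 2 l x" by (rule c_commute[OF x])
    show "g 2 1 x = g 1 2 x" by (simp add: g_def lorentz_commute)
    show "dird v (k 2 1) x = dird v (k 1 2) x" by (rule dird_cong[OF open_S x k_commute])
    show "dird (space_dir 2) (dw 1) x = dird (space_dir 1) (dw 2) x"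
      unfolding dw_def by (rule dird_commute[OF open_S smooth_base(6) x])
  qed
  \<comment> \<open>With indices \<open>1 2 2\<close> and \<open>2 1 1\<close> the Codazzi equation
    yields exactly the two differences of derivatives of \<open>k\<close> in the divergence.\<close>
  note id = mass_density_identity[OF D_pos[OF x, unfolded D_def] w_pos[OF x] trace_k[OF x, unfolded D_def]
      k_time[OF x, of 1 1, unfolded B_def comm] k_time[OF x, of 1 2, unfolded B_def comm]
      k_time[OF x, of 2 2, unfolded B_def comm] trace_k_time[OF x, unfolded D_def K_def]
      codazzi[OF x, of 1 2 2, unfolded B_def comm] codazzi[OF x, of 2 1 1, unfolded B_def comm],
      folded D_def K_def N_def]
  have "dird time_dir (\<lambda>x. q x * s x) x + q x * s x =
      (2 * D x - 4 * dird time_dir K x - (D x - 4 * K x) * dird time_dir w x / w x) / (2 * w x * s x)"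
    by (rule dird_qs[OF x D_time[OF x]])
  also have "\<dots> = dird (space_dir 1) (P 1) x + dird (space_dir 2) (P 2) x - (N x / (2 * w x)) / (2 * w x * s x)"
  proof -
    define r where "r = 2 * w x * s x"
    have D1: "dird (space_dir 1) D x =
        2 * (c 1 1 1 x * g 2 2 x + g 1 1 x * c 1 2 2 x - g 1 2 x * (c 1 1 2 x + c 1 2 1 x))"
      and D2: "dird (space_dir 2) D x =
        2 * (c 1 2 1 x * g 2 2 x + g 1 1 x * c 2 2 2 x - g 1 2 x * (c 1 2 2 x + c 2 2 1 x))"
      by (simp_all add: dird_D[OF x] g_space[OF x] comm algebra_simps)
    have half: "a * (2 * b) / (2 * D x) = a * b / D x" for a b by simp
    have "2 * D x - 4 * dird time_dir K x - (D x - 4 * K x) * dird time_dir w x / w x =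
        (dird (space_dir 1) (A 1) x - A 1 x * dird (space_dir 1) w x / w x
          - A 1 x * dird (space_dir 1) D x / (2 * D x))
        + (dird (space_dir 2) (A 2) x - A 2 x * dird (space_dir 2) w x / w x
          - A 2 x * dird (space_dir 2) D x / (2 * D x)) - N x / (2 * w x)"
    proof -
      have "dird time_dir K x = dird time_dir (k 1 1) x * k 2 2 x + k 1 1 x * dird time_dir (k 2 2) x
          - 2 * k 1 2 x * dird time_dir (k 1 2) x" by (rule dird_K[OF x])
      moreover have "A 1 x = 2 * (k 2 2 x * dw 1 x - k 1 2 x * dw 2 x) - (g 2 2 x * dw 1 x - g 1 2 x * dw 2 x)"
        "A 2 x = 2 * (k 1 1 x * dw 2 x - k 1 2 x * dw 1 x) - (g 1 1 x * dw 2 x - g 1 2 x * dw 1 x)"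
        by (simp_all add: A_def)
      ultimately show ?thesis
        unfolding dird_A[OF x] D1 D2 half dw_def[symmetric] g_space[OF x] comm
        using id
        unfolding add.commute[of "c 1 2 1 x" "c 1 1 2 x"] add.commute[of "c 2 2 1 x" "c 1 2 2 x"]
        by (simp add: add_divide_distrib)
    qed
    then show ?thesis
      unfolding dird_P[OF x] r_def[symmetric] by (simp only: add_divide_distrib diff_divide_distrib)
  qed
  also have "(N x / (2 * w x)) / (2 * w x * s x) = R x * s x"
    using s_pos[OF x] w_pos[OF x] unfolding R_def s_sq[OF x, symmetric]
    by (simp add: field_simps power2_eq_square)
  finally show ?thesis by simp
qed

end

subsection \<open>Inverse mean curvature flow\<close>

lemma slice_has_derivative:
  assumes "smooth_on (U \<times> I) a" "u \<in> U" "t \<in> I"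
  shows "((\<lambda>u. a (u, t)) has_derivative (\<lambda>v. dird (v, 0) a (u, t))) (at u)"
proof -
  have "((\<lambda>u. (u, t)) has_derivative (\<lambda>v. (v, 0))) (at u)"
    by (auto intro!: derivative_eq_intros)
  from diff_chain_at[OF this smooth_on_has_derivative[OF assms(1)]] assms(2,3) show ?thesis
    by (simp add: o_def)
qed

lemmas dird_slice = dird_eq[OF slice_has_derivative]

lemma slice_C1:
  assumes "smooth_on (U \<times> I) a" "t \<in> I"
  shows "Ck_on 1 U (\<lambda>u. a (u, t))"
proof -
  have "continuous_on U (\<lambda>u. dird (v, 0) a (u, t))" for v
    using assms(2) by (intro continuous_on_compose2[OF smooth_on_imp_continuous[OF smooth_on_dird[OF assms(1)]]]
        continuous_intros) auto
  then have "continuous_on U (dird v (\<lambda>u. a (u, t)))" for v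
    using dird_slice[OF assms(1) _ assms(2)] by (simp cong: continuous_on_cong)
  then show ?thesis
    using slice_has_derivative[OF assms(1) _ assms(2)] by (auto simp: Ck_on_Suc differentiable_def)
qed

text \<open>For a Jacobian \<open>J\<close> and a symmetric form \<open>h\<close> one has
  \<open>adj (J^T h J) = adj J adj h (adj J)^T\<close>. Paired with covectors \<open>J^T x\<close>
  and \<open>J^T z\<close>, the products \<open>J adj J = det J\<close> leave the factor
  \<open>(det J)^2\<close>.\<close>

lemma cofactor_pairing_transform:
  fixes a b c d k l m x y z w :: real
  defines "h \<equiv> \<lambda>p q r s. p * r * k + (p * s + q * r) * l + q * s * m"
  shows "h c d c d * (a * x + b * y) * (a * z + b * w)
      - h a b c d * ((a * x + b * y) * (c * z + d * w) + (c * x + d * y) * (a * z + b * w))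
      + h a b a b * (c * x + d * y) * (c * z + d * w)
    = (a * d - c * b)\<^sup>2 * (m * x * z - l * (x * w + y * z) + k * y * w)"
  unfolding h_def power2_eq_square by algebra

lemma det_transform:
  fixes a b c d k l m :: real
  defines "h \<equiv> \<lambda>p q r s. p * r * k + (p * s + q * r) * l + q * s * m"
  shows "h a b a b * h c d c d - (h a b c d)\<^sup>2 = (a * d - c * b)\<^sup>2 * (k * m - l\<^sup>2)"
  unfolding h_def power2_eq_square by algebra

lemma gram_determinant_pos:
  assumes pos: "\<And>r s. (r, s) \<noteq> (0, 0) \<Longrightarrow> lorentz (r *\<^sub>R a + s *\<^sub>R b) (r *\<^sub>R a + s *\<^sub>R b) > 0"
  shows "lorentz a a * lorentz b b - (lorentz a b)\<^sup>2 > 0"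
proof -
  have aa: "lorentz a a > 0" using pos[of 1 0] by simp
  \<comment> \<open>The vector is the part of \<open>b\<close> orthogonal to \<open>a\<close>,
    multiplied by \<open>lorentz a a\<close>; its square is \<open>lorentz a a\<close> times the
    Gram determinant.\<close>
  then have "lorentz (- lorentz a b *\<^sub>R a + lorentz a a *\<^sub>R b) (- lorentz a b *\<^sub>R a + lorentz a a *\<^sub>R b) > 0"
    by (intro pos) simp
  also have "lorentz (- lorentz a b *\<^sub>R a + lorentz a a *\<^sub>R b) (- lorentz a b *\<^sub>R a + lorentz a a *\<^sub>R b) =
      lorentz a a * (lorentz a a * lorentz b b - (lorentz a b)\<^sup>2)"
    by (simp add: lorentz_simps lorentz_commute[of b a] power2_eq_square algebra_simps)
  finally show ?thesis using aa by (simp add: zero_less_mult_iff)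
qed

locale imcf =
  fixes M :: "'m::t2_space set" and cs :: "'m chart list" and I :: "real set"
    and F \<nu> :: "real \<Rightarrow> 'm \<Rightarrow> minkowski"
  assumes flow: "inverse_mean_curvature_flow M cs I F \<nu>"
begin

sublocale atlas M cs
  using flow by unfold_locales (simp add: inverse_mean_curvature_flow_def)

definition Y :: "(real^2 \<Rightarrow> 'm) \<Rightarrow> (real^2) \<times> real \<Rightarrow> minkowski"
  where "Y \<phi> = (\<lambda>(u, t). F t (\<phi> u))"

definition H :: "real \<Rightarrow> (real^2 \<Rightarrow> 'm) \<Rightarrow> real^2 \<Rightarrow> real"
  where "H t \<phi> = mean_curv (F t \<circ> \<phi>) (\<nu> t \<circ> \<phi>)"

lemma open_I: "open I"
  using flow by (simp add: inverse_mean_curvature_flow_def)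

lemma smooth_Y: "charts U \<phi> \<Longrightarrow> smooth_on (U \<times> I) (Y \<phi>)"
  using flow unfolding inverse_mean_curvature_flow_def charts_def Y_def by fast

lemma embedded: "t \<in> I \<Longrightarrow> embedded_in_hyp3 M cs (F t)"
  and outward_normal: "t \<in> I \<Longrightarrow> outward_unit_normal M cs (F t) (\<nu> t)"
  using flow by (auto simp: inverse_mean_curvature_flow_def)

lemma smooth_map_F: "t \<in> I \<Longrightarrow> smooth_map (F t)"
  using embedded unfolding embedded_in_hyp3_def smooth_map_def charts_def by fast

lemma F_hyp3: "t \<in> I \<Longrightarrow> p \<in> M \<Longrightarrow> lorentz (F t p) (F t p) = -1"
  using embedded unfolding embedded_in_hyp3_def hyp3_def by blast

lemma F_inj_derivative:
  "t \<in> I \<Longrightarrow> charts U \<phi> \<Longrightarrow> u \<in> U \<Longrightarrow> inj (\<lambda>v. dird v (F t \<circ> \<phi>) u)"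
  using embedded unfolding embedded_in_hyp3_def charts_def dird_def by fast

lemma normal_unit: "t \<in> I \<Longrightarrow> p \<in> M \<Longrightarrow> lorentz (\<nu> t p) (\<nu> t p) = 1"
  and normal_position: "t \<in> I \<Longrightarrow> p \<in> M \<Longrightarrow> lorentz (\<nu> t p) (F t p) = 0"
  using outward_normal unfolding outward_unit_normal_def by blast+

lemma normal_tangent:
  "t \<in> I \<Longrightarrow> charts U \<phi> \<Longrightarrow> u \<in> U \<Longrightarrow> lorentz (\<nu> t (\<phi> u)) (dird (e2 i) (F t \<circ> \<phi>) u) = 0"
  using outward_normal unfolding outward_unit_normal_def charts_def pderiv2_eq_dird[symmetric] by fast

lemma H_pos: "t \<in> I \<Longrightarrow> charts U \<phi> \<Longrightarrow> u \<in> U \<Longrightarrow> H t \<phi> u > 0"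
  and F_velocity: "t \<in> I \<Longrightarrow> charts U \<phi> \<Longrightarrow> u \<in> U \<Longrightarrow>
    ((\<lambda>s. F s (\<phi> u)) has_vector_derivative (1 / H t \<phi> u) *\<^sub>R \<nu> t (\<phi> u)) (at t)"
  using flow unfolding inverse_mean_curvature_flow_def charts_def H_def Let_def by fast+

lemma Y_slice: "(\<lambda>u. Y \<phi> (u, t)) = F t \<circ> \<phi>"
  by (simp add: Y_def fun_eq_iff)

section \<open>The geometry of the flow read in one chart\<close>

context
  fixes U \<phi> u t
  assumes \<phi>: "charts U \<phi>" and u: "u \<in> U" and t: "t \<in> I"
begin

lemma dird_Y_space: "dird (v, 0) (Y \<phi>) (u, t) = dird v (F t \<circ> \<phi>) u"
  using dird_slice[OF smooth_Y[OF \<phi>] u t] by (simp add: Y_slice)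

lemma dird_Y_time: "dird time_dir (Y \<phi>) (u, t) = (1 / H t \<phi> u) *\<^sub>R \<nu> t (\<phi> u)"
proof -
  have "((\<lambda>r. Y \<phi> ((u, 0) + r *\<^sub>R time_dir)) has_vector_derivative
      dird time_dir (Y \<phi>) ((u, 0) + t *\<^sub>R time_dir)) (at t)"
    using u t by (intro smooth_on_line_derivative[OF smooth_Y[OF \<phi>]]) simp
  then have "((\<lambda>r. F r (\<phi> u)) has_vector_derivative dird time_dir (Y \<phi>) (u, t)) (at t)"
    by (simp add: Y_def)
  then show ?thesis using F_velocity[OF t \<phi> u] vector_derivative_unique_at by blast
qed

lemma dird_F_position: "lorentz (dird v (F t \<circ> \<phi>) u) (F t (\<phi> u)) = 0"
proof -
  have sm: "smooth_on U (F t \<circ> \<phi>)" using smooth_map_F[OF t] \<phi> by (simp add: smooth_map_def)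
  have "dird v (\<lambda>u. lorentz ((F t \<circ> \<phi>) u) ((F t \<circ> \<phi>) u)) u = 0"
    by (rule dird_constant_on[OF chart_open[OF \<phi>] u, where c = "-1"])
      (simp add: F_hyp3[OF t chart_in[OF \<phi>]])
  then show ?thesis using dird_lorentz[OF sm sm u] by (simp add: lorentz_commute)
qed

lemma immersed_determinant: 
  "lorentz (dird (e2 1) (F t \<circ> \<phi>) u) (dird (e2 1) (F t \<circ> \<phi>) u) *
    lorentz (dird (e2 2) (F t \<circ> \<phi>) u) (dird (e2 2) (F t \<circ> \<phi>) u) -
    (lorentz (dird (e2 1) (F t \<circ> \<phi>) u) (dird (e2 2) (F t \<circ> \<phi>) u))\<^sup>2 > 0"
proof (rule gram_determinant_pos)
  fix r s :: real
  assume rs: "(r, s) \<noteq> (0, 0)"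
  have "((F t \<circ> \<phi>) has_derivative (\<lambda>v. dird v (F t \<circ> \<phi>) u)) (at u)"
    using smooth_map_F[OF t] \<phi> u smooth_on_has_derivative[of U "F t \<circ> \<phi>" u]
    unfolding smooth_map_def by blast
  then have lin: "linear (\<lambda>v. dird v (F t \<circ> \<phi>) u)" by (rule has_derivative_linear)
  define v where "v = r *\<^sub>R e2 1 + s *\<^sub>R e2 2"
  have eq: "r *\<^sub>R dird (e2 1) (F t \<circ> \<phi>) u + s *\<^sub>R dird (e2 2) (F t \<circ> \<phi>) u = dird v (F t \<circ> \<phi>) u"
    unfolding v_def by (simp only: linear_add[OF lin] linear_cmul[OF lin])
  have "v \<noteq> 0" using rs by (auto simp: v_def vec_eq_iff forall_2 axis_def)
  then have "dird v (F t \<circ> \<phi>) u \<noteq> 0"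
    using F_inj_derivative[OF t \<phi> u] linear_injective_0[OF lin] by blast
  then show "lorentz (r *\<^sub>R dird (e2 1) (F t \<circ> \<phi>) u + s *\<^sub>R dird (e2 2) (F t \<circ> \<phi>) u)
      (r *\<^sub>R dird (e2 1) (F t \<circ> \<phi>) u + s *\<^sub>R dird (e2 2) (F t \<circ> \<phi>) u) > 0"
    unfolding eq using lorentz_spacelike[OF F_hyp3[OF t chart_in[OF \<phi> u]] dird_F_position] by blast
qed

end

lemma local_flow: "charts U \<phi> \<Longrightarrow> local_flow (U \<times> I) (Y \<phi>)"
proof
  assume \<phi>: "charts U \<phi>"
  show "open (U \<times> I)" using chart_open[OF \<phi>] open_I by (rule open_Times)
  show "smooth_on (U \<times> I) (Y \<phi>)" by (rule smooth_Y[OF \<phi>])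
  fix x assume "x \<in> U \<times> I"
  then obtain u t where x: "x = (u, t)" "u \<in> U" "t \<in> I" by blast
  note d = dird_Y_space[OF \<phi> x(2,3)] dird_Y_time[OF \<phi> x(2,3)]
  show "lorentz (Y \<phi> x) (Y \<phi> x) = -1" using F_hyp3[OF x(3) chart_in[OF \<phi> x(2)]] by (simp add: x Y_def)
  show "lorentz (dird time_dir (Y \<phi>) x) (dird (space_dir i) (Y \<phi>) x) = 0" for i
    using normal_tangent[OF x(3) \<phi> x(2)] by (simp add: x(1) d lorentz_simps)
  show "lorentz (dird time_dir (Y \<phi>) x) (dird time_dir (Y \<phi>) x) > 0"
    using normal_unit[OF x(3) chart_in[OF \<phi> x(2)]] H_pos[OF x(3) \<phi> x(2)] by (simp add: x(1) d lorentz_simps)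
  show "lorentz (dird (space_dir 1) (Y \<phi>) x) (dird (space_dir 1) (Y \<phi>) x) *
        lorentz (dird (space_dir 2) (Y \<phi>) x) (dird (space_dir 2) (Y \<phi>) x) -
        (lorentz (dird (space_dir 1) (Y \<phi>) x) (dird (space_dir 2) (Y \<phi>) x))\<^sup>2 > 0"
    using immersed_determinant[OF \<phi> x(2,3)] by (simp add: x(1) d)
qed

context
  fixes U \<phi> u t
  assumes \<phi>: "charts U \<phi>" and u: "u \<in> U" and t: "t \<in> I"
begin

interpretation L: local_flow "U \<times> I" "Y \<phi>" by (rule local_flow[OF \<phi>])

lemma ut: "(u, t) \<in> U \<times> I" using u t by simp

lemma T_eq: "L.T (u, t) = (1 / H t \<phi> u) *\<^sub>R \<nu> t (\<phi> u)"
  by (simp add: L.T_def dird_Y_time[OF \<phi> u t])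

lemma X_eq: "L.X i (u, t) = dird (e2 i) (F t \<circ> \<phi>) u"
  by (simp add: L.X_def dird_Y_space[OF \<phi> u t])

lemma XX_eq: "L.XX i j (u, t) = pderiv2 i (pderiv2 j (F t \<circ> \<phi>)) u"
proof -
  have "L.XX i j (u, t) = dird (e2 i) (\<lambda>u. L.X j (u, t)) u"
    by (simp add: L.XX_def dird_slice[OF L.smooth_base(2) u t])
  also have "\<dots> = dird (e2 i) (pderiv2 j (F t \<circ> \<phi>)) u"
    by (rule dird_cong[OF chart_open[OF \<phi>] u])
      (simp add: L.X_def dird_Y_space[OF \<phi> _ t] pderiv2_eq_dird)
  finally show ?thesis by (simp add: pderiv2_eq_dird)
qed

lemma first_ff_eq: "first_ff (F t \<circ> \<phi>) u $ i $ j = L.g i j (u, t)"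
  by (simp add: first_ff_component L.g_def X_eq)

lemma w_eq: "L.w (u, t) = 1 / (H t \<phi> u)\<^sup>2"
  by (simp add: L.w_def T_eq lorentz_simps normal_unit[OF t chart_in[OF \<phi> u]] power2_eq_square)

text \<open>The correction in the tangential projection is a multiple of the position vector, to
  which the normal is orthogonal.\<close>

lemma second_ff_eq: "second_ff (F t \<circ> \<phi>) (\<nu> t \<circ> \<phi>) u $ i $ j = H t \<phi> u * L.k i j (u, t)"
proof -
  have "lorentz (F t (\<phi> u)) (\<nu> t (\<phi> u)) = 0"
    using normal_position[OF t chart_in[OF \<phi> u]] by (simp only: lorentz_commute)
  then show ?thesis
    using H_pos[OF t \<phi> u] lorentz_commute[of "\<nu> t (\<phi> u)" "L.XX i j (u, t)"]
    by (simp add: second_ff_def L.k_def T_eq XX_eq hyp_tangent_proj_def lorentz_simps)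
qed

lemma g_commute: "L.g 2 1 (u, t) = L.g 1 2 (u, t)"
  unfolding L.g_def by (rule lorentz_commute)

lemma det_first_ff: "det (first_ff (F t \<circ> \<phi>) u) = L.D (u, t)"
  by (simp add: det_2 first_ff_eq L.D_def g_commute power2_eq_square)

lemma area_density_eq: "area_density (F t) \<phi> u = L.s (u, t)"
  by (simp add: area_density_def det_first_ff L.s_def)

lemma det_pos: "det (first_ff (F t \<circ> \<phi>) u) > 0"
  using L.D_pos[OF ut] by (simp add: det_first_ff)

lemma trace_second_ff:
  "H t \<phi> u = H t \<phi> u * (L.g 2 2 (u, t) * L.k 1 1 (u, t) - 2 * L.g 1 2 (u, t) * L.k 1 2 (u, t)
    + L.g 1 1 (u, t) * L.k 2 2 (u, t)) / L.D (u, t)"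
proof -
  have "H t \<phi> u = trace (matrix_inv (first_ff (F t \<circ> \<phi>) u) ** second_ff (F t \<circ> \<phi>) (\<nu> t \<circ> \<phi>) u)"
    by (simp add: H_def mean_curv_def)
  also have "\<dots> = H t \<phi> u * (L.g 2 2 (u, t) * L.k 1 1 (u, t) - 2 * L.g 1 2 (u, t) * L.k 1 2 (u, t)
      + L.g 1 1 (u, t) * L.k 2 2 (u, t)) / L.D (u, t)"
    using det_pos by (subst trace_inv_mult_2)
      (simp_all add: first_ff_eq second_ff_eq det_first_ff g_commute L.k_commute[OF ut, of 2 1] algebra_simps)
  finally show ?thesis .
qed

text \<open>\<open>H\<close> is the trace of the second fundamental form, which is
  \<open>H k\<close>; cancelling the positive \<open>H\<close> leaves trace 1. Here the speed
  \<open>1 / H\<close> becomes the assumption of \<open>local_imcf\<close>.\<close>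

lemma trace_k: "L.g 2 2 (u, t) * L.k 1 1 (u, t) - 2 * L.g 1 2 (u, t) * L.k 1 2 (u, t)
    + L.g 1 1 (u, t) * L.k 2 2 (u, t) = L.D (u, t)"
  using trace_second_ff H_pos[OF t \<phi> u] L.D_pos[OF ut] by (simp add: divide_simps)

text \<open>The traceless part is \<open>H (k - g / 2)\<close>. Its trace vanishes, so by
  \<open>tensor_norm_sq_2\<close> only its determinant counts, which is
  \<open>H^2 (K - D / 4)\<close> because \<open>k\<close> has trace 1.\<close>

lemma traceless_norm_sq_eq: "traceless_norm_sq (F t \<circ> \<phi>) (\<nu> t \<circ> \<phi>) u = L.q (u, t)"
proof -
  let ?g = "first_ff (F t \<circ> \<phi>) u" and ?A = "traceless_ff (F t \<circ> \<phi>) (\<nu> t \<circ> \<phi>) u"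
  let ?H = "H t \<phi> u"
  have A: "?A $ i $ j = ?H * (L.k i j (u, t) - L.g i j (u, t) / 2)" for i j
    by (simp add: traceless_ff_def second_ff_eq first_ff_eq H_def[symmetric] right_diff_distrib)
  have det_nz: "det ?g \<noteq> 0" using det_pos by simp
  have "traceless_norm_sq (F t \<circ> \<phi>) (\<nu> t \<circ> \<phi>) u = (trace (matrix_inv ?g ** ?A))\<^sup>2 - 2 * det ?A / det ?g"
    unfolding traceless_norm_sq_def
    by (rule tensor_norm_sq_2[OF det_nz])
      (simp_all add: A first_ff_eq g_commute L.k_commute[OF ut, of 2 1])
  also have "trace (matrix_inv ?g ** ?A) = ?H * ((L.g 2 2 (u, t) * L.k 1 1 (u, t)
      - 2 * L.g 1 2 (u, t) * L.k 1 2 (u, t) + L.g 1 1 (u, t) * L.k 2 2 (u, t)) - L.D (u, t)) / L.D (u, t)"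
    using det_nz by (subst trace_inv_mult_2) (simp_all add: A first_ff_eq det_first_ff g_commute
        L.k_commute[OF ut, of 2 1] L.D_def power2_eq_square algebra_simps)
  also have "\<dots> = 0" by (simp add: trace_k)
  also have "det ?A = ?H\<^sup>2 * (L.K (u, t) - (L.g 2 2 (u, t) * L.k 1 1 (u, t)
      - 2 * L.g 1 2 (u, t) * L.k 1 2 (u, t) + L.g 1 1 (u, t) * L.k 2 2 (u, t)) / 2 + L.D (u, t) / 4)"
    by (simp add: det_2 A g_commute L.k_commute[OF ut, of 2 1] L.K_def L.D_def power2_eq_square
        algebra_simps add_divide_distrib diff_divide_distrib)
  also have "\<dots> = ?H\<^sup>2 * (L.K (u, t) - L.D (u, t) / 4)" by (simp add: trace_k)
  finally have eq: "traceless_norm_sq (F t \<circ> \<phi>) (\<nu> t \<circ> \<phi>) u =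
      0\<^sup>2 - 2 * (?H\<^sup>2 * (L.K (u, t) - L.D (u, t) / 4)) / L.D (u, t)"
    unfolding det_first_ff .
  show ?thesis
    using L.D_pos[OF ut] H_pos[OF t \<phi> u] unfolding eq L.q_def w_eq by (simp add: field_simps)
qed

end

text \<open>\<open>H\<close> is the inverse square root of \<open>w\<close>, so its differential is
  \<open>- H^3 dw / 2\<close>; this explains the factor \<open>1 / (4 w^2)\<close> in
  \<open>R\<close>.\<close>

lemma grad_H_eq:
  assumes \<phi>: "charts U \<phi>" and u: "u \<in> U" and t: "t \<in> I"
  shows "grad_norm_sq (F t \<circ> \<phi>) (H t \<phi>) u / (H t \<phi> u)\<^sup>2 = local_flow.R (Y \<phi>) (u, t)"
proof -
  interpret L: local_flow "U \<times> I" "Y \<phi>" by (rule local_flow[OF \<phi>])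
  let ?H = "H t \<phi> u"
  have ut: "(u, t) \<in> U \<times> I" using u t by simp
  have w_pos: "L.w (u, t) > 0" by (rule L.w_pos[OF ut])
  have H_sqrt: "H t \<phi> v = inverse (sqrt (L.w (v, t)))" if "v \<in> U" for v
    using H_pos[OF t \<phi> that] by (simp add: w_eq[OF \<phi> that t] real_sqrt_divide)
  have dw: "((\<lambda>u. L.w (u, t)) has_derivative (\<lambda>v. dird (v, 0) L.w (u, t))) (at u)"
    by (rule slice_has_derivative[OF L.smooth_base(6) u t])
  have dH: "pderiv2 i (H t \<phi>) u = - L.dw i (u, t) * ?H ^ 3 / 2" for i
  proof -
    have "((\<lambda>u. inverse (sqrt (L.w (u, t)))) has_derivative
        (\<lambda>v. - (dird (v, 0) L.w (u, t) * inverse (sqrt (L.w (u, t))) ^ 3 / 2))) (at u)"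
      using w_pos by (auto intro!: derivative_eq_intros dw simp: power3_eq_cube field_simps)
    from dird_eq[OF this, of "e2 i"]
    have "dird (e2 i) (\<lambda>u. inverse (sqrt (L.w (u, t)))) u = - L.dw i (u, t) * ?H ^ 3 / 2"
      by (simp add: L.dw_def H_sqrt[OF u])
    moreover have "dird (e2 i) (H t \<phi>) u = dird (e2 i) (\<lambda>u. inverse (sqrt (L.w (u, t)))) u"
      by (rule dird_cong[OF chart_open[OF \<phi>] u H_sqrt])
    ultimately show ?thesis by (simp add: pderiv2_eq_dird)
  qed
  note det = det_first_ff[OF \<phi> u t]
  have det_nz: "det (first_ff (F t \<circ> \<phi>) u) \<noteq> 0" using det_pos[OF \<phi> u t] by simp
  have "grad_norm_sq (F t \<circ> \<phi>) (H t \<phi>) u = (?H ^ 3 / 2)\<^sup>2 * (L.N (u, t) / L.D (u, t))"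
    unfolding grad_norm_sq_def sum_2 matrix_inv_2[OF det_nz] dH first_ff_eq[OF \<phi> u t] det
      g_commute[OF \<phi> u t] L.N_def
    using L.D_pos[OF ut] by (simp add: power2_eq_square field_simps)
  also have "(?H ^ 3 / 2)\<^sup>2 * (L.N (u, t) / L.D (u, t)) / ?H\<^sup>2 = L.R (u, t)"
    using H_pos[OF t \<phi> u] L.D_pos[OF ut]
    by (simp add: L.R_def w_eq[OF \<phi> u t] field_simps power_numeral_reduce)
  finally show ?thesis .
qed

lemma local_imcf: "charts U \<phi> \<Longrightarrow> local_imcf (U \<times> I) (Y \<phi>)"
  using local_flow trace_k by (auto simp: local_imcf_def local_imcf_axioms_def)

text \<open>In this form the velocity depends on the point of \<open>M\<close> alone, so
  \<open>T\<close> transforms like a function on the surface.\<close>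

lemma velocity_slice:
  assumes "charts U \<phi>" "u \<in> U" "t \<in> I"
  shows "dird time_dir (Y \<phi>) (u, t) = vector_derivative (\<lambda>s. F s (\<phi> u)) (at t)"
  using vector_derivative_at[OF F_velocity[OF assms(3,1,2)]] dird_Y_time[OF assms] by simp

section \<open>Transformation laws under a change of chart\<close>

context
  fixes U \<phi> u V \<psi> v t
  assumes \<phi>: "charts U \<phi>" and \<psi>: "charts V \<psi>" and u: "u \<in> U" and v: "v \<in> V"
    and uv: "\<phi> u = \<psi> v" and t: "t \<in> I"
begin

interpretation L: local_imcf "U \<times> I" "Y \<phi>" by (rule local_imcf[OF \<phi>])
interpretation L': local_imcf "V \<times> I" "Y \<psi>" by (rule local_imcf[OF \<psi>])

definition J where "J i j = chart_jacobian V \<psi> \<phi> u $ i $ j"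

definition velocity where "velocity p = vector_derivative (\<lambda>s. F s p) (at t)"

lemma transform:
  fixes a :: "'m \<Rightarrow> 'b::real_normed_vector"
  assumes "smooth_on (U \<times> I) A" "smooth_on (V \<times> I) A'"
    and "\<And>x. x \<in> U \<Longrightarrow> A (x, t) = a (\<phi> x)" "\<And>x. x \<in> V \<Longrightarrow> A' (x, t) = a (\<psi> x)"
  shows "dird (space_dir i) A (u, t) =
    J 1 i *\<^sub>R dird (space_dir 1) A' (v, t) + J 2 i *\<^sub>R dird (space_dir 2) A' (v, t)"
proof -
  have A: "dird (space_dir i) A (u, t) = dird (e2 i) (a \<circ> \<phi>) u" for i
    unfolding dird_slice[OF assms(1) u t, symmetric]
    by (rule dird_cong[OF chart_open[OF \<phi>] u]) (simp add: assms)
  have A': "dird (space_dir i) A' (v, t) = dird (e2 i) (a \<circ> \<psi>) v" for i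
    unfolding dird_slice[OF assms(2) v t, symmetric]
    by (rule dird_cong[OF chart_open[OF \<psi>] v]) (simp add: assms)
  have "(\<lambda>x. A' (x, t)) differentiable (at v)"
    using slice_has_derivative[OF assms(2) v t] differentiableI by blast
  then have "(a \<circ> \<psi>) differentiable (at v)"
    using differentiable_cong_open[OF chart_open[OF \<psi>] v, of "\<lambda>x. A' (x, t)" "a \<circ> \<psi>"] assms(4) by simp
  from dird_chart_change[OF \<phi> \<psi> u v uv this, of i] show ?thesis
    unfolding A A' J_def .
qed

lemma X_transform: "L.X i (u, t) = J 1 i *\<^sub>R L'.X 1 (v, t) + J 2 i *\<^sub>R L'.X 2 (v, t)"
  unfolding L.X_def L'.X_def
  by (rule transform[OF L.smooth_Y L'.smooth_Y, where a = "F t"]) (simp_all add: Y_def)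

lemma T_transform: "dird (space_dir i) L.T (u, t) =
    J 1 i *\<^sub>R dird (space_dir 1) L'.T (v, t) + J 2 i *\<^sub>R dird (space_dir 2) L'.T (v, t)"
  by (rule transform[OF L.smooth_base(1) L'.smooth_base(1), where a = velocity])
    (simp_all add: L.T_def L'.T_def velocity_slice[OF \<phi> _ t] velocity_slice[OF \<psi> _ t] velocity_def)

lemma w_transform: "L.w (u, t) = L'.w (v, t)"
  by (simp add: L.w_def L'.w_def L.T_def L'.T_def velocity_slice[OF \<phi> u t] velocity_slice[OF \<psi> v t] uv)

lemma dw_transform: "L.dw i (u, t) = J 1 i * L'.dw 1 (v, t) + J 2 i * L'.dw 2 (v, t)"
  unfolding L.dw_def L'.dw_def real_scaleR_def[symmetric]
  by (rule transform[OF L.smooth_base(6) L'.smooth_base(6), where a = "\<lambda>p. lorentz (velocity p) (velocity p)"])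
    (simp_all add: L.w_def L'.w_def L.T_def L'.T_def velocity_slice[OF \<phi> _ t] velocity_slice[OF \<psi> _ t] velocity_def)

lemma g_transform: "L.g i j (u, t) = J 1 i * J 1 j * L'.g 1 1 (v, t)
    + (J 1 i * J 2 j + J 2 i * J 1 j) * L'.g 1 2 (v, t) + J 2 i * J 2 j * L'.g 2 2 (v, t)"
  by (simp add: L.g_def L'.g_def X_transform lorentz_simps
      lorentz_commute[of "L'.X 2 (v, t)" "L'.X 1 (v, t)"] algebra_simps)

text \<open>Written as the product of a space derivative of \<open>T\<close> with
  \<open>X j\<close>, \<open>k\<close> contains only first space derivatives of functions on
  \<open>M\<close>, so second derivatives of the chart change do not occur.\<close>

lemma k_transform: "L.k i j (u, t) = J 1 i * J 1 j * L'.k 1 1 (v, t)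
    + (J 1 i * J 2 j + J 2 i * J 1 j) * L'.k 1 2 (v, t) + J 2 i * J 2 j * L'.k 2 2 (v, t)"
proof -
  have ut: "(u, t) \<in> U \<times> I" and vt: "(v, t) \<in> V \<times> I" using u v t by auto
  show ?thesis
    using L'.k_commute[OF vt, of 2 1]
    by (simp add: L.space_T_components(3)[OF ut, symmetric] L'.space_T_components(3)[OF vt, symmetric]
        X_transform T_transform lorentz_simps algebra_simps)
qed

definition detJ where "detJ = J 1 1 * J 2 2 - J 1 2 * J 2 1"

lemma D_transform: "L.D (u, t) = detJ\<^sup>2 * L'.D (v, t)"
  unfolding L.D_def L'.D_def g_transform detJ_def
  by (rule det_transform)

lemma K_transform: "L.K (u, t) = detJ\<^sup>2 * L'.K (v, t)"
  unfolding L.K_def L'.K_def k_transform detJ_def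
  by (rule det_transform)

lemma detJ_nonzero: "detJ \<noteq> 0"
  using D_transform L.D_pos[of "(u, t)"] u t by auto

lemma q_transform: "L.q (u, t) = L'.q (v, t)"
  using detJ_nonzero by (simp add: L.q_def L'.q_def D_transform K_transform w_transform)

lemma k_cofactor_transform:
  "L.k 2 2 (u, t) * (J 1 1 * x + J 2 1 * y) * (J 1 1 * z + J 2 1 * w)
      - L.k 1 2 (u, t) * ((J 1 1 * x + J 2 1 * y) * (J 1 2 * z + J 2 2 * w)
        + (J 1 2 * x + J 2 2 * y) * (J 1 1 * z + J 2 1 * w))
      + L.k 1 1 (u, t) * (J 1 2 * x + J 2 2 * y) * (J 1 2 * z + J 2 2 * w)
    = detJ\<^sup>2 * (L'.k 2 2 (v, t) * x * z - L'.k 1 2 (v, t) * (x * w + y * z) + L'.k 1 1 (v, t) * y * w)"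
  unfolding k_transform detJ_def by (rule cofactor_pairing_transform)

lemma g_cofactor_transform:
  "L.g 2 2 (u, t) * (J 1 1 * x + J 2 1 * y) * (J 1 1 * z + J 2 1 * w)
      - L.g 1 2 (u, t) * ((J 1 1 * x + J 2 1 * y) * (J 1 2 * z + J 2 2 * w)
        + (J 1 2 * x + J 2 2 * y) * (J 1 1 * z + J 2 1 * w))
      + L.g 1 1 (u, t) * (J 1 2 * x + J 2 2 * y) * (J 1 2 * z + J 2 2 * w)
    = detJ\<^sup>2 * (L'.g 2 2 (v, t) * x * z - L'.g 1 2 (v, t) * (x * w + y * z) + L'.g 1 1 (v, t) * y * w)"
  unfolding g_transform detJ_def by (rule cofactor_pairing_transform)

lemma R_transform: "L.R (u, t) = L'.R (v, t)"
proof -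
  have "L.N (u, t) = detJ\<^sup>2 * L'.N (v, t)"
    using g_cofactor_transform[of "L'.dw 1 (v, t)" "L'.dw 2 (v, t)" "L'.dw 1 (v, t)" "L'.dw 2 (v, t)"]
    by (simp add: L.N_def L'.N_def dw_transform power2_eq_square mult.assoc
        mult.left_commute[of "L.g 1 2 (u, t)" 2] mult.left_commute[of "L'.g 1 2 (v, t)" 2])
  then show ?thesis
    using detJ_nonzero by (simp add: L.R_def L'.R_def D_transform w_transform)
qed

text \<open>\<open>P / s\<close> is \<open>A / (2 w D)\<close> with \<open>A\<close> built from
  cofactors of \<open>k\<close> and \<open>g\<close>; the factor \<open>detJ^2\<close> from the
  cofactor pairings cancels against that of \<open>D\<close>.\<close>

lemma flux_transform:
  assumes \<eta>: "Ck_on 1 V (\<eta> \<circ> \<psi>)"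
  shows "(L.P 1 (u, t) * dird (e2 1) (\<eta> \<circ> \<phi>) u + L.P 2 (u, t) * dird (e2 2) (\<eta> \<circ> \<phi>) u) / L.s (u, t) =
    (L'.P 1 (v, t) * dird (e2 1) (\<eta> \<circ> \<psi>) v + L'.P 2 (v, t) * dird (e2 2) (\<eta> \<circ> \<psi>) v) / L'.s (v, t)"
proof -
  have ut: "(u, t) \<in> U \<times> I" and vt: "(v, t) \<in> V \<times> I" using u v t by auto
  define a1 a2 where "a1 = dird (e2 1) (\<eta> \<circ> \<psi>) v" and "a2 = dird (e2 2) (\<eta> \<circ> \<psi>) v"
  define b1 b2 where "b1 = L'.dw 1 (v, t)" and "b2 = L'.dw 2 (v, t)"
  have "(\<eta> \<circ> \<psi>) differentiable (at v)" using \<eta> v by (simp add: Ck_on_Suc)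
  from dird_chart_change[OF \<phi> \<psi> u v uv this]
  have d\<eta>: "dird (e2 i) (\<eta> \<circ> \<phi>) u = J 1 i * a1 + J 2 i * a2" for i
    by (simp add: J_def a1_def a2_def)
  have flux: "(L.P 1 x * y1 + L.P 2 x * y2) / L.s x = (L.A 1 x * y1 + L.A 2 x * y2) / (2 * L.w x * L.D x)"
    if "x \<in> U \<times> I" for x y1 y2
    using L.s_pos[OF that] L.w_pos[OF that] unfolding L.P_def L.s_sq[OF that, symmetric]
    by (simp add: field_simps)
  have flux': "(L'.P 1 x * y1 + L'.P 2 x * y2) / L'.s x = (L'.A 1 x * y1 + L'.A 2 x * y2) / (2 * L'.w x * L'.D x)"
    if "x \<in> V \<times> I" for x y1 y2
    using L'.s_pos[OF that] L'.w_pos[OF that] unfolding L'.P_def L'.s_sq[OF that, symmetric]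
    by (simp add: field_simps)
  have "L.A 1 (u, t) * (J 1 1 * a1 + J 2 1 * a2) + L.A 2 (u, t) * (J 1 2 * a1 + J 2 2 * a2) =
      2 * (L.k 2 2 (u, t) * (J 1 1 * b1 + J 2 1 * b2) * (J 1 1 * a1 + J 2 1 * a2)
      - L.k 1 2 (u, t) * ((J 1 1 * b1 + J 2 1 * b2) * (J 1 2 * a1 + J 2 2 * a2)
        + (J 1 2 * b1 + J 2 2 * b2) * (J 1 1 * a1 + J 2 1 * a2))
      + L.k 1 1 (u, t) * (J 1 2 * b1 + J 2 2 * b2) * (J 1 2 * a1 + J 2 2 * a2))
      - (L.g 2 2 (u, t) * (J 1 1 * b1 + J 2 1 * b2) * (J 1 1 * a1 + J 2 1 * a2)
      - L.g 1 2 (u, t) * ((J 1 1 * b1 + J 2 1 * b2) * (J 1 2 * a1 + J 2 2 * a2)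
        + (J 1 2 * b1 + J 2 2 * b2) * (J 1 1 * a1 + J 2 1 * a2))
      + L.g 1 1 (u, t) * (J 1 2 * b1 + J 2 2 * b2) * (J 1 2 * a1 + J 2 2 * a2))"
    unfolding L.A_def dw_transform b1_def[symmetric] b2_def[symmetric] by simp algebra
  also have "\<dots> = detJ\<^sup>2 * (L'.A 1 (v, t) * a1 + L'.A 2 (v, t) * a2)"
    unfolding k_cofactor_transform g_cofactor_transform L'.A_def b1_def[symmetric] b2_def[symmetric]
    by simp algebra
  finally show ?thesis
    unfolding flux[OF ut] flux'[OF vt] d\<eta> a1_def[symmetric] a2_def[symmetric]
    using detJ_nonzero by (simp add: D_transform w_transform)
qed

end

lemma invariants:
  assumes "t \<in> I"
  shows "chart_invariant (\<lambda>\<phi> u. local_flow.q (Y \<phi>) (u, t))"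
    and "chart_invariant (\<lambda>\<phi> u. local_flow.R (Y \<phi>) (u, t))"
  unfolding chart_invariant_def using q_transform R_transform assms by blast+

lemma flux_invariant:
  assumes t: "t \<in> I" and \<eta>: "\<And>U \<phi>. charts U \<phi> \<Longrightarrow> Ck_on 1 U (\<eta> \<circ> \<phi>)"
  shows "chart_invariant (\<lambda>\<phi> u. (local_flow.P (Y \<phi>) 1 (u, t) * dird (e2 1) (\<eta> \<circ> \<phi>) u +
    local_flow.P (Y \<phi>) 2 (u, t) * dird (e2 2) (\<eta> \<circ> \<phi>) u) / area_density (F t) \<phi> u)"
  unfolding chart_invariant_def
proof (intro allI impI, elim conjE)
  fix U \<phi> V \<psi> u v
  assume c: "charts U \<phi>" "charts V \<psi>" "u \<in> U" "v \<in> V" "\<phi> u = \<psi> v"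
  show "(local_flow.P (Y \<phi>) 1 (u, t) * dird (e2 1) (\<eta> \<circ> \<phi>) u +
      local_flow.P (Y \<phi>) 2 (u, t) * dird (e2 2) (\<eta> \<circ> \<phi>) u) / area_density (F t) \<phi> u =
    (local_flow.P (Y \<psi>) 1 (v, t) * dird (e2 1) (\<eta> \<circ> \<psi>) v +
      local_flow.P (Y \<psi>) 2 (v, t) * dird (e2 2) (\<eta> \<circ> \<psi>) v) / area_density (F t) \<psi> v"
    unfolding area_density_eq[OF c(1,3) t] area_density_eq[OF c(2,4) t]
    by (rule flux_transform[OF c t \<eta>[OF c(2)]])
qed

section \<open>Time derivatives of the area, the traceless integral and the mass\<close>

lemma surface_area_derivative:
  assumes t: "t \<in> I"
  shows "((\<lambda>s. surface_area cs (F s)) has_real_derivative surface_area cs (F t)) (at t)"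
proof -
  obtain Js \<eta> where pou: "partition_of_unity Js \<eta>" using partition_of_unity_exists by blast
  note Js = partition_of_unityD[OF pou]
  have inv: "chart_invariant (\<lambda>\<phi> u. 1)" by (simp add: chart_invariant_def)
  have "((\<lambda>s. surface_integral cs (F s) (\<lambda>\<phi> u. 1)) has_real_derivative
    (\<Sum>(U, \<phi>, a, b)\<in>Js. integral (cbox a b)
      (\<lambda>u. \<eta> (U, \<phi>, a, b) (\<phi> u) * dird time_dir (local_flow.s (Y \<phi>)) (u, t)))) (at t)"
    by (rule surface_integral_has_real_derivative[OF pou open_I t smooth_map_F inv])
      (auto simp: area_density_eq intro: local_flow.smooth_s[OF local_flow])
  also have "(\<Sum>(U, \<phi>, a, b)\<in>Js. integral (cbox a b)
      (\<lambda>u. \<eta> (U, \<phi>, a, b) (\<phi> u) * dird time_dir (local_flow.s (Y \<phi>)) (u, t))) =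
    (\<Sum>(U, \<phi>, a, b)\<in>Js. integral (cbox a b)
      (\<lambda>u. \<eta> (U, \<phi>, a, b) (\<phi> u) * (1 * area_density (F t) \<phi> u)))"
  proof (intro sum.cong refl, clarify, intro Henstock_Kurzweil_Integration.integral_cong)
    fix U \<phi> a b u assume j: "(U, \<phi>, a, b) \<in> Js" and "u \<in> cbox a b"
    then have u: "u \<in> U" using Js(3) by blast
    have "dird time_dir (local_flow.s (Y \<phi>)) (u, t) = area_density (F t) \<phi> u"
      using local_imcf.s_time[OF local_imcf[OF Js(2)[OF j]]] area_density_eq[OF Js(2)[OF j] u t] u t by simp
    then show "\<eta> (U, \<phi>, a, b) (\<phi> u) * dird time_dir (local_flow.s (Y \<phi>)) (u, t) =
      \<eta> (U, \<phi>, a, b) (\<phi> u) * (1 * area_density (F t) \<phi> u)" by simp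
  qed
  also have "\<dots> = surface_integral cs (F t) (\<lambda>\<phi> u. 1)"
    by (rule surface_integral_partition[OF pou smooth_map_F[OF t] inv, symmetric]) simp
  finally show ?thesis by (simp add: surface_area_def)
qed

lemma traceless_integral_derivative:
  assumes t: "t \<in> I"
  shows "((\<lambda>s. surface_integral cs (F s) (\<lambda>\<phi>. traceless_norm_sq (F s \<circ> \<phi>) (\<nu> s \<circ> \<phi>)))
    has_real_derivative
      - surface_integral cs (F t) (\<lambda>\<phi> u. grad_norm_sq (F t \<circ> \<phi>) (H t \<phi>) u / (H t \<phi> u)\<^sup>2)
      - surface_integral cs (F t) (\<lambda>\<phi>. traceless_norm_sq (F t \<circ> \<phi>) (\<nu> t \<circ> \<phi>))) (at t)"
proof -
  obtain Js \<eta> where pou: "partition_of_unity Js \<eta>" using partition_of_unity_exists by blast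
  note Js = partition_of_unityD[OF pou]
  let ?q = "\<lambda>s \<phi> u. local_flow.q (Y \<phi>) (u, s)" and ?R = "\<lambda>\<phi> u. local_flow.R (Y \<phi>) (u, t)"
  let ?P = "\<lambda>\<phi> i u. local_flow.P (Y \<phi>) i (u, t)"
  have C1: "Ck_on 1 U (?q s \<phi>)" "Ck_on 1 U (?P \<phi> i)" "Ck_on 1 U (?R \<phi>)"
    if "s \<in> I" "charts U \<phi>" for s U \<phi> i
    using slice_C1 local_flow.smooth_q[OF local_flow[OF that(2)]] local_flow.smooth_P[OF local_flow[OF that(2)]]
      local_flow.smooth_R[OF local_flow[OF that(2)]] that(1) t by blast+
  have q_eq: "surface_integral cs (F s) (\<lambda>\<phi>. traceless_norm_sq (F s \<circ> \<phi>) (\<nu> s \<circ> \<phi>)) =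
      surface_integral cs (F s) (?q s)" if "s \<in> I" for s
    by (rule surface_integral_cong) (rule traceless_norm_sq_eq[OF _ _ that])
  have R_eq: "surface_integral cs (F t) (\<lambda>\<phi> u. grad_norm_sq (F t \<circ> \<phi>) (H t \<phi>) u / (H t \<phi> u)\<^sup>2) =
      surface_integral cs (F t) ?R"
    by (rule surface_integral_cong) (rule grad_H_eq[OF _ _ t])
  let ?d = "\<Sum>(U, \<phi>, a, b)\<in>Js. integral (cbox a b) (\<lambda>u. \<eta> (U, \<phi>, a, b) (\<phi> u) *
      dird time_dir (\<lambda>x. local_flow.q (Y \<phi>) x * local_flow.s (Y \<phi>) x) (u, t))"
  have "((\<lambda>s. surface_integral cs (F s) (?q s)) has_real_derivative ?d) (at t)"
  proof (rule surface_integral_has_real_derivative[OF pou open_I t smooth_map_F invariants(1)])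
    show "smooth_on (U \<times> I) (\<lambda>x. local_flow.q (Y \<phi>) x * local_flow.s (Y \<phi>) x)" if "charts U \<phi>" for U \<phi>
      by (intro smooth_intros open_Times chart_open[OF that] open_I
          local_flow.smooth_q[OF local_flow[OF that]] local_flow.smooth_s[OF local_flow[OF that]])
  qed (use Ck_on_imp_continuous[OF C1(1)] in \<open>auto simp: area_density_eq\<close>)
  also have "?d = (\<Sum>(U, \<phi>, a, b)\<in>Js.
      integral (cbox a b) (\<lambda>u. \<eta> (U, \<phi>, a, b) (\<phi> u) * (dird (e2 1) (?P \<phi> 1) u + dird (e2 2) (?P \<phi> 2) u))
      - integral (cbox a b) (\<lambda>u. \<eta> (U, \<phi>, a, b) (\<phi> u) * (?R \<phi> u * area_density (F t) \<phi> u))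
      - integral (cbox a b) (\<lambda>u. \<eta> (U, \<phi>, a, b) (\<phi> u) * (?q t \<phi> u * area_density (F t) \<phi> u)))"
  proof (intro sum.cong refl, clarify)
    fix U \<phi> a b assume j: "(U, \<phi>, a, b) \<in> Js"
    note \<phi> = Js(2)[OF j] and ab = Js(3)[OF j]
    let ?\<eta> = "\<lambda>u. \<eta> (U, \<phi>, a, b) (\<phi> u)"
    have cont: "continuous_on (cbox a b) h" if "continuous_on U h" for h :: "real^2 \<Rightarrow> real"
      using that ab continuous_on_subset by blast
    have \<eta>: "continuous_on (cbox a b) ?\<eta>"
      using cont[OF Ck_on_imp_continuous[OF Js(5)[OF j \<phi>]]] by (simp add: o_def)
    have dP: "continuous_on (cbox a b) (dird v (?P \<phi> i))" for v i
      using C1(2)[OF t \<phi>] by (intro cont) (simp add: Ck_on_Suc)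
    have dens: "continuous_on (cbox a b) (area_density (F t) \<phi>)"
      using smooth_map_F[OF t] \<phi> unfolding smooth_map_def
      by (intro cont continuous_on_area_density chart_open) blast+
    have qR: "continuous_on (cbox a b) (?q t \<phi>)" "continuous_on (cbox a b) (?R \<phi>)"
      using Ck_on_imp_continuous[OF C1(1)[OF t \<phi>]] Ck_on_imp_continuous[OF C1(3)[OF t \<phi>]]
      by (simp_all add: cont)
    have io: "(\<lambda>u. ?\<eta> u * (dird (e2 1) (?P \<phi> 1) u + dird (e2 2) (?P \<phi> 2) u)) integrable_on cbox a b"
      "(\<lambda>u. ?\<eta> u * (?R \<phi> u * area_density (F t) \<phi> u)) integrable_on cbox a b"
      "(\<lambda>u. ?\<eta> u * (?q t \<phi> u * area_density (F t) \<phi> u)) integrable_on cbox a b"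
      by (intro integrable_continuous continuous_on_mult continuous_on_add \<eta> dP dens qR)+
    have "integral (cbox a b) (\<lambda>u. ?\<eta> u * dird time_dir (\<lambda>x. local_flow.q (Y \<phi>) x * local_flow.s (Y \<phi>) x) (u, t)) =
      integral (cbox a b) (\<lambda>u. ?\<eta> u * (dird (e2 1) (?P \<phi> 1) u + dird (e2 2) (?P \<phi> 2) u)
        - ?\<eta> u * (?R \<phi> u * area_density (F t) \<phi> u) - ?\<eta> u * (?q t \<phi> u * area_density (F t) \<phi> u))"
    proof (intro Henstock_Kurzweil_Integration.integral_cong)
      fix u assume "u \<in> cbox a b"
      then have u: "u \<in> U" using ab by blast
      interpret L: local_imcf "U \<times> I" "Y \<phi>" by (rule local_imcf[OF \<phi>])
      have "dird (e2 i) (?P \<phi> i) u = dird (space_dir i) (L.P i) (u, t)" for i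
        by (rule dird_slice[OF L.smooth_P u t])
      then have "dird time_dir (\<lambda>x. L.q x * L.s x) (u, t) = dird (e2 1) (?P \<phi> 1) u + dird (e2 2) (?P \<phi> 2) u
        - ?R \<phi> u * area_density (F t) \<phi> u - ?q t \<phi> u * area_density (F t) \<phi> u"
        using L.mass_density_evolution[of "(u, t)"] u t by (simp add: area_density_eq[OF \<phi> u t])
      then show "?\<eta> u * dird time_dir (\<lambda>x. L.q x * L.s x) (u, t) =
        ?\<eta> u * (dird (e2 1) (?P \<phi> 1) u + dird (e2 2) (?P \<phi> 2) u)
        - ?\<eta> u * (?R \<phi> u * area_density (F t) \<phi> u) - ?\<eta> u * (?q t \<phi> u * area_density (F t) \<phi> u)"
        by (simp only: right_diff_distrib)
    qed
    also have "\<dots> = integral (cbox a b) (\<lambda>u. ?\<eta> u * (dird (e2 1) (?P \<phi> 1) u + dird (e2 2) (?P \<phi> 2) u))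
      - integral (cbox a b) (\<lambda>u. ?\<eta> u * (?R \<phi> u * area_density (F t) \<phi> u))
      - integral (cbox a b) (\<lambda>u. ?\<eta> u * (?q t \<phi> u * area_density (F t) \<phi> u))"
      using io by (simp only: Henstock_Kurzweil_Integration.integral_diff integrable_diff)
    finally show "integral (cbox a b) (\<lambda>u. ?\<eta> u *
        dird time_dir (\<lambda>x. local_flow.q (Y \<phi>) x * local_flow.s (Y \<phi>) x) (u, t)) = \<dots>" .
  qed
  also have "\<dots> = (\<Sum>(U, \<phi>, a, b)\<in>Js.
      integral (cbox a b) (\<lambda>u. \<eta> (U, \<phi>, a, b) (\<phi> u) * (dird (e2 1) (?P \<phi> 1) u + dird (e2 2) (?P \<phi> 2) u)))
    - (\<Sum>(U, \<phi>, a, b)\<in>Js. integral (cbox a b) (\<lambda>u. \<eta> (U, \<phi>, a, b) (\<phi> u) * (?R \<phi> u * area_density (F t) \<phi> u)))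
    - (\<Sum>(U, \<phi>, a, b)\<in>Js. integral (cbox a b) (\<lambda>u. \<eta> (U, \<phi>, a, b) (\<phi> u) * (?q t \<phi> u * area_density (F t) \<phi> u)))"
    by (simp add: case_prod_unfold sum_subtractf)
  also have "(\<Sum>(U, \<phi>, a, b)\<in>Js.
      integral (cbox a b) (\<lambda>u. \<eta> (U, \<phi>, a, b) (\<phi> u) * (dird (e2 1) (?P \<phi> 1) u + dird (e2 2) (?P \<phi> 2) u))) = 0"
  proof (rule surface_divergence_theorem[OF pou smooth_map_F[OF t] _ C1(2)[OF t] flux_invariant[OF t]])
    show "area_density (F t) \<phi> u > 0" if "charts U \<phi>" "u \<in> U" for U \<phi> u
      using local_flow.s_pos[OF local_flow[OF that(1)]] that(2) t by (simp add: area_density_eq[OF that t])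
  qed
  also have "(\<Sum>(U, \<phi>, a, b)\<in>Js. integral (cbox a b)
      (\<lambda>u. \<eta> (U, \<phi>, a, b) (\<phi> u) * (?R \<phi> u * area_density (F t) \<phi> u))) = surface_integral cs (F t) ?R"
    by (rule surface_integral_partition[OF pou smooth_map_F[OF t] invariants(2)[OF t], symmetric])
      (rule Ck_on_imp_continuous[OF C1(3)[OF t]])
  also have "(\<Sum>(U, \<phi>, a, b)\<in>Js. integral (cbox a b)
      (\<lambda>u. \<eta> (U, \<phi>, a, b) (\<phi> u) * (?q t \<phi> u * area_density (F t) \<phi> u))) = surface_integral cs (F t) (?q t)"
    by (rule surface_integral_partition[OF pou smooth_map_F[OF t] invariants(1)[OF t], symmetric])
      (rule Ck_on_imp_continuous[OF C1(1)[OF t]])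
  finally have "((\<lambda>s. surface_integral cs (F s) (?q s)) has_real_derivative
      - surface_integral cs (F t) ?R - surface_integral cs (F t) (?q t)) (at t)" by simp
  then show ?thesis
    unfolding R_eq q_eq[OF t]
    by (rule has_field_derivative_transform_within_open[OF _ open_I t]) (simp add: q_eq)
qed

theorem modified_hawking_mass_derivative:
  assumes "t \<in> I"
  shows "((\<lambda>s. modified_hawking_mass cs (F s) (\<nu> s)) has_real_derivative
    surface_area cs (F t) * surface_integral cs (F t)
      (\<lambda>\<phi> u. grad_norm_sq (F t \<circ> \<phi>) (H t \<phi>) u / (H t \<phi> u)\<^sup>2)) (at t)"
  unfolding modified_hawking_mass_def
  by (rule derivative_eq_intros surface_area_derivative[OF assms] traceless_integral_derivative[OF assms] refl)+
    (simp add: algebra_simps)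

end

theorem proposition2:
  fixes M :: "'m::t2_space set" and cs :: "'m chart list" and I :: "real set"
    and F \<nu> :: "real \<Rightarrow> 'm \<Rightarrow> minkowski" and t :: real
  assumes "inverse_mean_curvature_flow M cs I F \<nu>"
    and "t \<in> I"
  shows "((\<lambda>s. modified_hawking_mass cs (F s) (\<nu> s)) has_real_derivative
      surface_area cs (F t) *
      surface_integral cs (F t) (\<lambda>\<phi> u.
        let H = mean_curv (F t \<circ> \<phi>) (\<nu> t \<circ> \<phi>) in grad_norm_sq (F t \<circ> \<phi>) H u / (H u)\<^sup>2))
      (at t)"
proof -
  interpret imcf M cs I F \<nu> by unfold_locales (rule assms(1))
  show ?thesis using modified_hawking_mass_derivative[OF assms(2)] by (simp add: H_def Let_def)
qed

end
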